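(* Let $f\in\mathcal{O}_2$ be such that $C=\{f=0\}$ is a reduced curve at $0\in\mathbb{C}^2$. Then, for all integers $k\ge0$, $$i^k(\mathcal{P}^{df},C)=\mu^k(C)+\nu(f)-1.$$
   Context: $\mathcal{O}_2=\mathbb{C}\{x,y\}$ is the ring of germs of holomorphic functions at $0\in\mathbb{C}^2$, $\mathfrak{m}$ is its maximal ideal, and $\mathfrak{m}^0=\mathcal{O}_2$. $\nu(f)$ is the order of vanishing of $f$ at $0$. $C=\{f=0\}$ with $f$ a reduced equation, and $\mu^k(C)=\dim_{\mathbb{C}}\mathcal{O}_2/(\langle f_x,f_y\rangle\mathfrak{m}^k)$. The $k$-th polar intersection number of $df$ with respect to $C$ is $$i^k(\mathcal{P}^{df},C)=\dim_{\mathbb{C}}\frac{\mathcal{O}_2}{\langle\alpha f_x+\beta f_y,\ f\rangle\,\mathfrak{m}^k},$$ where $[\alpha:\beta]\in\mathbb{P}^1$ is generic, i.e. belongs to a suitable nonempty Zariski-open subset of $\mathbb{P}^1$. *)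

theory Defs
  imports
    "HOL-Analysis.Analysis"
    "HOL-Computational_Algebra.Formal_Power_Series"
    "HOL-Algebra.Algebra"
begin

section \<open>The ring of convergent power series in two variables\<close>

text \<open>
  A power series in \<open>x, y\<close> is a power series in \<open>x\<close> whose coefficients are power series in \<open>y\<close>:
  the coefficient of \<open>x^i y^j\<close> in \<open>F\<close> is \<open>F $ i $ j\<close>.
  A germ of a holomorphic function at the origin is identified with its Taylor series, a series
  that converges absolutely on some polydisc around the origin.
\<close>

type_synonym series2 = "complex fps fps"

definition convergent2 :: "series2 \<Rightarrow> bool" where
  "convergent2 F \<longleftrightarrow>
     (\<exists>r>0. (\<lambda>(i, j). norm (fps_nth (fps_nth F i) j) * r ^ i * r ^ j) summable_on (UNIV :: (nat \<times> nat) set))"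

definition O2 :: "series2 ring" where
  "O2 = \<lparr>carrier = {F. convergent2 F}, mult = (*), one = 1, ring.zero = 0, ring.add = (+)\<rparr>"

definition const2 :: "complex \<Rightarrow> series2" where
  "const2 c = fps_const (fps_const c)"

definition dx :: "series2 \<Rightarrow> series2" where
  "dx F = fps_deriv F"

definition dy :: "series2 \<Rightarrow> series2" where
  "dy F = Abs_fps (\<lambda>i. fps_deriv (fps_nth F i))"

definition max_ideal :: "series2 set" where
  "max_ideal = {F \<in> carrier O2. fps_nth (fps_nth F 0) 0 = 0}"

text \<open>Powers and products of ideals are taken in the monoid of ideals, so the zeroth power is
  the whole ring.\<close>

definition max_ideal_power :: "nat \<Rightarrow> series2 set" where
  "max_ideal_power k = max_ideal [^]\<^bsub>ideals_set O2\<^esub> k"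

definition vanishing_order :: "series2 \<Rightarrow> nat" where
  "vanishing_order F = (LEAST n. \<exists>i j. i + j = n \<and> fps_nth (fps_nth F i) j \<noteq> 0)"

text \<open>\<open>f\<close> is a reduced equation of a curve through the origin: it vanishes at the origin, is not
  identically zero, and has no multiple factors.\<close>

definition reduced_equation :: "series2 \<Rightarrow> bool" where
  "reduced_equation f \<longleftrightarrow> f \<in> max_ideal \<and> f \<noteq> 0 \<and>
     (\<forall>g\<in>carrier O2. (g \<otimes>\<^bsub>O2\<^esub> g) divides\<^bsub>O2\<^esub> f \<longrightarrow> g \<in> Units O2)"


section \<open>Dimensions of quotients\<close>

text \<open>\<open>has_codim J n\<close> says that the complex vector space \<open>O2 / J\<close> is finite-dimensional, of
  dimension \<open>n\<close>. The scalars are the classes of the constants; they form a copy of the field of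
  complex numbers, except when \<open>J\<close> is the whole ring, where the quotient is \<open>{0}\<close> and \<open>n = 0\<close>.\<close>

definition has_codim :: "series2 set \<Rightarrow> nat \<Rightarrow> bool" where
  "has_codim J n \<longleftrightarrow>
     ring.dimension (O2 Quot J) n (range (\<lambda>c. J +>\<^bsub>O2\<^esub> const2 c)) (carrier (O2 Quot J))"

definition is_mu :: "nat \<Rightarrow> series2 \<Rightarrow> nat \<Rightarrow> bool" where
  "is_mu k f n \<longleftrightarrow> has_codim ((Idl\<^bsub>O2\<^esub> {dx f, dy f}) \<cdot>\<^bsub>O2\<^esub> max_ideal_power k) n"


section \<open>The projective line and generic points\<close>

definition hpoint :: "complex \<Rightarrow> complex \<Rightarrow> (complex \<times> complex) set" where
  "hpoint \<alpha> \<beta> = {(c * \<alpha>, c * \<beta>) | c. c \<noteq> 0}"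

definition P1 :: "(complex \<times> complex) set set" where
  "P1 = {hpoint \<alpha> \<beta> | \<alpha> \<beta>. (\<alpha>, \<beta>) \<noteq> (0, 0)}"

text \<open>A pair \<open>(d, a)\<close> encodes the binary form \<open>\<Sum>i\<le>d. a i * \<alpha>^i * \<beta>^(d - i)\<close> of degree \<open>d\<close>.\<close>

definition binary_form :: "nat \<times> (nat \<Rightarrow> complex) \<Rightarrow> complex \<Rightarrow> complex \<Rightarrow> complex" where
  "binary_form q \<alpha> \<beta> = (\<Sum>i\<le>fst q. snd q i * \<alpha> ^ i * \<beta> ^ (fst q - i))"

definition zariski_open :: "(complex \<times> complex) set set \<Rightarrow> bool" where
  "zariski_open U \<longleftrightarrow>
     (\<exists>S. U = {p \<in> P1. \<exists>q\<in>S. \<forall>(\<alpha>, \<beta>)\<in>p. binary_form q \<alpha> \<beta> \<noteq> 0})"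

definition is_polar_intersection :: "nat \<Rightarrow> series2 \<Rightarrow> nat \<Rightarrow> bool" where
  "is_polar_intersection k f n \<longleftrightarrow>
     (\<exists>U. zariski_open U \<and> U \<noteq> {} \<and>
       (\<forall>\<alpha> \<beta>. hpoint \<alpha> \<beta> \<in> U \<longrightarrow>
          has_codim ((Idl\<^bsub>O2\<^esub> {const2 \<alpha> * dx f + const2 \<beta> * dy f, f}) \<cdot>\<^bsub>O2\<^esub> max_ideal_power k) n))"


section \<open>Basic properties\<close>

lemma convergent2_iff_bound:
  "convergent2 F \<longleftrightarrow> (\<exists>M\<ge>0. \<exists>R>0. \<forall>i j. norm (fps_nth (fps_nth F i) j) \<le> M * R ^ (i + j))"
proof
  assume "convergent2 F"
  then obtain r where r: "r > 0" and
    s: "(\<lambda>(i, j). norm (fps_nth (fps_nth F i) j) * r ^ i * r ^ j) summable_on (UNIV :: (nat \<times> nat) set)"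
      (is "?f summable_on _")
    unfolding convergent2_def by blast
  have nn: "?f p \<ge> 0" for p using r by (cases p) simp
  define M where "M = infsum ?f UNIV"
  have "norm (fps_nth (fps_nth F i) j) \<le> M * (1 / r) ^ (i + j)" for i j
  proof -
    have "sum ?f {(i, j)} \<le> M"
      unfolding M_def by (rule finite_sum_le_infsum[OF s]) (use nn in auto)
    then show ?thesis using r by (simp add: field_simps power_add power_divide)
  qed
  moreover have "M \<ge> 0" unfolding M_def by (rule infsum_nonneg) (use nn in auto)
  moreover have "1 / r > 0" using r by simp
  ultimately show "\<exists>M\<ge>0. \<exists>R>0. \<forall>i j. norm (fps_nth (fps_nth F i) j) \<le> M * R ^ (i + j)" by blast
next
  assume "\<exists>M\<ge>0. \<exists>R>0. \<forall>i j. norm (fps_nth (fps_nth F i) j) \<le> M * R ^ (i + j)"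
  then obtain M R where M: "M \<ge> 0" and R: "R > 0"
    and b: "\<And>i j. norm (fps_nth (fps_nth F i) j) \<le> M * R ^ (i + j)" by blast
  define r where "r = 1 / (2 * R)"
  have r: "r > 0" using R by (simp add: r_def)
  have g: "((\<lambda>n. (1 / 2 :: real) ^ n) has_sum 2) UNIV"
    using geometric_sums[of "1 / 2 :: real"]
    by (intro sums_nonneg_imp_has_sum) auto
  have "(\<lambda>(i, j). (1 / 2 :: real) ^ i * (1 / 2) ^ j) summable_on (UNIV \<times> UNIV)"
    by (rule summable_on_SigmaI[where g = "\<lambda>i. (1 / 2) ^ i * 2"])
       (auto intro!: has_sum_cmult_right summable_on_cmult_left g has_sum_imp_summable[OF g])
  then have "(\<lambda>p. M * (case p of (i, j) \<Rightarrow> (1 / 2 :: real) ^ i * (1 / 2) ^ j)) summable_on UNIV"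
    by (intro summable_on_cmult_right) simp
  then have "(\<lambda>(i, j). norm (fps_nth (fps_nth F i) j) * r ^ i * r ^ j) summable_on (UNIV :: (nat \<times> nat) set)"
  proof (rule summable_on_comparison_test)
    fix p :: "nat \<times> nat"
    obtain i j where p: "p = (i, j)" by (cases p)
    have "norm (fps_nth (fps_nth F i) j) * r ^ i * r ^ j
          \<le> (M * R ^ (i + j)) * (r ^ i * r ^ j)"
      using mult_right_mono[OF b[of i j], of "r ^ i * r ^ j"] r by (simp add: mult.assoc)
    also have "\<dots> = M * ((R * r) ^ i * (R * r) ^ j)"
      by (simp add: power_add power_mult_distrib mult_ac)
    also have "R * r = 1 / 2" using R by (simp add: r_def)
    finally show "(case p of (i, j) \<Rightarrow> norm (fps_nth (fps_nth F i) j) * r ^ i * r ^ j)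
        \<le> M * (case p of (i, j) \<Rightarrow> (1 / 2) ^ i * (1 / 2) ^ j)" by (simp add: p)
  qed (use r in \<open>auto split: prod.splits\<close>)
  then show "convergent2 F" unfolding convergent2_def using r by blast
qed

lemma convergent2I:
  assumes "M \<ge> 0" "R > 0" "\<And>i j. norm (fps_nth (fps_nth F i) j) \<le> M * R ^ (i + j)"
  shows "convergent2 F"
  using assms convergent2_iff_bound by blast

lemma convergent2E:
  assumes "convergent2 F"
  obtains M R where "M \<ge> 0" "R \<ge> 1" "\<And>i j. norm (fps_nth (fps_nth F i) j) \<le> M * R ^ (i + j)"
proof -
  from assms obtain M R where M: "M \<ge> 0" and R: "R > 0"
    and b: "\<And>i j. norm (fps_nth (fps_nth F i) j) \<le> M * R ^ (i + j)"
    using convergent2_iff_bound by blast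
  have "norm (fps_nth (fps_nth F i) j) \<le> M * max R 1 ^ (i + j)" for i j
    using b[of i j] mult_left_mono[OF power_mono[of R "max R 1" "i + j"] M] R
    by linarith
  then show ?thesis using that[of M "max R 1"] M by simp
qed

lemma convergent2_const2: "convergent2 (const2 c)"
  by (rule convergent2I[of "norm c" 1]) (auto simp: const2_def)

lemma convergent2_0: "convergent2 0" and convergent2_1: "convergent2 1"
  using convergent2_const2[of 0] convergent2_const2[of 1] by (simp_all add: const2_def)

lemma convergent2_add:
  assumes "convergent2 F" "convergent2 G" shows "convergent2 (F + G)"
proof -
  obtain M R where F: "M \<ge> 0" "R \<ge> 1" "\<And>i j. norm (fps_nth (fps_nth F i) j) \<le> M * R ^ (i + j)"
    using convergent2E[OF assms(1)] by blast
  obtain N S where G: "N \<ge> 0" "S \<ge> 1" "\<And>i j. norm (fps_nth (fps_nth G i) j) \<le> N * S ^ (i + j)"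
    using convergent2E[OF assms(2)] by blast
  show ?thesis
  proof (rule convergent2I[of "M + N" "max R S"])
    fix i j
    have "M * R ^ (i + j) \<le> M * max R S ^ (i + j)" "N * S ^ (i + j) \<le> N * max R S ^ (i + j)"
      using F G by (auto intro!: mult_left_mono power_mono)
    then show "norm (fps_nth (fps_nth (F + G) i) j) \<le> (M + N) * max R S ^ (i + j)"
      using norm_triangle_ineq[of "fps_nth (fps_nth F i) j" "fps_nth (fps_nth G i) j"]
        F(3)[of i j] G(3)[of i j] by (simp add: distrib_right)
  qed (use F G in auto)
qed

lemma convergent2_uminus: "convergent2 F \<Longrightarrow> convergent2 (- F)"
  by (simp add: convergent2_def)

lemma Suc_le_2_power: "real (Suc n) \<le> 2 ^ n"
  by (induction n) auto

lemma convergent2_mult: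
  assumes "convergent2 F" "convergent2 G" shows "convergent2 (F * G)"
proof -
  obtain M R where F: "M \<ge> 0" "R \<ge> 1" "\<And>i j. norm (fps_nth (fps_nth F i) j) \<le> M * R ^ (i + j)"
    using convergent2E[OF assms(1)] by blast
  obtain N S where G: "N \<ge> 0" "S \<ge> 1" "\<And>i j. norm (fps_nth (fps_nth G i) j) \<le> N * S ^ (i + j)"
    using convergent2E[OF assms(2)] by blast
  define T where "T = max R S"
  have T: "T \<ge> 1" using F by (simp add: T_def)
  show ?thesis
  proof (rule convergent2I[of "M * N" "2 * T"])
    fix i j
    have "norm (fps_nth (fps_nth (F * G) i) j)
      = norm (\<Sum>k=0..i. \<Sum>l=0..j. fps_nth (fps_nth F k) l * fps_nth (fps_nth G (i - k)) (j - l))"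
      by (simp add: fps_mult_nth fps_sum_nth)
    also have "\<dots> \<le> (\<Sum>k=0..i. \<Sum>l=0..j. M * N * T ^ (i + j))"
    proof (intro sum_norm_le)
      fix k l assume kl: "k \<in> {0..i}" "l \<in> {0..j}"
      have a: "norm (fps_nth (fps_nth F k) l) \<le> M * T ^ (k + l)"
        using F(3)[of k l] mult_left_mono[OF power_mono[of R T "k + l"] F(1)] F(2)
        by (simp add: T_def)
      have b: "norm (fps_nth (fps_nth G (i - k)) (j - l)) \<le> N * T ^ (i - k + (j - l))"
        using G(3)[of "i - k" "j - l"]
          mult_left_mono[OF power_mono[of S T "i - k + (j - l)"] G(1)] G(2)
        by (simp add: T_def)
      have "norm (fps_nth (fps_nth F k) l * fps_nth (fps_nth G (i - k)) (j - l))
         \<le> (M * T ^ (k + l)) * (N * T ^ (i - k + (j - l)))"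
        unfolding norm_mult by (rule mult_mono[OF a b]) (use F T in auto)
      also have "\<dots> = M * N * T ^ ((k + l) + (i - k + (j - l)))"
        by (simp only: power_add mult_ac)
      also have "(k + l) + (i - k + (j - l)) = i + j" using kl by simp
      finally show "norm (fps_nth (fps_nth F k) l * fps_nth (fps_nth G (i - k)) (j - l))
         \<le> M * N * T ^ (i + j)" .
    qed
    also have "\<dots> = (M * N * T ^ (i + j)) * (real (Suc i) * real (Suc j))"
      by simp
    also have "\<dots> \<le> (M * N * T ^ (i + j)) * (2 ^ i * 2 ^ j)"
      by (intro mult_left_mono mult_mono Suc_le_2_power) (use F G T in auto)
    also have "\<dots> = M * N * (2 * T) ^ (i + j)"
      by (simp add: power_mult_distrib power_add mult_ac)
    finally show "norm (fps_nth (fps_nth (F * G) i) j) \<le> M * N * (2 * T) ^ (i + j)" .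
  qed (use F G T in auto)
qed

lemma convergent2_dx: assumes "convergent2 F" shows "convergent2 (dx F)"
proof -
  obtain M R where F: "M \<ge> 0" "R \<ge> 1" "\<And>i j. norm (fps_nth (fps_nth F i) j) \<le> M * R ^ (i + j)"
    using convergent2E[OF assms] by blast
  show ?thesis
  proof (rule convergent2I[of "M * R" "2 * R"])
    fix i j
    have *: "fps_nth (fps_nth (dx F) i) j = of_nat (Suc i) * fps_nth (fps_nth F (Suc i)) j"
    proof -
      have "fps_nth (of_nat n * (h :: complex fps)) j = of_nat n * fps_nth h j" for n h
        by (induction n) (simp_all add: distrib_right)
      from this[of "Suc i"] show ?thesis by (simp add: dx_def)
    qed
    have "norm (fps_nth (fps_nth (dx F) i) j) = real (Suc i) * norm (fps_nth (fps_nth F (Suc i)) j)"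
      unfolding * norm_mult norm_of_nat ..
    also have "\<dots> \<le> 2 ^ (i + j) * (M * R ^ (Suc i + j))"
    proof (rule mult_mono[OF _ F(3)])
      show "real (Suc i) \<le> 2 ^ (i + j)"
        using Suc_le_2_power[of i] power_increasing[of i "i + j" "2::real"] by linarith
    qed auto
    finally show "norm (fps_nth (fps_nth (dx F) i) j) \<le> M * R * (2 * R) ^ (i + j)"
      by (simp add: power_mult_distrib mult_ac)
  qed (use F in auto)
qed

lemma convergent2_dy: assumes "convergent2 F" shows "convergent2 (dy F)"
proof -
  obtain M R where F: "M \<ge> 0" "R \<ge> 1" "\<And>i j. norm (fps_nth (fps_nth F i) j) \<le> M * R ^ (i + j)"
    using convergent2E[OF assms] by blast
  show ?thesis
  proof (rule convergent2I[of "M * R" "2 * R"])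
    fix i j
    have *: "fps_nth (fps_nth (dy F) i) j = of_nat (Suc j) * fps_nth (fps_nth F i) (Suc j)"
      by (simp add: dy_def)
    have "norm (fps_nth (fps_nth (dy F) i) j) = real (Suc j) * norm (fps_nth (fps_nth F i) (Suc j))"
      unfolding * norm_mult norm_of_nat ..
    also have "\<dots> \<le> 2 ^ (i + j) * (M * R ^ (i + Suc j))"
    proof (rule mult_mono[OF _ F(3)])
      show "real (Suc j) \<le> 2 ^ (i + j)"
        using Suc_le_2_power[of j] power_increasing[of j "i + j" "2::real"] by linarith
    qed auto
    finally show "norm (fps_nth (fps_nth (dy F) i) j) \<le> M * R * (2 * R) ^ (i + j)"
      by (simp add: power_mult_distrib mult_ac)
  qed (use F in auto)
qed

lemma O2_simps [simp]:
  "F \<in> carrier O2 \<longleftrightarrow> convergent2 F" "F \<otimes>\<^bsub>O2\<^esub> G = F * G" "F \<oplus>\<^bsub>O2\<^esub> G = F + G"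
  "\<one>\<^bsub>O2\<^esub> = 1" "\<zero>\<^bsub>O2\<^esub> = 0"
  by (simp_all add: O2_def)

lemma cring_O2: "cring O2"
proof (rule cringI)
  show "abelian_group O2"
  proof (rule abelian_groupI)
    fix F assume "F \<in> carrier O2"
    then show "\<exists>G\<in>carrier O2. G \<oplus>\<^bsub>O2\<^esub> F = \<zero>\<^bsub>O2\<^esub>"
      by (intro bexI[of _ "- F"]) (auto simp: convergent2_uminus)
  qed (auto simp: convergent2_add convergent2_0 algebra_simps)
  show "comm_monoid O2"
    by (rule comm_monoidI) (auto simp: convergent2_mult convergent2_1 algebra_simps)
qed (auto simp: algebra_simps)

interpretation O2: cring O2 by (rule cring_O2)

lemma max_ideal_is_maximal: "maximalideal max_ideal O2"
proof (rule maximalidealI)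
  show "ideal max_ideal O2"
  proof (rule idealI[OF O2.ring_axioms])
    show "subgroup max_ideal (add_monoid O2)"
    proof
      fix F assume F: "F \<in> max_ideal"
      then have "F \<in> carrier O2" by (simp add: max_ideal_def)
      then have "inv\<^bsub>add_monoid O2\<^esub> F = - F"
        using O2.minus_equality[of "- F" F]
        by (simp add: a_inv_def convergent2_uminus)
      then show "inv\<^bsub>add_monoid O2\<^esub> F \<in> max_ideal"
        using F by (simp add: max_ideal_def convergent2_uminus)
    qed (auto simp: max_ideal_def convergent2_add convergent2_0)
  qed (auto simp: max_ideal_def convergent2_mult fps_mult_nth)
  show "carrier O2 \<noteq> max_ideal"
  proof
    assume "carrier O2 = max_ideal"
    moreover have "1 \<in> carrier O2" using convergent2_1 by simp
    ultimately have "1 \<in> max_ideal" by (simp only:)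
    then show False by (simp add: max_ideal_def)
  qed
  fix J assume J: "ideal J O2" "max_ideal \<subseteq> J" "J \<subseteq> carrier O2"
  show "J = max_ideal \<or> J = carrier O2"
  proof (rule disjCI)
    assume "J \<noteq> carrier O2"
    interpret J: ideal J O2 by (rule J(1))
    have "F \<in> max_ideal" if F: "F \<in> J" for F
    proof (rule ccontr)
      assume nF: "F \<notin> max_ideal"
      have cF: "convergent2 F" using F J(3) by auto
      define c where "c = fps_nth (fps_nth F 0) 0"
      have c: "c \<noteq> 0" using nF cF by (simp add: max_ideal_def c_def)
      have "convergent2 (const2 c + - F)"
        by (intro convergent2_add convergent2_uminus convergent2_const2 cF)
      then have "const2 c + - F \<in> max_ideal"
        by (simp add: max_ideal_def c_def const2_def)
      then have "(const2 c + - F) \<oplus>\<^bsub>O2\<^esub> F \<in> J" using J(2) F by (intro J.a_closed) auto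
      then have "const2 c \<in> J" by simp
      then have "const2 (1 / c) \<otimes>\<^bsub>O2\<^esub> const2 c \<in> J"
        by (intro J.I_l_closed) (simp_all add: convergent2_const2)
      then have "\<one>\<^bsub>O2\<^esub> \<in> J" using c by (simp add: const2_def)
      then show False using J.one_imp_carrier \<open>J \<noteq> carrier O2\<close> by blast
    qed
    then show "J = max_ideal" using J(2) by blast
  qed
qed

lemma max_ideal_power_0: "max_ideal_power 0 = carrier O2"
  by (simp add: max_ideal_power_def ideals_set_def nat_pow_def)

lemma max_ideal_power_Suc: "max_ideal_power (Suc k) = max_ideal_power k \<cdot>\<^bsub>O2\<^esub> max_ideal"
  by (simp add: max_ideal_power_def ideals_set_def nat_pow_def)

end

theory Submission
  imports
    Defs
    "HOL-Computational_Algebra.Fundamental_Theorem_Algebra"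
    "HOL-Computational_Algebra.Polynomial_FPS"
    "HOL-Computational_Algebra.Formal_Laurent_Series"
begin

text \<open>
  Write \<open>g = s f_x + f_y\<close> with generic \<open>s\<close>. After a ramification \<open>y = t^N\<close> the polar curve \<open>g = 0\<close> splits
  into smooth formal branches \<open>x = \<phi>(t)\<close> (Puiseux), and intersection numbers with \<open>g\<close> become sums of
  orders in \<open>t\<close>, divided by \<open>N\<close>. Along a branch \<open>d/dt f = f_x * d/dt (x - s y)\<close>, so the order of \<open>f\<close> is the
  sum of the orders of \<open>f_x\<close> and of \<open>x - s y\<close>. Summing over the branches gives
  \<open>i(g, f) = i(g, f_x) + i(g, x - s y) = \<mu> + \<nu> - 1\<close>, which is the case \<open>k = 0\<close>.

  For general \<open>k\<close>, if the order of \<open>g\<close> is at most that of \<open>h\<close>, then the difference between the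
  codimensions of \<open>\<langle>g, h\<rangle> \<mm>^k\<close> and \<open>\<langle>g, h\<rangle>\<close> depends only on \<open>g\<close> and \<open>k\<close>; apply this to \<open>h = f\<close> and
  \<open>h = f_x\<close>.

  The numbers are computed with formal series. Convergence enters twice: reducedness is turned into
  a relation \<open>0 \<noteq> b(y) \<in> \<langle>f, g\<rangle>\<close> by convergent Weierstrass division, and at the end Nakayama's lemma
  identifies the convergent ideals with the convergent parts of the formal ones.
\<close>

unbundle no vec_syntax
unbundle fps_syntax

hide_const (open) up_ring.monom up_ring.coeff Polynomials.degree Coset.order

section \<open>Dimensions of quotients by chains of subspaces\<close>

text \<open>The Puiseux roots are only formal, whereas \<open>reduced_equation\<close> speaks of
  convergent factors, so a multiple formal factor of \<open>f\<close> is not excluded beforehand.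
  The relation \<open>b(y)\<close> bridges this gap: it is found among convergent series, and read
  formally it says that \<open>f\<close> vanishes on no branch of the polar curve, so that all
  orders in the count are finite. Multiple branches of the polar curve do no harm, since its linear
  factors are listed with repetition. Genericity of \<open>s\<close> means two things:
  \<open>x = s y\<close> is not tangent to the curve, so that it meets \<open>g\<close> with
  multiplicity \<open>\<nu> - 1\<close>, and \<open>y\<close> does not divide \<open>g\<close>, so
  that \<open>g\<close> is regular in \<open>x\<close>. For every \<open>s\<close>, \<open>g\<close>
  and \<open>f_x\<close> generate the same ideal as \<open>f_x\<close> and \<open>f_y\<close>; this
  is how \<open>\<mu>^k\<close> enters. The division by \<open>N\<close> is legitimate because
  series in \<open>t\<close> form a free module of rank \<open>N\<close> over series in
  \<open>t^N\<close>. Dimensions are counted as lengths of flags of subspaces, which makes it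
  possible to move them between ideals and between the two rings one vector at a time.\<close>

locale vector_space_quotient = vector_space scale
  for scale :: "'a::field \<Rightarrow> 'b::ab_group_add \<Rightarrow> 'b"
begin

text \<open>The number counts the lines added in a flag from \<open>J\<close> to \<open>V\<close>,
  so finite dimension of \<open>V / J\<close> is expressed without forming a quotient. The clauses
  have the shape of the inductive \<open>dimension\<close> behind \<open>has_codim\<close>, which
  lets \<open>has_codimI\<close> follow a flag step by step.\<close>

inductive quot_dim :: "'b set \<Rightarrow> 'b set \<Rightarrow> nat \<Rightarrow> bool" for J where
  quot_dim_0: "quot_dim J J 0"
| quot_dim_Suc: "quot_dim J V n \<Longrightarrow> v \<notin> V \<Longrightarrow> quot_dim J {x. \<exists>c. x - scale c v \<in> V} (Suc n)"

lemma subspace_line_extension: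
  assumes "subspace V" shows "subspace {x. \<exists>c. x - scale c v \<in> V}"
proof (rule subspaceI)
  show "0 \<in> {x. \<exists>c. x - scale c v \<in> V}"
    using subspace_0[OF assms] by (auto intro!: exI[of _ 0])
next
  fix x y assume "x \<in> {x. \<exists>c. x - scale c v \<in> V}" "y \<in> {x. \<exists>c. x - scale c v \<in> V}"
  then obtain c d where "x - scale c v \<in> V" "y - scale d v \<in> V" by auto
  from subspace_add[OF assms this] have "x + y - scale (c + d) v \<in> V"
    by (simp add: algebra_simps)
  then show "x + y \<in> {x. \<exists>c. x - scale c v \<in> V}" by blast
next
  fix k x assume "x \<in> {x. \<exists>c. x - scale c v \<in> V}"
  then obtain c where "x - scale c v \<in> V" by auto
  from subspace_scale[OF assms this] have "scale k x - scale (k * c) v \<in> V"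
    by (simp add: scale_right_diff_distrib)
  then show "scale k x \<in> {x. \<exists>c. x - scale c v \<in> V}" by blast
qed

lemma subset_line_extension: "V \<subseteq> {x. \<exists>c. x - scale c v \<in> V}"
  by (auto intro!: exI[of _ 0])

lemma quot_dim_subspace:
  assumes "quot_dim J V n" "subspace J" shows "subspace V" "J \<subseteq> V"
proof -
  have "subspace V \<and> J \<subseteq> V"
    using assms
  proof (induction rule: quot_dim.induct)
    case (quot_dim_Suc V n v)
    then show ?case using subspace_line_extension[of V v] subset_line_extension[of V v] by blast
  qed auto
  then show "subspace V" "J \<subseteq> V" by auto
qed

lemma line_extension_replace:
  assumes "subspace V" "u - scale c v \<in> V" "c \<noteq> 0"
  shows "{x. \<exists>c. x - scale c v \<in> V} = {x. \<exists>c. x - scale c u \<in> V}"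
proof safe
  fix x d assume "x - scale d v \<in> V"
  from subspace_diff[OF assms(1) this subspace_scale[OF assms(1) assms(2), of "d / c"]]
  have "x - scale (d / c) u \<in> V" using assms(3) by (simp add: algebra_simps)
  then show "\<exists>c. x - scale c u \<in> V" by blast
next
  fix x d assume "x - scale d u \<in> V"
  from subspace_add[OF assms(1) this subspace_scale[OF assms(1) assms(2), of d]]
  have "x - scale (d * c) v \<in> V" by (simp add: algebra_simps)
  then show "\<exists>c. x - scale c v \<in> V" by blast
qed

text \<open>Nothing lies strictly between a subspace and its extension by a line, and any vector
  outside the subspace can take over the role of \<open>v\<close>.\<close>

lemma line_extension_eq:
  assumes "subspace V" "subspace W" "V \<subseteq> W" "W \<subseteq> {x. \<exists>c. x - scale c v \<in> V}"
    "u \<in> W" "u \<notin> V"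
  shows "W = {x. \<exists>c. x - scale c v \<in> V}" "W = {x. \<exists>c. x - scale c u \<in> V}"
proof -
  obtain c where c: "u - scale c v \<in> V" using assms by blast
  have "c \<noteq> 0" using c assms(6) by auto
  note eq = line_extension_replace[OF assms(1) c this]
  have "{x. \<exists>c. x - scale c u \<in> V} \<subseteq> W"
  proof safe
    fix x c assume "x - scale c u \<in> V"
    then have "x - scale c u + scale c u \<in> W"
      using assms subspace_add subspace_scale by blast
    then show "x \<in> W" by simp
  qed
  then show "W = {x. \<exists>c. x - scale c v \<in> V}" "W = {x. \<exists>c. x - scale c u \<in> V}"
    using assms(4) eq by auto
qed

lemma quot_dim_trans:
  assumes "quot_dim I V n" "quot_dim J I m" shows "quot_dim J V (m + n)"
  using assms(1)
proof (induction rule: quot_dim.induct)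
  case (quot_dim_Suc V n v)
  then show ?case using quot_dim.quot_dim_Suc[of J V "m + n" v] by simp
qed (use assms in simp)

text \<open>The Jordan--Hoelder argument: two different hyperplanes of \<open>V\<close> meet in a hyperplane of either.\<close>

lemma quot_dim_hyperplane:
  assumes "quot_dim J V n" "subspace J" "subspace W" "J \<subseteq> W" "u \<notin> W"
    "V = {x. \<exists>c. x - scale c u \<in> W}"
  shows "\<exists>m. n = Suc m \<and> quot_dim J W m"
  using assms
proof (induction arbitrary: W u rule: quot_dim.induct)
  case quot_dim_0
  then have "u \<in> J" by (auto simp: subspace_0 intro!: exI[of _ 1])
  then show ?case using quot_dim_0 by blast
next
  case (quot_dim_Suc V n v W u)
  let ?V = "{x. \<exists>c. x - scale c v \<in> V}"
  have sV: "subspace V" and JV: "J \<subseteq> V"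
    using quot_dim_subspace quot_dim_Suc by blast+
  have WV: "W \<subseteq> ?V" using subset_line_extension[of W u] quot_dim_Suc.prems(5) by blast
  show ?case
  proof (cases "W \<subseteq> V")
    case True
    have "v \<in> ?V" using subspace_0[OF sV] by (auto intro!: exI[of _ 1])
    have "V \<subseteq> {x. \<exists>c. x - scale c u \<in> W}" using subset_line_extension[of V v] quot_dim_Suc.prems(5) by blast
    have "V = W"
    proof (rule ccontr)
      assume "V \<noteq> W"
      then obtain a where "a \<in> V" "a \<notin> W" using True by blast
      from line_extension_eq(1)[OF quot_dim_Suc.prems(2) sV True _ this, of u]
      have "V = ?V" using \<open>V \<subseteq> {x. \<exists>c. x - scale c u \<in> W}\<close> quot_dim_Suc.prems(5) by blast
      then show False using \<open>v \<in> ?V\<close> quot_dim_Suc.hyps by blast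
    qed
    then show ?thesis using quot_dim_Suc.hyps by blast
  next
    case False
    then obtain w where w: "w \<in> W" "w \<notin> V" by blast
    have sI: "subspace (W \<inter> V)" using subspace_inter quot_dim_Suc.prems sV by blast
    have W: "W = {x. \<exists>c. x - scale c w \<in> W \<inter> V}"
    proof
      show "W \<subseteq> {x. \<exists>c. x - scale c w \<in> W \<inter> V}"
      proof
        fix x assume x: "x \<in> W"
        have "w \<in> ?V" using w WV by blast
        then obtain c where c: "w - scale c v \<in> V" by blast
        have c0: "c \<noteq> 0" using c w by auto
        have "x \<in> {x. \<exists>c. x - scale c w \<in> V}"
          using line_extension_replace[OF sV c c0] x WV by blast
        then show "x \<in> {x. \<exists>c. x - scale c w \<in> W \<inter> V}"
          using subspace_diff[OF quot_dim_Suc.prems(2) x]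
            subspace_scale[OF quot_dim_Suc.prems(2) w(1)] by blast
      qed
      show "{x. \<exists>c. x - scale c w \<in> W \<inter> V} \<subseteq> W"
      proof safe
        fix x c assume "x - scale c w \<in> W"
        from subspace_add[OF quot_dim_Suc.prems(2) this
            subspace_scale[OF quot_dim_Suc.prems(2) w(1), of c]]
        show "x \<in> W" by simp
      qed
    qed
    have "\<not> V \<subseteq> W"
    proof
      assume "V \<subseteq> W"
      from line_extension_eq(1)[OF sV quot_dim_Suc.prems(2) this WV w]
      have "W = {x. \<exists>c. x - scale c u \<in> W}" using quot_dim_Suc.prems(5) by simp
      moreover have "u \<in> {x. \<exists>c. x - scale c u \<in> W}"
        using subspace_0[OF quot_dim_Suc.prems(2)] by (auto intro!: exI[of _ 1])
      ultimately show False using quot_dim_Suc.prems by blast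
    qed
    then obtain u' where u': "u' \<in> V" "u' \<notin> W" by blast
    have "u' \<in> ?V" using u' subset_line_extension by blast
    then obtain c where c: "u' - scale c u \<in> W" using quot_dim_Suc.prems(5) by blast
    have c0: "c \<noteq> 0" using c u' by auto
    have V: "V = {x. \<exists>c. x - scale c u' \<in> W \<inter> V}"
    proof
      show "V \<subseteq> {x. \<exists>c. x - scale c u' \<in> W \<inter> V}"
      proof
        fix x assume x: "x \<in> V"
        then have "x \<in> {x. \<exists>c. x - scale c u \<in> W}"
          using subset_line_extension[of V v] quot_dim_Suc.prems(5) by blast
        then obtain d where "x - scale d u' \<in> W"
          using line_extension_replace[OF quot_dim_Suc.prems(2) c c0] by blast
        moreover have "x - scale d u' \<in> V"
          using subspace_diff[OF sV x] subspace_scale[OF sV u'(1)] by blast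
        ultimately show "x \<in> {x. \<exists>c. x - scale c u' \<in> W \<inter> V}" by blast
      qed
      show "{x. \<exists>c. x - scale c u' \<in> W \<inter> V} \<subseteq> V"
      proof safe
        fix x c assume "x - scale c u' \<in> V"
        from subspace_add[OF sV this subspace_scale[OF sV u'(1), of c]]
        show "x \<in> V" by simp
      qed
    qed
    obtain m where m: "n = Suc m" "quot_dim J (W \<inter> V) m"
      using quot_dim_Suc.IH[OF \<open>subspace J\<close> sI _ _ V] JV quot_dim_Suc.prems(3) u' by blast
    have "quot_dim J W (Suc m)"
      using quot_dim.quot_dim_Suc[OF m(2), of w] w W by simp
    then show ?thesis using m by blast
  qed
qed

lemma quot_dim_unique:
  assumes "quot_dim J V n" "quot_dim J V m" "subspace J" shows "m = n"
  using assms(2,1)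
proof (induction arbitrary: n rule: quot_dim.induct)
  case quot_dim_0
  from this show ?case
  proof (cases rule: quot_dim.cases)
    case (quot_dim_Suc V k v)
    then have "J \<subseteq> V" "subspace V" using quot_dim_subspace assms(3) by blast+
    moreover have "v \<in> J" using quot_dim_Suc subspace_0[OF \<open>subspace V\<close>]
      by (auto intro!: exI[of _ 1])
    ultimately show ?thesis using quot_dim_Suc by blast
  qed simp
next
  case (quot_dim_Suc V k v)
  then have "J \<subseteq> V" "subspace V" using quot_dim_subspace assms(3) by blast+
  from quot_dim_hyperplane[OF quot_dim_Suc.prems assms(3) this(2,1) quot_dim_Suc.hyps(2)]
  show ?case using quot_dim_Suc.IH by blast
qed

text \<open>Adding \<open>W\<close> to every member of the flag gives a flag that starts at
  \<open>W\<close>; a step collapses exactly when its vector already lies in \<open>add V\<close>.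
  As long as no step has collapsed, \<open>W \<inter> V\<close> is still \<open>J\<close>. This
  yields the strict inequality, on which the induction in \<open>power_mem_finite_codim\<close>
  runs.\<close>

lemma quot_dim_supset:
  assumes "quot_dim J V n" "subspace J" "subspace W" "J \<subseteq> W" "W \<subseteq> V"
  shows "\<exists>m\<le>n. quot_dim W V m \<and> (W \<noteq> J \<longrightarrow> m < n)"
proof -
  define add where "add U = {x. \<exists>u\<in>U. \<exists>w\<in>W. x = u + w}" for U
  have "\<exists>m\<le>n. quot_dim W (add V) m \<and> (W \<inter> V \<noteq> J \<longrightarrow> m < n)"
    using assms(1)
  proof (induction rule: quot_dim.induct)
    case quot_dim_0
    have "add J = W"
    proof
      show "add J \<subseteq> W" using assms(3,4) subspace_add by (auto simp: add_def)
      show "W \<subseteq> add J"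
        unfolding add_def using subspace_0[OF assms(2)]
        by (intro subsetI CollectI bexI[of _ 0] bexI) auto
    qed
    moreover have "W \<inter> J = J" using assms(4) by blast
    ultimately show ?case using quot_dim.quot_dim_0[of W] by auto
  next
    case (quot_dim_Suc V n v)
    then obtain m where m: "m \<le> n" "quot_dim W (add V) m" "W \<inter> V \<noteq> J \<longrightarrow> m < n" by blast
    have sV: "subspace V" using quot_dim_Suc quot_dim_subspace assms by blast
    let ?V = "{x. \<exists>c. x - scale c v \<in> V}"
    have eq: "add ?V = {x. \<exists>c. x - scale c v \<in> add V}"
    proof safe
      fix x assume "x \<in> add ?V"
      then obtain u w c where "u - scale c v \<in> V" "w \<in> W" "x = u + w" by (auto simp: add_def)
      then have "x - scale c v = (u - scale c v) + w" by simp
      then show "\<exists>c. x - scale c v \<in> add V" using \<open>w \<in> W\<close> \<open>u - scale c v \<in> V\<close>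
        unfolding add_def by blast
    next
      fix x c assume "x - scale c v \<in> add V"
      then obtain u w where uw: "u \<in> V" "w \<in> W" "x - scale c v = u + w" by (auto simp: add_def)
      then have "x = (u + scale c v) + w" by (simp add: algebra_simps)
      moreover have "u + scale c v \<in> ?V" using uw by (auto intro!: exI[of _ c])
      ultimately show "x \<in> add ?V" using uw unfolding add_def by blast
    qed
    show ?case
    proof (cases "v \<in> add V")
      case False
      have "W \<inter> V = J" if "m = n" using m that by auto
      have "W \<inter> ?V = W \<inter> V"
      proof
        show "W \<inter> V \<subseteq> W \<inter> ?V" using subset_line_extension[of V v] by blast
        show "W \<inter> ?V \<subseteq> W \<inter> V"
        proof
          fix x assume "x \<in> W \<inter> ?V"
          then obtain c where x: "x \<in> W" "x - scale c v \<in> V" by blast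
          have "c = 0"
          proof (rule ccontr)
            assume c: "c \<noteq> 0"
            have "v = scale (- (1/c)) (x - scale c v) + scale (1/c) x"
              using c by (simp add: algebra_simps)
            then have "v \<in> add V" unfolding add_def
              using subspace_scale[OF sV x(2)] subspace_scale[OF assms(3) x(1)] by blast
            then show False using False by blast
          qed
          then show "x \<in> W \<inter> V" using x by simp
        qed
      qed
      then show ?thesis
        using quot_dim.quot_dim_Suc[OF m(2) False] eq m by (intro exI[of _ "Suc m"]) auto
    next
      case True
      have "subspace (add V)" using quot_dim_subspace[OF m(2) assms(3)] by blast
      have "{x. \<exists>c. x - scale c v \<in> add V} \<subseteq> add V"
      proof safe
        fix x c assume "x - scale c v \<in> add V"
        from subspace_add[OF \<open>subspace (add V)\<close> this
            subspace_scale[OF \<open>subspace (add V)\<close> True, of c]]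
        show "x \<in> add V" by simp
      qed
      then have "add ?V = add V" using eq subset_line_extension[of "add V" v] by simp
      then show ?thesis using m by (intro exI[of _ m]) auto
    qed
  qed
  moreover have "add V = V"
  proof -
    have "subspace V" using assms quot_dim_subspace by blast
    show ?thesis
    proof
      show "add V \<subseteq> V" using assms(5) subspace_add[OF \<open>subspace V\<close>] by (auto simp: add_def)
      show "V \<subseteq> add V"
      proof
        fix x assume "x \<in> V"
        then show "x \<in> add V"
          unfolding add_def using subspace_0[OF assms(3)] by (intro CollectI bexI[of _ x] bexI[of _ 0]) auto
      qed
    qed
  qed
  moreover have "W \<inter> V = W" using assms by blast
  ultimately show ?thesis by simp
qed

text \<open>The preimage of a line extension is either the old preimage or a line extension of it.
  Only finiteness is recorded; the exact value is recovered later by uniqueness.\<close>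

lemma quot_dim_vimage:
  assumes "quot_dim J V n" "subspace J"
    "\<And>x y. T (x + y) = T x + T y" "\<And>c x. T (scale c x) = scale c (T x)"
  shows "\<exists>m. quot_dim (T -` J) (T -` V) m"
  using assms(1)
proof (induction rule: quot_dim.induct)
  case quot_dim_0
  then show ?case using quot_dim.quot_dim_0 by blast
next
  case (quot_dim_Suc V n v)
  let ?V = "{x. \<exists>c. x - scale c v \<in> V}"
  have sV: "subspace V" using quot_dim_Suc quot_dim_subspace assms by blast
  obtain m where m: "quot_dim (T -` J) (T -` V) m" using quot_dim_Suc by blast
  have Tm: "T (x - scale c u) = T x - scale c (T u)" for x c u
    using assms(3)[of x "scale (- c) u"] assms(4)[of "- c" u] by simp
  show ?case
  proof (cases "T -` ?V \<subseteq> T -` V")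
    case True
    then have "T -` ?V = T -` V" using subset_line_extension[of V v] by blast
    then show ?thesis using m by auto
  next
    case False
    then obtain u where u: "T u \<in> ?V" "T u \<notin> V" by blast
    then obtain c where c: "T u - scale c v \<in> V" by blast
    have "c \<noteq> 0" using c u by auto
    from line_extension_replace[OF sV c this]
    have "T -` ?V = {x. \<exists>c. x - scale c u \<in> T -` V}" by (auto simp: Tm)
    then show ?thesis using quot_dim.quot_dim_Suc[OF m, of u] u by auto
  qed
qed

end


section \<open>Formal series as a complex vector space, and the passage to
  \<open>has_codim\<close>\<close>

lemma const2_add: "const2 (a + b) = const2 a + const2 b"
  and const2_mult: "const2 (a * b) = const2 a * const2 b"
  and const2_0 [simp]: "const2 0 = 0"
  and const2_1 [simp]: "const2 1 = 1"
  by (simp_all add: const2_def)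

lemma const2_mult_nth [simp]: "(const2 c * F) $ i $ j = c * F $ i $ j"
  by (simp add: const2_def)

interpretation S: vector_space_quotient "\<lambda>c F. const2 c * F"
  by unfold_locales (auto simp: const2_add const2_mult algebra_simps)

text \<open>By density the convergent series map onto the quotient of all series by
  \<open>V0\<close>, and \<open>J\<close> is the kernel of this map. A formal flag therefore turns
  into a flag of cosets once each of its vectors is replaced by a convergent one.\<close>

lemma has_codimI:
  assumes J: "ideal J O2" "J = {F \<in> V0. convergent2 F}"
    and V0: "S.subspace V0" "S.quot_dim V0 UNIV n"
    and dense: "\<And>F. \<exists>G. convergent2 G \<and> F - G \<in> V0"
  shows "has_codim J n"
proof -
  interpret J: ideal J O2 by (rule J(1))
  let ?Q = "O2 Quot J"
  interpret Q: ring ?Q by (rule J.quotient_is_ring)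
  let ?K = "range (\<lambda>c. J +>\<^bsub>O2\<^esub> const2 c)"
  define E where "E V = {J +>\<^bsub>O2\<^esub> F | F. F \<in> V \<and> convergent2 F}" for V
  have coset_eq: "J +>\<^bsub>O2\<^esub> F = J +>\<^bsub>O2\<^esub> G \<longleftrightarrow> F - G \<in> V0"
    if "convergent2 F" "convergent2 G" for F G
  proof -
    have "F \<ominus>\<^bsub>O2\<^esub> G = F - G"
      using that O2.minus_equality[of "- G" G] by (simp add: a_minus_def convergent2_uminus)
    moreover have "convergent2 (F - G)"
      using convergent2_add[OF that(1) convergent2_uminus[OF that(2)]] by simp
    ultimately show ?thesis
      using O2.quotient_eq_iff_same_a_r_cos[OF J(1), of F G] that J(2) by auto
  qed
  have coset_add: "(J +>\<^bsub>O2\<^esub> F) \<oplus>\<^bsub>?Q\<^esub> (J +>\<^bsub>O2\<^esub> G) = J +>\<^bsub>O2\<^esub> (F + G)"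
    if "convergent2 F" "convergent2 G" for F G
    using J.a_rcos_sum[of F G] that by (simp add: FactRing_def)
  have coset_mult: "(J +>\<^bsub>O2\<^esub> F) \<otimes>\<^bsub>?Q\<^esub> (J +>\<^bsub>O2\<^esub> G) = J +>\<^bsub>O2\<^esub> (F * G)"
    if "convergent2 F" "convergent2 G" for F G
    using J.rcoset_mult_add[of F G] that by (simp add: FactRing_def)
  have "Q.dimension n ?K (E V)" if "S.quot_dim V0 V n" for V n
    using that
  proof (induction rule: S.quot_dim.induct)
    case quot_dim_0
    have "E V0 = {\<zero>\<^bsub>?Q\<^esub>}"
    proof -
      have z: "\<zero>\<^bsub>?Q\<^esub> = J +>\<^bsub>O2\<^esub> 0"
        by (auto simp: FactRing_def a_r_coset_def')
      have "J +>\<^bsub>O2\<^esub> F = J +>\<^bsub>O2\<^esub> 0" if "F \<in> V0" "convergent2 F" for F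
        using coset_eq[of F 0] that convergent2_0 by simp
      then show ?thesis
        unfolding E_def z using S.subspace_0[OF V0(1)] convergent2_0 by blast
    qed
    then show ?case by simp
  next
    case (quot_dim_Suc V n v)
    have V: "S.subspace V" "V0 \<subseteq> V" using S.quot_dim_subspace quot_dim_Suc V0 by blast+
    \<comment> \<open>The convergent \<open>w\<close> agrees with \<open>v\<close> modulo
      \<open>V0\<close>, hence modulo \<open>V\<close>, so it spans the same line extension.\<close>
    obtain w where w: "convergent2 w" "v - w \<in> V0" using dense by blast
    have "w - v \<in> V0" using S.subspace_neg[OF V0(1) w(2)] by simp
    then have wv: "w - const2 1 * v \<in> V" using V by auto
    have wV: "w \<notin> V"
      using quot_dim_Suc.hyps(2) S.subspace_add[OF V(1), of "v - w" w] w V(2) by auto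
    have "E {x. \<exists>c. x - const2 c * v \<in> V} = Q.line_extension ?K (J +>\<^bsub>O2\<^esub> w) (E V)" (is "?L = ?R")
    proof
      note ext = S.line_extension_replace[OF V(1) wv, simplified]
      show "?L \<subseteq> ?R"
      proof
        fix u assume "u \<in> ?L"
        then obtain F c where F: "u = J +>\<^bsub>O2\<^esub> F" "convergent2 F" "F - const2 c * w \<in> V"
          using ext unfolding E_def by blast
        have c: "convergent2 (const2 c * w)" using convergent2_mult convergent2_const2 w by blast
        then have d: "convergent2 (F - const2 c * w)"
          using convergent2_add[OF F(2) convergent2_uminus[OF c]] by simp
        have "u = (J +>\<^bsub>O2\<^esub> const2 c) \<otimes>\<^bsub>?Q\<^esub> (J +>\<^bsub>O2\<^esub> w) \<oplus>\<^bsub>?Q\<^esub> (J +>\<^bsub>O2\<^esub> (F - const2 c * w))"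
          using coset_add[OF c d] coset_mult[OF convergent2_const2 w(1)] F by simp
        then show "u \<in> ?R"
          unfolding Q.line_extension_mem_iff using F d by (auto simp: E_def)
      qed
      show "?R \<subseteq> ?L"
      proof
        fix u assume "u \<in> ?R"
        then obtain c F where F: "convergent2 F" "F \<in> V"
          "u = (J +>\<^bsub>O2\<^esub> const2 c) \<otimes>\<^bsub>?Q\<^esub> (J +>\<^bsub>O2\<^esub> w) \<oplus>\<^bsub>?Q\<^esub> (J +>\<^bsub>O2\<^esub> F)"
          unfolding Q.line_extension_mem_iff E_def by blast
        have c: "convergent2 (const2 c * w)" using convergent2_mult convergent2_const2 w by blast
        have "u = J +>\<^bsub>O2\<^esub> (const2 c * w + F)"
          using coset_add[OF c F(1)] coset_mult[OF convergent2_const2 w(1)] F by simp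
        moreover have "const2 c * w + F - const2 c * w \<in> V" using F by simp
        ultimately show "u \<in> ?L"
          unfolding ext E_def using convergent2_add[OF c F(1)] by blast
      qed
    qed
    moreover have "J +>\<^bsub>O2\<^esub> w \<notin> E V"
    proof
      assume "J +>\<^bsub>O2\<^esub> w \<in> E V"
      then obtain F where "F \<in> V" "convergent2 F" "J +>\<^bsub>O2\<^esub> w = J +>\<^bsub>O2\<^esub> F" unfolding E_def by blast
      with coset_eq w have "w - F \<in> V" using V by blast
      from S.subspace_add[OF V(1) this \<open>F \<in> V\<close>] show False using wV by simp
    qed
    moreover have "J +>\<^bsub>O2\<^esub> w \<in> carrier ?Q"
      using w by (auto simp: FactRing_def A_RCOSETS_def')
    ultimately show ?case using Q.Suc_dim[OF _ _ quot_dim_Suc.IH] by simp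
  qed
  from this[OF V0(2)] have "Q.dimension n ?K (E UNIV)" .
  moreover have "E UNIV = carrier ?Q" by (auto simp: E_def FactRing_def A_RCOSETS_def')
  ultimately show ?thesis by (simp add: has_codim_def)
qed


section \<open>Weierstrass division\<close>

lemma fps2_mult_nth:
  "(F * G) $ i $ j = (\<Sum>k\<le>i. \<Sum>l\<le>j. F $ k $ l * G $ (i - k) $ (j - l))" for F G :: "'a::comm_ring_1 fps fps"
  by (simp add: fps_mult_nth fps_sum_nth atLeast0AtMost)

lemma convergent2_diff: "convergent2 F \<Longrightarrow> convergent2 G \<Longrightarrow> convergent2 (F - G)"
  using convergent2_add[OF _ convergent2_uminus, of F G] by simp

lemma convergent2_sum: "(\<And>i. i \<in> A \<Longrightarrow> convergent2 (F i)) \<Longrightarrow> convergent2 (sum F A)"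
  by (induction A rule: infinite_finite_induct) (auto simp: convergent2_0 convergent2_add)

lemma convergent2_power: "convergent2 F \<Longrightarrow> convergent2 (F ^ n)"
  by (induction n) (auto simp: convergent2_1 convergent2_mult)

definition regular_x :: "nat \<Rightarrow> series2 \<Rightarrow> bool" where
  "regular_x n g \<longleftrightarrow> (\<forall>i<n. g $ i $ 0 = 0) \<and> g $ n $ 0 \<noteq> 0"

text \<open>With \<open>x\<close> of weight \<open>1\<close> and \<open>y\<close> of weight \<open>n + 1\<close>, the monomial \<open>x^n\<close> is the only monomial
  of lowest weight in \<open>g\<close>. Hence the coefficients of the quotient are determined by recursion on the
  weight; the guard in the sum only drops terms that vanish.\<close>

function weierstrass_coeff :: "nat \<Rightarrow> series2 \<Rightarrow> series2 \<Rightarrow> nat \<Rightarrow> nat \<Rightarrow> complex" where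
  "weierstrass_coeff n F g i j = F $ (i + n) $ j -
     (\<Sum>a\<le>i + n. \<Sum>b\<le>j. if a + Suc n * b < i + Suc n * j
        then weierstrass_coeff n F g a b * g $ (i + n - a) $ (j - b) else 0)"
  by pat_completeness auto
termination
  by (relation "Wellfounded.measure (\<lambda>(n, F, g, i, j). i + Suc n * j)") auto

declare weierstrass_coeff.simps [simp del]

text \<open>In the full convolution, every term dropped by the guard vanishes except the one at
  \<open>(i, j)\<close>, and that one is the new coefficient times the leading coefficient
  1.\<close>

lemma weierstrass_coeff_step:
  assumes g: "regular_x n g" "g $ n $ 0 = 1"
  shows "(\<Sum>a\<le>i + n. \<Sum>b\<le>j. weierstrass_coeff n F g a b * g $ (i + n - a) $ (j - b)) = F $ (i + n) $ j"
proof -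
  let ?q = "weierstrass_coeff n F g"
  let ?G = "\<lambda>a b. if a + Suc n * b < i + Suc n * j then ?q a b * g $ (i + n - a) $ (j - b) else 0"
  have split: "?q a b * g $ (i + n - a) $ (j - b) = (if b = j then if a = i then ?q i j else 0 else 0) + ?G a b"
    if ab: "a \<le> i + n" "b \<le> j" for a b
  proof (cases "a + Suc n * b < i + Suc n * j")
    case True
    then have "\<not> (b = j \<and> a = i)" by blast
    then have "(if b = j then if a = i then z else 0 else 0) = (0 :: complex)" for z by auto
    then show ?thesis unfolding if_P[OF True] by (simp only: add_0)
  next
    case False
    obtain d where d: "j = b + d" using le_Suc_ex[OF ab(2)] by blast
    \<comment> \<open>A missing power of \<open>y\<close> costs weight \<open>n + 1\<close>, more
      than the at most \<open>n\<close> extra powers of \<open>x\<close> can restore.\<close>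
    have d0: "d = 0"
    proof (rule ccontr)
      assume "d \<noteq> 0"
      then have "Suc n * 1 \<le> Suc n * d" by (intro mult_le_mono2) simp
      moreover have "i + (Suc n * b + Suc n * d) \<le> a + Suc n * b"
        using False by (simp only: d add_mult_distrib2 not_less)
      moreover have "i + (u + v) \<le> a + u \<Longrightarrow> Suc n \<le> v \<Longrightarrow> False" for u v
        using ab(1) by linarith
      ultimately show False by (metis mult_1_right)
    qed
    have "i \<le> a" using False d d0 by simp
    have G: "?G a b = 0" using False by (rule if_not_P)
    show ?thesis
    proof (cases "a = i")
      case True
      then show ?thesis unfolding G using d d0 g(2) by simp
    next
      case ai: False
      then have "i + n - a < n" using \<open>i \<le> a\<close> ab by linarith
      then have "g $ (i + n - a) $ (j - b) = 0" using d d0 g(1) by (simp add: regular_x_def)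
      then show ?thesis unfolding G using ai by simp
    qed
  qed
  have "(\<Sum>a\<le>i + n. \<Sum>b\<le>j. ?q a b * g $ (i + n - a) $ (j - b)) =
     (\<Sum>a\<le>i + n. \<Sum>b\<le>j. (if b = j then if a = i then ?q i j else 0 else 0) + ?G a b)"
    by (intro sum.cong refl split) simp_all
  also have "\<dots> = ?q i j + (\<Sum>a\<le>i + n. \<Sum>b\<le>j. ?G a b)"
    by (simp add: sum.distrib)
  also have "\<dots> = F $ (i + n) $ j"
    by (subst weierstrass_coeff.simps) simp
  finally show ?thesis .
qed

lemma sum_half_powers: "(\<Sum>a\<le>N. (1 / 2) ^ (N - a)) \<le> (2 :: real)"
proof -
  have "(\<Sum>a\<le>N. (1 / 2) ^ (N - a)) = 2 - (1 / 2 :: real) ^ N"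
  proof (induction N)
    case (Suc N)
    have "(\<Sum>a\<le>N. (1 / 2 :: real) ^ (Suc N - a)) = (\<Sum>a\<le>N. 1 / 2 * (1 / 2) ^ (N - a))"
      by (intro sum.cong refl) (simp add: Suc_diff_le)
    then have "(\<Sum>a\<le>N. (1 / 2 :: real) ^ (Suc N - a)) = 1 / 2 * (2 - (1 / 2) ^ N)"
      using Suc by (simp only: sum_distrib_left[symmetric])
    then show ?case by simp
  qed simp
  then show ?thesis by simp
qed

text \<open>Induction on the weight with a geometric majorant. A term of the recursion whose weight
  is lower by \<open>m \<ge> 1\<close> gains a factor \<open>u ^ m \<le> u\<close>; with
  \<open>u\<close> small the whole sum uses up one half of the bound, and
  \<open>M = 2 * A * R ^ n\<close> reserves the other half for the coefficient of
  \<open>F\<close>.\<close>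

lemma weierstrass_coeff_bound:
  fixes F g :: series2 and A H R :: real
  assumes F: "A \<ge> 0" "\<And>i j. norm (F $ i $ j) \<le> A * R ^ (i + j)"
    and g: "H \<ge> 0" "\<And>i j. norm (g $ i $ j) \<le> H * R ^ (i + j)" and R: "R \<ge> 1"
  shows "\<exists>M\<ge>0. \<exists>\<rho>\<ge>1. \<forall>i j. norm (weierstrass_coeff n F g i j) \<le> M * \<rho> ^ (i + Suc n * j)"
proof -
  define K0 where "K0 = (H + 1) * R ^ n * 2 ^ n"
  \<comment> \<open>The choice makes \<open>H * R ^ n * u * 2 ^ n * 4\<close> at most 1/2. The 4
    bounds the product of two geometric sums of ratio 1/2, and \<open>2 ^ n\<close> comes from
    \<open>c + d \<le> m + n\<close>.\<close>
  define u where "u = 1 / (8 * K0)"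
  define \<rho> where "\<rho> = 2 * R / u"
  define M where "M = 2 * A * R ^ n"
  have "1 * 1 * 1 \<le> K0"
    unfolding K0_def using g(1) one_le_power[OF R, of n] by (intro mult_mono) auto
  then have K0: "K0 \<ge> 1" by simp
  have u: "0 < u" "u \<le> 1" using K0 by (auto simp: u_def)
  have R\<rho>: "R = \<rho> * (u / 2)" using u by (simp add: \<rho>_def)
  have "R * u \<le> R * 2" using u R by (intro mult_left_mono) auto
  then have "R \<le> \<rho>" using u(1) by (simp add: \<rho>_def field_simps)
  then have \<rho>: "\<rho> \<ge> 1" using R by simp
  have M: "M \<ge> 0" using F(1) R by (simp add: M_def)
  have "H * R ^ n * 2 ^ n * 8 \<le> 8 * K0" using R by (simp add: K0_def)
  then have Hu: "H * R ^ n * u * 2 ^ n * 4 \<le> 1 / 2"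
    using K0 unfolding u_def by (simp add: field_simps)
  have "norm (weierstrass_coeff n F g i j) \<le> M * \<rho> ^ (i + Suc n * j)" for i j
  proof (induction "i + Suc n * j" arbitrary: i j rule: less_induct)
    case less
    let ?w = "i + Suc n * j"
    have summand: "norm (weierstrass_coeff n F g a b * g $ (i + n - a) $ (j - b))
       \<le> M * H * R ^ n * u * 2 ^ n * \<rho> ^ ?w * ((1/2) ^ (i + n - a) * (1/2) ^ (j - b))"
      if ab: "a \<le> i + n" "b \<le> j" "a + Suc n * b < ?w" for a b
    proof -
      define c where "c = i + n - a"
      define d where "d = j - b"
      define m where "m = ?w - (a + Suc n * b)"
      have m: "m \<ge> 1" "a + Suc n * b + m = ?w" using ab by (auto simp: m_def)
      have cd: "c + Suc n * d = m + n"
      proof -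
        have "i + n = a + c" "j = b + d" using ab by (auto simp: c_def d_def)
        then have "a + Suc n * b + m = i + (Suc n * b + Suc n * d)"
          using m(2) by (simp only: add_mult_distrib2)
        then show ?thesis using \<open>i + n = a + c\<close> by linarith
      qed
      have cd': "c + d \<le> m + n" using cd by simp
      have "norm (weierstrass_coeff n F g a b * g $ c $ d) \<le> (M * \<rho> ^ (a + Suc n * b)) * (H * R ^ (c + d))"
        unfolding norm_mult using less ab M \<rho> g by (intro mult_mono) auto
      also have "\<dots> = M * H * (\<rho> ^ (a + Suc n * b) * R ^ (c + d))" by simp
      also have "\<dots> \<le> M * H * (\<rho> ^ (a + Suc n * b) * R ^ (m + n))"
        using M g \<rho> R cd' by (intro mult_left_mono power_increasing) auto
      also have "R ^ (m + n) = R ^ n * (\<rho> ^ m * (u ^ m * (1 / 2) ^ m))"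
      proof -
        have "R = \<rho> * (u * (1 / 2))" using R\<rho> by simp
        then have "R ^ m = (\<rho> * (u * (1 / 2))) ^ m" by (rule arg_cong)
        then show ?thesis by (simp only: power_add power_mult_distrib mult_ac)
      qed
      also have "M * H * (\<rho> ^ (a + Suc n * b) * (R ^ n * (\<rho> ^ m * (u ^ m * (1 / 2) ^ m)))) =
          M * H * R ^ n * \<rho> ^ ?w * (u ^ m * (1 / 2) ^ m)"
        unfolding m(2)[symmetric] power_add by simp
      also have "\<dots> \<le> M * H * R ^ n * \<rho> ^ ?w * (u * (2 ^ n * ((1/2) ^ c * (1/2) ^ d)))"
      proof (intro mult_left_mono mult_mono)
        show "u ^ m \<le> u" using power_decreasing[OF m(1), of u] u by simp
        have "(1 / 2 :: real) ^ (m + n) \<le> (1 / 2) ^ (c + d)" using cd' by (intro power_decreasing) auto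
        then have "2 ^ n * (1 / 2 :: real) ^ (m + n) \<le> 2 ^ n * (1 / 2) ^ (c + d)" by simp
        then show "(1 / 2 :: real) ^ m \<le> 2 ^ n * ((1/2) ^ c * (1/2) ^ d)"
          by (simp add: power_add power_divide)
      qed (use M g R \<rho> u in auto)
      finally show ?thesis by (simp add: c_def d_def mult_ac)
    qed
    let ?K = "M * H * R ^ n * u * 2 ^ n * \<rho> ^ ?w"
    have K: "?K \<ge> 0" using M g R \<rho> u by simp
    have "norm (\<Sum>a\<le>i + n. \<Sum>b\<le>j. if a + Suc n * b < ?w
        then weierstrass_coeff n F g a b * g $ (i + n - a) $ (j - b) else 0)
      \<le> (\<Sum>a\<le>i + n. \<Sum>b\<le>j. ?K * ((1/2) ^ (i + n - a) * (1/2) ^ (j - b)))"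
      using summand K by (intro sum_norm_le) auto
    also have "\<dots> = ?K * ((\<Sum>a\<le>i + n. (1/2) ^ (i + n - a)) * (\<Sum>b\<le>j. (1/2) ^ (j - b)))"
      by (simp only: sum_product sum_distrib_left[symmetric])
    also have "\<dots> \<le> ?K * (2 * 2)"
      using K by (intro mult_left_mono mult_mono sum_half_powers) (auto intro!: sum_nonneg)
    also have "\<dots> = M * \<rho> ^ ?w * (H * R ^ n * u * 2 ^ n * 4)" by simp
    also have "\<dots> \<le> M * \<rho> ^ ?w * (1 / 2)"
      using Hu M \<rho> by (intro mult_left_mono) auto
    finally have S: "norm (\<Sum>a\<le>i + n. \<Sum>b\<le>j. if a + Suc n * b < ?w
        then weierstrass_coeff n F g a b * g $ (i + n - a) $ (j - b) else 0) \<le> M * \<rho> ^ ?w / 2" by simp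
    have "norm (F $ (i + n) $ j) \<le> A * R ^ (i + n + j)" by (rule F(2))
    also have "\<dots> = A * R ^ n * R ^ (i + j)" by (simp add: power_add)
    also have "\<dots> \<le> A * R ^ n * \<rho> ^ ?w"
    proof (rule mult_left_mono)
      have "R ^ (i + j) \<le> \<rho> ^ (i + j)" using \<open>R \<le> \<rho>\<close> R by (intro power_mono) auto
      also have "\<dots> \<le> \<rho> ^ ?w" using \<rho> by (intro power_increasing) auto
      finally show "R ^ (i + j) \<le> \<rho> ^ ?w" .
    qed (use F R in auto)
    also have "\<dots> = M * \<rho> ^ ?w / 2" by (simp add: M_def)
    finally have T: "norm (F $ (i + n) $ j) \<le> M * \<rho> ^ ?w / 2" .
    show ?case
    proof (subst weierstrass_coeff.simps, rule order.trans[OF norm_triangle_ineq4])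
      show "norm (F $ (i + n) $ j) + norm (\<Sum>a\<le>i + n. \<Sum>b\<le>j. if a + Suc n * b < ?w
        then weierstrass_coeff n F g a b * g $ (i + n - a) $ (j - b) else 0) \<le> M * \<rho> ^ ?w"
        using S T by linarith
    qed
  qed
  then show ?thesis using M \<rho> by blast
qed

text \<open>One set of coefficients serves both rings: the recursion always gives a formal quotient,
  and the majorant shows that it converges as soon as \<open>F\<close> and \<open>g\<close> do.
  Rescaling to \<open>h\<close> normalizes the leading coefficient to 1.\<close>

theorem weierstrass_division:
  assumes g: "regular_x n g"
  obtains Q R where "F = Q * g + R" "\<And>i. i \<ge> n \<Longrightarrow> R $ i = 0"
    "convergent2 F \<Longrightarrow> convergent2 g \<Longrightarrow> convergent2 Q \<and> convergent2 R"
proof -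
  define h where "h = const2 (1 / (g $ n $ 0)) * g"
  have h: "regular_x n h" "h $ n $ 0 = 1" using g by (auto simp: h_def regular_x_def)
  define Q where "Q = Abs_fps (\<lambda>i. Abs_fps (weierstrass_coeff n F h i))"
  define R where "R = F - Q * h"
  have "(Q * h) $ (i + n) $ j = F $ (i + n) $ j" for i j
    using weierstrass_coeff_step[OF h, of F i j] by (simp add: fps2_mult_nth Q_def)
  then have "R $ (i + n) $ j = 0" for i j by (simp add: R_def)
  then have R: "R $ i = 0" if "i \<ge> n" for i
    using that by (metis fps_ext fps_zero_nth le_add_diff_inverse2)
  have "convergent2 Q \<and> convergent2 R" if c: "convergent2 F" "convergent2 g"
  proof -
    have hc: "convergent2 h" using that by (simp add: h_def convergent2_mult convergent2_const2)
    obtain A r where F: "A \<ge> 0" "r \<ge> 1" "\<And>i j. norm (F $ i $ j) \<le> A * r ^ (i + j)"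
      using convergent2E[OF c(1)] by blast
    obtain H s where H: "H \<ge> 0" "s \<ge> 1" "\<And>i j. norm (h $ i $ j) \<le> H * s ^ (i + j)"
      using convergent2E[OF hc] by blast
    define t where "t = max r s"
    have t: "r \<le> t" "s \<le> t" by (auto simp: t_def)
    have "norm (F $ i $ j) \<le> A * t ^ (i + j)" "norm (h $ i $ j) \<le> H * t ^ (i + j)" for i j
      using F(3)[of i j] H(3)[of i j] mult_left_mono[OF power_mono[OF t(1), of "i + j"] F(1)]
        mult_left_mono[OF power_mono[OF t(2), of "i + j"] H(1)] F(2) H(2) by linarith+
    moreover have "t \<ge> 1" using F by (simp add: t_def)
    ultimately obtain M \<rho> where M: "M \<ge> 0" "\<rho> \<ge> 1"
      "\<And>i j. norm (weierstrass_coeff n F h i j) \<le> M * \<rho> ^ (i + Suc n * j)"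
      using weierstrass_coeff_bound[of A F t H h n] F(1) H(1) by blast
    have "convergent2 Q"
    proof (rule convergent2I[of M "\<rho> ^ Suc n"])
      fix i j
      have "\<rho> ^ (i + Suc n * j) \<le> \<rho> ^ (Suc n * (i + j))"
        using M by (intro power_increasing) (auto simp: algebra_simps)
      then have "M * \<rho> ^ (i + Suc n * j) \<le> M * (\<rho> ^ Suc n) ^ (i + j)"
        using M by (metis mult_left_mono power_mult)
      then show "norm (Q $ i $ j) \<le> M * (\<rho> ^ Suc n) ^ (i + j)"
        using M(3)[of i j] by (simp add: Q_def)
    qed (use M in auto)
    then show ?thesis using that hc by (simp add: R_def convergent2_diff convergent2_mult)
  qed
  moreover have "F = (Q * const2 (1 / (g $ n $ 0))) * g + R"
    by (simp add: R_def h_def mult_ac)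
  ultimately show ?thesis
    using that[of "Q * const2 (1 / (g $ n $ 0))" R] R
    by (auto simp: convergent2_mult convergent2_const2)
qed

text \<open>A series with nonzero constant term is regular of order 0, so dividing 1 by it leaves no
  remainder; convergence of the inverse comes with the division.\<close>

lemma unit_inverse:
  assumes "F $ 0 $ 0 \<noteq> 0"
  obtains G where "F * G = 1" "convergent2 F \<Longrightarrow> convergent2 G"
proof -
  have "regular_x 0 F" using assms by (simp add: regular_x_def)
  from weierstrass_division[OF this, of 1] obtain Q R where Q: "1 = Q * F + R"
    "\<And>i. R $ i = 0" "convergent2 F \<Longrightarrow> convergent2 Q"
    using convergent2_1 by (metis le0)
  from Q(2) have "R = 0" by (simp add: fps_ext)
  then show ?thesis using that[of Q] Q by (simp add: mult.commute)
qed

lemma unit_dvd_1_iff: "(F :: series2) dvd 1 \<longleftrightarrow> F $ 0 $ 0 \<noteq> 0"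
proof
  assume "F dvd 1"
  then obtain G where "1 = F * G" by blast
  then have "(F * G) $ 0 $ 0 = 1" by (metis fps_one_nth)
  then show "F $ 0 $ 0 \<noteq> 0" by (auto simp: fps2_mult_nth)
next
  assume "F $ 0 $ 0 \<noteq> 0"
  then show "F dvd 1" by (rule unit_inverse) (metis dvd_triv_left)
qed

lemma Units_O2_iff: "F \<in> Units O2 \<longleftrightarrow> convergent2 F \<and> F $ 0 $ 0 \<noteq> 0"
proof
  assume F: "F \<in> Units O2"
  then obtain G where "F * G = 1" by (auto simp: Units_def)
  then have "F dvd 1" by (metis dvd_triv_left)
  then show "convergent2 F \<and> F $ 0 $ 0 \<noteq> 0" using F unit_dvd_1_iff by (auto simp: Units_def)
next
  assume F: "convergent2 F \<and> F $ 0 $ 0 \<noteq> 0"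
  then obtain G where "F * G = 1" "convergent2 G" using unit_inverse by blast
  then show "F \<in> Units O2" using F by (auto simp: Units_def mult.commute)
qed


section \<open>Evaluation at a power series\<close>

text \<open>The value of \<open>F\<close> at \<open>x = \<phi>(y)\<close>, obtained as the remainder modulo \<open>x - \<phi>\<close>. It is only meaningful
  if \<open>\<phi>\<close> has no constant term.\<close>

definition eval_x :: "complex fps \<Rightarrow> series2 \<Rightarrow> complex fps" where
  "eval_x \<phi> F = (THE c. fps_X - fps_const \<phi> dvd F - fps_const c)"

lemma regular_x_linear: "\<phi> $ 0 = 0 \<Longrightarrow> regular_x 1 (fps_X - fps_const \<phi>)"
  by (simp add: regular_x_def)

text \<open>Comparing coefficients of \<open>x\<close> gives
  \<open>q $ i = \<phi> * q $ Suc i\<close>, so \<open>q $ 0\<close> would be divisible by every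
  power of \<open>\<phi>\<close>, which its finite order forbids. This is the uniqueness that makes
  \<open>eval_x\<close> well defined.\<close>

lemma linear_dvd_const:
  assumes "\<phi> $ 0 = 0" "fps_X - fps_const \<phi> dvd fps_const (c :: complex fps)"
  shows "c = 0"
proof (rule ccontr)
  assume c: "c \<noteq> 0"
  obtain q where q: "fps_const c = (fps_X - fps_const \<phi>) * q" using assms by blast
  have nth: "fps_const c $ i = (if i = 0 then 0 else q $ (i - 1)) - \<phi> * q $ i" for i
    by (subst q) (simp add: left_diff_distrib)
  have c0: "c = - \<phi> * q $ 0" using nth[of 0] by simp
  have step: "q $ i = \<phi> * q $ Suc i" for i using nth[of "Suc i"] by simp
  have pow: "q $ 0 = \<phi> ^ k * q $ k" for k
  proof (induction k)
    case (Suc k)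
    then show ?case using step[of k] by (simp add: mult.assoc)
  qed simp
  have q0: "q $ 0 \<noteq> 0" "\<phi> \<noteq> 0" using c c0 by auto
  then have "subdegree \<phi> \<noteq> 0" using assms(1) by (simp add: subdegree_eq_0_iff)
  let ?k = "Suc (subdegree (q $ 0))"
  have "q $ ?k \<noteq> 0" using pow[of ?k] q0 by auto
  then have "subdegree (q $ 0) = ?k * subdegree \<phi> + subdegree (q $ ?k)"
    using pow[of ?k] q0 by (metis power_eq_0_iff subdegree_mult subdegree_power)
  moreover have "?k * subdegree \<phi> \<ge> ?k * 1" using \<open>subdegree \<phi> \<noteq> 0\<close> by (intro mult_le_mono) auto
  ultimately show False by simp
qed

context
  fixes \<phi> :: "complex fps"
  assumes \<phi>: "\<phi> $ 0 = 0"
begin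

lemma eval_x_eqI:
  assumes "fps_X - fps_const \<phi> dvd F - fps_const c" shows "eval_x \<phi> F = c"
  unfolding eval_x_def
proof (rule the_equality)
  fix d assume "fps_X - fps_const \<phi> dvd F - fps_const d"
  from dvd_diff[OF assms this] have "fps_X - fps_const \<phi> dvd fps_const (d - c)"
    by (simp flip: fps_const_sub)
  then show "d = c" using linear_dvd_const[OF \<phi>] by fastforce
qed (rule assms)

lemma eval_x_dvd: "fps_X - fps_const \<phi> dvd F - fps_const (eval_x \<phi> F)"
proof -
  obtain Q R where "F = Q * (fps_X - fps_const \<phi>) + R" "\<And>i. i \<ge> 1 \<Longrightarrow> R $ i = 0"
    using weierstrass_division[OF regular_x_linear[OF \<phi>]] by metis
  then have "R = fps_const (R $ 0)" by (auto simp: fps_eq_iff)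
  then have "F - fps_const (R $ 0) = Q * (fps_X - fps_const \<phi>)"
    using \<open>F = _\<close> by simp
  then have "fps_X - fps_const \<phi> dvd F - fps_const (R $ 0)" by simp
  then show ?thesis using eval_x_eqI by metis
qed

lemma eval_x_eq_0_iff: "eval_x \<phi> F = 0 \<longleftrightarrow> fps_X - fps_const \<phi> dvd F"
  using eval_x_dvd[of F] eval_x_eqI[of F 0] by auto

lemma eval_x_const [simp]: "eval_x \<phi> (fps_const c) = c"
  by (rule eval_x_eqI) simp

lemma eval_x_0 [simp]: "eval_x \<phi> 0 = 0" and eval_x_1 [simp]: "eval_x \<phi> 1 = 1"
  using eval_x_const[of 0] eval_x_const[of 1] by (simp_all del: eval_x_const)

lemma eval_x_X [simp]: "eval_x \<phi> fps_X = \<phi>"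
  by (rule eval_x_eqI) simp

lemma eval_x_add: "eval_x \<phi> (F + G) = eval_x \<phi> F + eval_x \<phi> G"
  using dvd_add[OF eval_x_dvd[of F] eval_x_dvd[of G]]
  by (intro eval_x_eqI) (simp add: algebra_simps flip: fps_const_add)

lemma eval_x_diff: "eval_x \<phi> (F - G) = eval_x \<phi> F - eval_x \<phi> G"
  using dvd_diff[OF eval_x_dvd[of F] eval_x_dvd[of G]]
  by (intro eval_x_eqI) (simp add: algebra_simps flip: fps_const_sub)

lemma eval_x_mult: "eval_x \<phi> (F * G) = eval_x \<phi> F * eval_x \<phi> G"
proof (rule eval_x_eqI)
  have "F * G - fps_const (eval_x \<phi> F * eval_x \<phi> G) =
    (F - fps_const (eval_x \<phi> F)) * G + fps_const (eval_x \<phi> F) * (G - fps_const (eval_x \<phi> G))"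
    by (simp add: algebra_simps flip: fps_const_mult)
  then show "fps_X - fps_const \<phi> dvd F * G - fps_const (eval_x \<phi> F * eval_x \<phi> G)"
    using eval_x_dvd by simp
qed

lemma eval_x_nth_0: "eval_x \<phi> F $ 0 = F $ 0 $ 0"
proof -
  obtain q where "F - fps_const (eval_x \<phi> F) = (fps_X - fps_const \<phi>) * q" using eval_x_dvd by blast
  then have "(F - fps_const (eval_x \<phi> F)) $ 0 $ 0 = ((fps_X - fps_const \<phi>) * q) $ 0 $ 0" by simp
  then show ?thesis using \<phi> by (simp add: left_diff_distrib)
qed

end

section \<open>Restriction to lines and the order of a series\<close>

definition line :: "complex \<Rightarrow> complex fps" where
  "line s = fps_const s * fps_X"

lemma line_nth_0 [simp]: "line s $ 0 = 0"
  by (simp add: line_def)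

lemma eval_x_line_nth: "eval_x (line s) F $ d = (\<Sum>i\<le>d. F $ i $ (d - i) * s ^ i)"
proof -
  obtain q where q: "F - fps_const (eval_x (line s) F) = (fps_X - fps_const (line s)) * q"
    using eval_x_dvd[of "line s"] by auto
  have F: "F $ i $ j = (if i = 0 then eval_x (line s) F $ j else 0)
      + ((if i = 0 then 0 else q $ (i - 1) $ j) - (if j = 0 then 0 else s * q $ i $ (j - 1)))" for i j
  proof -
    have "F = (fps_X - fps_const (line s)) * q + fps_const (eval_x (line s) F)"
      using q by (simp add: algebra_simps)
    then have "F $ i $ j = ((fps_X - fps_const (line s)) * q + fps_const (eval_x (line s) F)) $ i $ j"
      by simp
    then show ?thesis by (simp add: left_diff_distrib line_def mult.assoc)
  qed
  \<comment> \<open>\<open>D i\<close> is the share of \<open>x * q\<close> in the diagonal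
    coefficient \<open>i\<close>, and the share of \<open>s * y * q\<close> at \<open>i\<close> is
    \<open>D (Suc i)\<close>, so the sum over the diagonal telescopes.\<close>
  define D where "D i = (if i = 0 then 0 else q $ (i - 1) $ (d - i) * s ^ i)" for i
  have "F $ i $ (d - i) * s ^ i = (if i = 0 then eval_x (line s) F $ d else 0) + (D i - (if i = d then 0 else D (Suc i)))"
    if "i \<le> d" for i
    using that by (subst F) (auto simp: D_def algebra_simps Suc_diff_Suc)
  then have "(\<Sum>i\<le>d. F $ i $ (d - i) * s ^ i) =
    (\<Sum>i\<le>d. (if i = 0 then eval_x (line s) F $ d else 0) + (D i - (if i = d then 0 else D (Suc i))))"
    by (intro sum.cong) auto
  also have "\<dots> = eval_x (line s) F $ d + ((\<Sum>i\<le>d. D i) - (\<Sum>i\<le>d. if i = d then 0 else D (Suc i)))"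
    by (simp add: sum.distrib sum_subtractf)
  also have "(\<Sum>i\<le>d. if i = d then 0 else D (Suc i)) = (\<Sum>i<d. D (Suc i))"
    by (intro sum.mono_neutral_cong_right) auto
  also have "(\<Sum>i\<le>d. D i) = (\<Sum>i<d. D (Suc i))"
    by (simp add: sum.atMost_shift D_def)
  finally show ?thesis by simp
qed

definition order_ge :: "nat \<Rightarrow> series2 set" where
  "order_ge k = {F. \<forall>i j. i + j < k \<longrightarrow> F $ i $ j = 0}"

lemma order_ge_0 [simp]: "order_ge 0 = UNIV"
  by (simp add: order_ge_def)

lemma order_ge_antimono: "k \<le> l \<Longrightarrow> order_ge l \<subseteq> order_ge k"
  by (auto simp: order_ge_def)

lemma order_ge_add: "F \<in> order_ge k \<Longrightarrow> G \<in> order_ge k \<Longrightarrow> F + G \<in> order_ge k"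
  and order_ge_diff: "F \<in> order_ge k \<Longrightarrow> G \<in> order_ge k \<Longrightarrow> F - G \<in> order_ge k"
  and zero_order_ge: "0 \<in> order_ge k"
  by (auto simp: order_ge_def)

lemma order_ge_mult: "F \<in> order_ge k \<Longrightarrow> G \<in> order_ge l \<Longrightarrow> F * G \<in> order_ge (k + l)"
  unfolding order_ge_def
proof (intro CollectI allI impI)
  fix i j assume F: "F \<in> {F. \<forall>i j. i + j < k \<longrightarrow> F $ i $ j = 0}"
    and G: "G \<in> {F. \<forall>i j. i + j < l \<longrightarrow> F $ i $ j = 0}" and ij: "i + j < k + l"
  have "F $ a $ b * G $ (i - a) $ (j - b) = 0" if "a \<le> i" "b \<le> j" for a b
  proof (cases "a + b < k")
    case False
    then have "(i - a) + (j - b) < l" using that ij by linarith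
    then show ?thesis using G by simp
  qed (use F in simp)
  then show "(F * G) $ i $ j = 0"
    unfolding fps2_mult_nth by (intro sum.neutral ballI) auto
qed

lemma order_ge_mult_left: "F \<in> order_ge k \<Longrightarrow> G * F \<in> order_ge k"
  using order_ge_mult[of G 0 F k] by simp

lemma eval_x_line_order: "F \<in> order_ge k \<Longrightarrow> d < k \<Longrightarrow> eval_x (line s) F $ d = 0"
  by (simp add: eval_x_line_nth order_ge_def)

text \<open>The homogeneous part of degree \<open>d\<close>, dehomogenized by \<open>y = 1\<close>.
  It is of interest when \<open>F\<close> has order at least \<open>d\<close>; its roots are then
  the directions in which the order of the restriction jumps.\<close>

definition leading_poly :: "nat \<Rightarrow> series2 \<Rightarrow> complex poly" where
  "leading_poly d F = (\<Sum>i\<le>d. monom (F $ i $ (d - i)) i)"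

lemma poly_leading_poly: "poly (leading_poly d F) s = eval_x (line s) F $ d"
  by (simp add: leading_poly_def eval_x_line_nth poly_sum poly_monom)

lemma leading_poly_nonzero:
  assumes "i + j = d" "F $ i $ j \<noteq> 0" shows "leading_poly d F \<noteq> 0"
proof -
  have "coeff (leading_poly d F) i = F $ i $ j"
    using assms by (auto simp: leading_poly_def coeff_sum)
  then show ?thesis using assms by auto
qed

lemma exists_lowest_term:
  assumes "F \<notin> order_ge k"
  obtains d i j where "d < k" "F \<in> order_ge d" "i + j = d" "F $ i $ j \<noteq> 0"
proof -
  define d where "d = (LEAST n. \<exists>i j. i + j = n \<and> F $ i $ j \<noteq> 0)"
  obtain a b where ab: "a + b < k" "F $ a $ b \<noteq> 0" using assms by (auto simp: order_ge_def)
  have d: "\<exists>i j. i + j = d \<and> F $ i $ j \<noteq> 0"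
    unfolding d_def by (rule LeastI[of _ "a + b"]) (use ab in blast)
  have "d \<le> a + b" unfolding d_def by (rule Least_le) (use ab in blast)
  moreover have "F \<in> order_ge d"
    unfolding order_ge_def d_def using not_less_Least by blast
  moreover obtain i j where "i + j = d" "F $ i $ j \<noteq> 0" using d by blast
  ultimately show ?thesis using that[of d i j] ab(1) by linarith
qed

lemma poly_nonroot:
  assumes "(p :: complex poly) \<noteq> 0" obtains s where "poly p s \<noteq> 0"
  using assms poly_all_0_iff_0 by blast

text \<open>The order is additive because, on a generic line, the restriction of a series has the same
  order as the series itself.\<close>

lemma order_ge_mult_cancel:
  assumes g: "g \<in> order_ge d" "g \<notin> order_ge (Suc d)" and gq: "g * q \<in> order_ge (d + l)"
  shows "q \<in> order_ge l"
proof (rule ccontr)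
  assume "q \<notin> order_ge l"
  then obtain e i j where e: "e < l" "q \<in> order_ge e" "i + j = e" "q $ i $ j \<noteq> 0"
    by (rule exists_lowest_term)
  obtain a b where ab: "a + b < Suc d" "g $ a $ b \<noteq> 0" using g(2) by (auto simp: order_ge_def)
  moreover have "\<not> a + b < d" using g(1) ab by (auto simp: order_ge_def)
  ultimately have "a + b = d" by linarith
  then have "leading_poly d g * leading_poly e q \<noteq> 0"
    using leading_poly_nonzero ab e by simp
  then obtain s where "poly (leading_poly d g * leading_poly e q) s \<noteq> 0" by (rule poly_nonroot)
  then have s: "eval_x (line s) g $ d \<noteq> 0" "eval_x (line s) q $ e \<noteq> 0"
    by (simp_all add: poly_leading_poly)
  have "subdegree (eval_x (line s) g) = d"
    using s eval_x_line_order[OF g(1)] by (intro subdegreeI) auto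
  moreover have "subdegree (eval_x (line s) q) = e"
    using s eval_x_line_order[OF e(2)] by (intro subdegreeI) auto
  moreover have "eval_x (line s) g \<noteq> 0" "eval_x (line s) q \<noteq> 0" using s by auto
  ultimately have "subdegree (eval_x (line s) (g * q)) = d + e" "eval_x (line s) (g * q) \<noteq> 0"
    by (simp_all add: eval_x_mult)
  then have "eval_x (line s) (g * q) $ (d + e) \<noteq> 0" by (metis nth_subdegree_nonzero)
  then show False using eval_x_line_order[OF gq] e(1) by simp
qed


section \<open>Puiseux factorization\<close>

definition ramify :: "nat \<Rightarrow> complex fps \<Rightarrow> complex fps" where
  "ramify N c = c oo fps_X ^ N"

definition ramify2 :: "nat \<Rightarrow> series2 \<Rightarrow> series2" where
  "ramify2 N F = Abs_fps (\<lambda>i. ramify N (F $ i))"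

lemma ramify2_nth [simp]: "ramify2 N F $ i = ramify N (F $ i)"
  by (simp add: ramify2_def)

lemma ramify_nth: "ramify N c $ j = (if N dvd j then c $ (j div N) else 0)"
  unfolding ramify_def by (rule fps_nth_compose_X_power)

lemma ramify_nth_0 [simp]: "ramify N c $ 0 = c $ 0"
  by (simp add: ramify_nth)

lemma ramify_0 [simp]: "ramify N 0 = 0" and ramify_1 [simp]: "ramify N 1 = 1"
  and ramify_add: "ramify N (c + d) = ramify N c + ramify N d"
  and ramify_diff: "ramify N (c - d) = ramify N c - ramify N d"
  and ramify_sum: "ramify N (sum f A) = (\<Sum>i\<in>A. ramify N (f i))"
  by (simp_all add: ramify_def fps_compose_add_distrib fps_compose_sub_distrib fps_compose_sum_distrib)

lemma ramify_const [simp]: "ramify N (fps_const z) = fps_const z"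
  by (simp add: ramify_def)

context
  fixes N :: nat assumes N: "N > 0"
begin

lemma ramify_mult: "ramify N (c * d) = ramify N c * ramify N d"
  unfolding ramify_def using N by (intro fps_compose_mult_distrib) simp

lemma ramify_eq_0_iff [simp]: "ramify N c = 0 \<longleftrightarrow> c = 0"
  unfolding ramify_def using N by (subst fps_compose_eq_0_iff) auto

lemma subdegree_ramify [simp]: "subdegree (ramify N c) = N * subdegree c"
  unfolding ramify_def using N by (subst subdegree_fps_compose) (auto simp: fps_X_power_subdegree)

lemma ramify_X: "ramify N fps_X = fps_X ^ N"
  unfolding ramify_def using N by (intro fps_X_fps_compose_startby0) simp

lemma ramify_power: "ramify N (c ^ n) = ramify N c ^ n"
  by (induction n) (simp_all add: ramify_mult)

lemma ramify_ramify: "M > 0 \<Longrightarrow> ramify N (ramify M c) = ramify (N * M) c"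
  using N by (auto simp: fps_eq_iff ramify_nth dvd_div_iff_mult div_mult2_eq mult.commute
      intro: dvd_mult_left)

lemma ramify2_mult: "ramify2 N (F * G) = ramify2 N F * ramify2 N G"
  by (rule fps_ext) (simp add: fps_mult_nth ramify_sum ramify_mult)

end

lemma ramify2_add: "ramify2 N (F + G) = ramify2 N F + ramify2 N G"
  and ramify2_diff: "ramify2 N (F - G) = ramify2 N F - ramify2 N G"
  by (simp_all add: fps_eq_iff ramify_add ramify_diff)

lemma ramify2_ramify2: "N > 0 \<Longrightarrow> M > 0 \<Longrightarrow> ramify2 N (ramify2 M F) = ramify2 (N * M) F"
  by (rule fps_ext) (simp add: ramify_ramify)

lemma ramify2_1 [simp]: "ramify2 (Suc 0) F = F"
  by (rule fps_ext)+ (simp add: ramify_nth)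

lemma ramify2_const [simp]: "ramify2 N (fps_const c) = fps_const (ramify N c)"
  and ramify2_X [simp]: "ramify2 N fps_X = fps_X"
  by (rule fps_ext; simp add: fps_X_nth)+

section \<open>Polynomials in \<open>x\<close> over power series, and Weierstrass
  polynomials\<close>

lemma map_poly_hom_add:
  fixes h :: "'a::comm_ring_1 \<Rightarrow> 'b::comm_ring_1"
  assumes "h 0 = 0" "\<And>x y. h (x + y) = h x + h y"
  shows "map_poly h (p + q) = map_poly h p + map_poly h q"
  by (rule poly_eqI) (simp add: coeff_map_poly assms)

lemma map_poly_hom_mult:
  fixes h :: "'a::comm_ring_1 \<Rightarrow> 'b::comm_ring_1"
  assumes "h 0 = 0" "\<And>x y. h (x + y) = h x + h y" "\<And>x y. h (x * y) = h x * h y"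
  shows "map_poly h (p * q) = map_poly h p * map_poly h q"
proof (rule poly_eqI)
  have sum: "h (sum f A) = (\<Sum>i\<in>A. h (f i))" for f and A :: "nat set"
    by (induction A rule: infinite_finite_induct) (simp_all add: assms)
  show "coeff (map_poly h (p * q)) n = coeff (map_poly h p * map_poly h q) n" for n
    by (simp add: coeff_map_poly coeff_mult assms sum)
qed

lemma map_poly_hom_pcompose:
  fixes h :: "'a::comm_ring_1 \<Rightarrow> 'b::comm_ring_1"
  assumes "h 0 = 0" "\<And>x y. h (x + y) = h x + h y" "\<And>x y. h (x * y) = h x * h y"
  shows "map_poly h (pcompose p q) = pcompose (map_poly h p) (map_poly h q)"
  by (induction p)
    (simp_all add: pcompose_pCons map_poly_pCons map_poly_hom_add map_poly_hom_mult assms)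

lemma pcompose_hom_power: "pcompose (p ^ n) q = pcompose p q ^ n" for p q :: "'a::comm_ring_1 poly"
  by (induction n) (simp_all add: pcompose_mult pcompose_1)

lemma degree_translate:
  fixes p :: "'a::idom poly" shows "degree (pcompose p [:b, 1:]) = degree p"
  by (simp add: degree_pcompose)

text \<open>The second part shows which translation removes the next-to-leading coefficient, as
  needed at the start of \<open>puiseux_root\<close>.\<close>

lemma coeff_translate_second:
  fixes p :: "'a::idom poly"
  shows "degree p \<le> m \<Longrightarrow> coeff (pcompose p [:b, 1:]) m = coeff p m"
    and "degree p \<le> Suc m \<Longrightarrow> coeff (pcompose p [:b, 1:]) m = coeff p m + of_nat (Suc m) * b * coeff p (Suc m)"
proof -
  have lead: "coeff (pcompose p [:b, 1:]) m = coeff p m" if "degree p \<le> m" for p :: "'a poly" and m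
  proof (cases "degree p = m")
    case True
    have "coeff (pcompose p [:b, 1:]) (degree (pcompose p [:b, 1:])) = coeff p (degree p)"
      by (subst lead_coeff_comp) simp_all
    then show ?thesis using True by (simp add: degree_translate)
  next
    case False
    then show ?thesis using that degree_translate[of p b] by (simp add: coeff_eq_0)
  qed
  then show "degree p \<le> m \<Longrightarrow> coeff (pcompose p [:b, 1:]) m = coeff p m" .
  show "degree p \<le> Suc m \<Longrightarrow> coeff (pcompose p [:b, 1:]) m = coeff p m + of_nat (Suc m) * b * coeff p (Suc m)"
  proof (induction p arbitrary: m)
    case (pCons a p)
    have d: "degree p \<le> m" using pCons.prems by (cases "p = 0") auto
    show ?case
    proof (cases m)
      case 0
      then obtain z where "p = [:z:]" using d degree_eq_zeroE[of p] by auto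
      then show ?thesis using 0 by (simp add: pcompose_pCons)
    next
      case (Suc k)
      then have "coeff (pcompose p [:b, 1:]) k = coeff p k + of_nat (Suc k) * b * coeff p (Suc k)"
        using pCons.IH[of k] d by simp
      then show ?thesis
        using lead[OF d] Suc by (simp add: pcompose_pCons algebra_simps)
    qed
  qed simp
qed

lemma eval_x_fps_of_poly:
  assumes "\<phi> $ 0 = 0" shows "eval_x \<phi> (fps_of_poly p) = poly p \<phi>"
  by (induction p) (simp_all add: fps_of_poly_pCons eval_x_add eval_x_mult assms)

lemma ramify2_fps_of_poly: "ramify2 N (fps_of_poly p) = fps_of_poly (map_poly (ramify N) p)"
  by (rule fps_ext) (simp add: coeff_map_poly)

text \<open>Dividing \<open>x^n\<close> by \<open>g\<close> makes \<open>x^n\<close> minus the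
  remainder a multiple of \<open>g\<close>. On \<open>y = 0\<close>, where \<open>g\<close> starts
  with \<open>x^n\<close>, the coefficients below \<open>n\<close> show that the remainder vanishes,
  and the coefficient at \<open>n\<close> shows that the quotient is a unit.\<close>

theorem weierstrass_preparation:
  assumes g: "regular_x n g"
  obtains W u where "fps_of_poly W = u * g" "u $ 0 $ 0 \<noteq> 0" "degree W = n" "coeff W n = 1"
    "\<And>i. i < n \<Longrightarrow> coeff W i $ 0 = 0"
proof -
  obtain Q R where Q: "fps_X ^ n = Q * g + R" and R: "\<And>i. i \<ge> n \<Longrightarrow> R $ i = 0"
    using weierstrass_division[OF g] by metis
  have nth: "(if i = n then 1 else 0) = (\<Sum>k\<le>i. Q $ k $ 0 * g $ (i - k) $ 0) + R $ i $ 0" for i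
  proof -
    have "(fps_X ^ n :: series2) $ i $ 0 = (Q * g + R) $ i $ 0" using Q by simp
    then show ?thesis by (simp add: fps2_mult_nth fps_X_power_nth split: if_splits)
  qed
  define W where "W = monom 1 n - (\<Sum>i<n. monom (R $ i) i)"
  have coeff: "coeff W i = (if i = n then 1 else if i < n then - (R $ i) else 0)" for i
    by (auto simp: W_def coeff_sum)
  have "coeff W n = 1" "degree W \<le> n" by (auto simp: coeff intro: degree_le)
  then have W: "degree W = n" "coeff W n = 1"
    using le_degree[of W n] by auto
  have "fps_of_poly W = Q * g"
  proof (rule fps_ext)
    fix i
    have "(fps_X ^ n :: series2) $ i = (Q * g) $ i + R $ i" using Q by simp
    then show "fps_of_poly W $ i = (Q * g) $ i"
      using R[of i] by (auto simp: coeff fps_X_power_nth neg_eq_iff_add_eq_0 add.commute)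
  qed
  moreover have "Q $ 0 $ 0 \<noteq> 0"
  proof
    assume "Q $ 0 $ 0 = 0"
    then have "Q $ k $ 0 * g $ (n - k) $ 0 = 0" if "k \<le> n" for k
      using g that by (cases "k = 0") (auto simp: regular_x_def)
    then have "(\<Sum>k\<le>n. Q $ k $ 0 * g $ (n - k) $ 0) = 0"
      by (intro sum.neutral) auto
    then show False using nth[of n] R[of n] by simp
  qed
  moreover have "coeff W i $ 0 = 0" if "i < n" for i
  proof -
    have "(\<Sum>k\<le>i. Q $ k $ 0 * g $ (i - k) $ 0) = 0"
      using g that by (intro sum.neutral) (auto simp: regular_x_def)
    then show ?thesis using nth[of i] that by (simp add: coeff)
  qed
  ultimately show ?thesis using that W by blast
qed

lemma degree_map_poly_monic:
  assumes "degree W = n" "coeff W n = 1"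
  shows "degree (map_poly (ramify N) W) = n"
proof (rule antisym)
  show "degree (map_poly (ramify N) W) \<le> n"
    using assms(1) by (intro degree_le) (auto simp: coeff_map_poly coeff_eq_0)
  show "n \<le> degree (map_poly (ramify N) W)"
    using assms(2) by (intro le_degree) (simp add: coeff_map_poly)
qed

text \<open>On \<open>y = 0\<close> the polynomial reduces to \<open>x^n\<close>, whose only root is
  0. This makes evaluation at the root legitimate.\<close>

lemma weierstrass_root_nth_0:
  assumes "degree W = n" "coeff W n = 1" "\<And>i. i < n \<Longrightarrow> coeff W i $ 0 = 0" "n > 0"
    "poly (map_poly (ramify N) W) \<psi> = (0 :: complex fps)"
  shows "\<psi> $ 0 = 0"
proof -
  have "degree (map_poly (ramify N) W) = n"
    using assms by (intro degree_map_poly_monic)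
  then have "0 = (\<Sum>i\<le>n. ramify N (coeff W i) * \<psi> ^ i)"
    using assms(5) by (simp add: poly_altdef coeff_map_poly)
  then have "0 = (\<Sum>i\<le>n. ramify N (coeff W i) * \<psi> ^ i) $ 0" by simp
  also have "\<dots> = (\<Sum>i\<le>n. coeff W i $ 0 * (\<psi> $ 0) ^ i)"
    by (simp add: fps_sum_nth fps_nth_power_0)
  also have "\<dots> = (\<Sum>i\<le>n. if i = n then (\<psi> $ 0) ^ n else 0)"
    using assms(2,3) by (intro sum.cong refl) (auto simp: le_less)
  finally show ?thesis using assms by simp
qed

text \<open>This takes the place of a Hensel factorization. After moving \<open>c\<close> to the
  origin, \<open>Q\<close> is regular of order \<open>m\<close>, the multiplicity of
  \<open>c\<close>, so up to a unit it is a Weierstrass polynomial of degree \<open>m\<close>. The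
  unit does not vanish at the root of the latter, which is thus a root of \<open>Q\<close> as
  well.\<close>

lemma translate_to_weierstrass_root:
  fixes Q :: "complex fps poly" and c :: complex
  assumes Qb: "map_poly (\<lambda>c. c $ 0) Q = [:-c, 1:] ^ m * r" "poly r c \<noteq> 0" and m: "m > 0"
    and root: "\<And>W :: complex fps poly. degree W = m \<Longrightarrow> coeff W m = 1 \<Longrightarrow>
      \<exists>N>0. \<exists>\<psi>. poly (map_poly (ramify N) W) \<psi> = 0"
  shows "\<exists>N>0. \<exists>\<psi>. poly (map_poly (ramify N) Q) \<psi> = 0"
proof -
  define Q2 where "Q2 = pcompose Q [:fps_const c, 1:]"
  have "map_poly (\<lambda>c. c $ 0) Q2 = pcompose (map_poly (\<lambda>c. c $ 0) Q) [:c, 1:]"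
    unfolding Q2_def by (subst map_poly_hom_pcompose) (simp_all add: map_poly_pCons)
  also have "\<dots> = [:0, 1:] ^ m * pcompose r [:c, 1:]"
    by (simp add: Qb pcompose_mult pcompose_hom_power pcompose_pCons)
  also have "\<dots> = monom 1 m * pcompose r [:c, 1:]"
    by (simp add: monom_altdef)
  finally have "coeff (map_poly (\<lambda>c. c $ 0) Q2) i = coeff (monom 1 m * pcompose r [:c, 1:]) i" for i
    by simp
  then have "coeff Q2 i $ 0 = (if m \<le> i then coeff (pcompose r [:c, 1:]) (i - m) else 0)" for i
    by (simp add: coeff_map_poly coeff_monom_mult)
  moreover have "coeff (pcompose r [:c, 1:]) 0 = poly r c" by simp
  ultimately have "regular_x m (fps_of_poly Q2)"
    using Qb by (simp add: regular_x_def)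
  then obtain W u where W: "fps_of_poly W = u * fps_of_poly Q2" "u $ 0 $ 0 \<noteq> 0" "degree W = m"
    "coeff W m = 1" "\<And>i. i < m \<Longrightarrow> coeff W i $ 0 = 0" by (rule weierstrass_preparation) blast
  then obtain N \<psi> where N: "N > 0" and \<psi>: "poly (map_poly (ramify N) W) \<psi> = 0" using root by blast
  have \<psi>0: "\<psi> $ 0 = 0" by (rule weierstrass_root_nth_0[OF W(3-5) m \<psi>])
  have "eval_x \<psi> (ramify2 N (fps_of_poly W)) = 0"
    by (simp add: ramify2_fps_of_poly eval_x_fps_of_poly \<psi> \<psi>0)
  then have "eval_x \<psi> (ramify2 N u) * eval_x \<psi> (ramify2 N (fps_of_poly Q2)) = 0"
    by (simp add: W(1) ramify2_mult N eval_x_mult \<psi>0)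
  moreover have "eval_x \<psi> (ramify2 N u) $ 0 \<noteq> 0"
    using W(2) by (simp add: eval_x_nth_0 \<psi>0)
  ultimately have "eval_x \<psi> (ramify2 N (fps_of_poly Q2)) = 0" by auto
  then have "poly (map_poly (ramify N) Q2) \<psi> = 0"
    by (simp add: ramify2_fps_of_poly eval_x_fps_of_poly \<psi>0)
  then have "poly (map_poly (ramify N) Q) (fps_const c + \<psi>) = 0"
    unfolding Q2_def
    by (subst (asm) map_poly_hom_pcompose)
      (simp_all add: ramify_add ramify_mult N map_poly_pCons poly_pcompose)
  then show ?thesis using N by blast
qed


text \<open>The first edge of the Newton polygon: \<open>p / q\<close> is the least slope
  \<open>sl\<close>. The substitution \<open>y = t^q\<close>, \<open>x = t^p x'\<close> then allows
  division by \<open>t^(p n)\<close>, and the coefficient attaining the slope keeps a nonzero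
  constant term.\<close>

lemma reduced_newton_polygon:
  fixes P :: "complex fps poly"
  assumes n: "degree P = n" "coeff P n = 1" and nz: "\<exists>i<n. coeff P i \<noteq> 0"
  obtains q p Q k where "q > 0" "degree Q = n" "coeff Q n = 1" "k < n" "coeff Q k $ 0 \<noteq> 0"
    "\<And>i. i \<le> n \<Longrightarrow> ramify q (coeff P i) = fps_X ^ (p * (n - i)) * coeff Q i"
proof -
  define S where "S = {k. 1 \<le> k \<and> k \<le> n \<and> coeff P (n - k) \<noteq> 0}"
  define sl where "sl k = real (subdegree (coeff P (n - k))) / real k" for k
  have fin: "finite S" unfolding S_def by simp
  obtain i where i: "i < n" "coeff P i \<noteq> 0" using nz by blast
  then have "n - i \<in> S" by (auto simp: S_def)
  then obtain q where q: "q \<in> S" "\<And>k. k \<in> S \<Longrightarrow> sl q \<le> sl k"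
    using ex_min_if_finite[of "sl ` S"] fin
    by (metis (no_types, lifting) arg_min_if_finite(1) arg_min_least emptyE)
  \<comment> \<open>The fraction \<open>p / q\<close> need not be in lowest terms: \<open>q\<close>
    is simply the distance from the top of a coefficient attaining the least slope.\<close>
  define p where "p = subdegree (coeff P (n - q))"
  have q1: "1 \<le> q" "q \<le> n" "coeff P (n - q) \<noteq> 0" using q(1) by (auto simp: S_def)
  have le: "p * k \<le> q * subdegree (coeff P (n - k))" if "k \<in> S" for k
  proof -
    have "k > 0" using that by (simp add: S_def)
    then have "real p * real k \<le> real q * real (subdegree (coeff P (n - k)))"
      using q(2)[OF that] q1(1) by (simp add: sl_def p_def field_simps)
    then show ?thesis by (metis of_nat_le_iff of_nat_mult)
  qed
  define b where "b i = fps_shift (p * (n - i)) (ramify q (coeff P i))" for i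
  have b: "ramify q (coeff P i) = fps_X ^ (p * (n - i)) * b i" if "i \<le> n" for i
  proof (cases "coeff P i = 0")
    case False
    have "p * (n - i) \<le> subdegree (ramify q (coeff P i))"
    proof (cases "i = n")
      case False
      then have "n - i \<in> S" using \<open>coeff P i \<noteq> 0\<close> that by (auto simp: S_def)
      from le[OF this] show ?thesis using q1 that by simp
    qed simp
    then show ?thesis
      unfolding b_def by (metis fps_shift_times_fps_X_power mult.commute)
  qed (simp add: b_def)
  define Q where "Q = (\<Sum>i\<le>n. monom (b i) i)"
  have Q: "coeff Q i = (if i \<le> n then b i else 0)" for i
    by (simp add: Q_def coeff_sum)
  have bn: "b n = 1" using b[of n] n by simp
  have "degree Q \<le> n" by (rule degree_le) (simp add: Q)
  moreover have "n \<le> degree Q" by (rule le_degree) (simp add: Q bn)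
  moreover have "b (n - q) $ 0 \<noteq> 0"
    using q1 by (simp add: b_def ramify_nth p_def mult.commute[of _ q])
  ultimately show ?thesis
    using that[of q Q "n - q" p] q1 b by (simp add: Q bn)
qed

text \<open>Newton's method by induction on the degree. The translation by \<open>a\<close> kills
  the coefficient of degree \<open>n - 1\<close>, which prevents the reduced polynomial
  \<open>Qb\<close> from being a multiple of an \<open>n\<close>-th power. Each of its roots then
  has multiplicity below \<open>n\<close>, and the induction hypothesis applies at such a
  root.\<close>

theorem puiseux_root:
  fixes P :: "complex fps poly"
  assumes "degree P = n" "coeff P n = 1" "n > 0"
  shows "\<exists>N>0. \<exists>\<phi>. poly (map_poly (ramify N) P) \<phi> = 0"
  using assms
proof (induction n arbitrary: P rule: less_induct)
  case (less n)
  obtain n' where n': "n = Suc n'" using less.prems gr0_implies_Suc by blast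
  define a where "a = fps_const (1 / of_nat n) * coeff P n'"
  define P1 where "P1 = pcompose P [:-a, 1:]"
  have P1: "degree P1 = n" "coeff P1 n = 1"
    using less.prems coeff_translate_second(1)[of P n "-a"] by (simp_all add: P1_def degree_translate)
  have "of_nat n * a = coeff P n'"
    using less.prems(3) by (simp add: a_def fps_of_nat[symmetric] mult.assoc[symmetric] del: fps_of_nat)
  then have P1n: "coeff P1 n' = 0"
    using less.prems coeff_translate_second(2)[of P n' "-a"] n' by (simp add: P1_def)
  have "\<exists>N>0. \<exists>\<phi>. poly (map_poly (ramify N) P1) \<phi> = 0"
  proof (cases "\<exists>i<n. coeff P1 i \<noteq> 0")
    case False
    then have "poly (map_poly (ramify 1) P1) 0 = 0"
      using less.prems by (simp add: poly_0_coeff_0 coeff_map_poly)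
    then show ?thesis by blast
  next
    case True
    from reduced_newton_polygon[OF P1 True] obtain q p Q k
      where q: "q > 0" and Q: "degree Q = n" "coeff Q n = 1" and k: "k < n" "coeff Q k $ 0 \<noteq> 0"
        and PQ: "\<And>i. i \<le> n \<Longrightarrow> ramify q (coeff P1 i) = fps_X ^ (p * (n - i)) * coeff Q i" by metis
    define Qb where "Qb = map_poly (\<lambda>c. c $ 0) Q"
    have Qbc: "coeff Qb i = coeff Q i $ 0" for i by (simp add: Qb_def coeff_map_poly)
    have "degree Qb \<le> n" using Q(1) by (intro degree_le) (simp add: Qbc coeff_eq_0)
    moreover have "n \<le> degree Qb" using Q by (intro le_degree) (simp add: Qbc)
    ultimately have Qbd: "degree Qb = n" by simp
    then have "\<not> constant (poly Qb)" using less.prems(3) by (simp add: constant_degree)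
    then obtain c where c: "poly Qb c = 0" using fundamental_theorem_of_algebra by blast
    have Qb0: "Qb \<noteq> 0" using Qbd less.prems(3) by auto
    define m where "m = order c Qb"
    obtain r where r: "Qb = [:-c, 1:] ^ m * r" "\<not> [:-c, 1:] dvd r"
      using order_decomp[OF Qb0, of c] by (auto simp: m_def)
    have m0: "m > 0" using c Qb0 by (simp add: m_def order_gt_0_iff)
    have rc: "poly r c \<noteq> 0" using r(2) by (simp add: poly_eq_0_iff_dvd)
    have r0: "r \<noteq> 0" using rc by auto
    have "m + degree r = n"
      using Qbd r(1) r0 by (simp add: degree_mult_eq degree_linear_power)
    \<comment> \<open>If \<open>Qb\<close> were \<open>z (x - c)^n\<close>, its vanishing
      coefficient of degree \<open>n - 1\<close> would force \<open>c = 0\<close>, and then the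
      coefficient of degree \<open>k < n\<close> would vanish too.\<close>
    moreover have "m \<noteq> n"
    proof
      assume "m = n"
      then have "degree r = 0" using \<open>m + degree r = n\<close> by simp
      then obtain z where z: "r = [:z:]" using degree_eq_zeroE by blast
      have co: "coeff Qb i = (of_nat (n choose i) * (- c) ^ (n - i)) * z" if "i \<le> n" for i
        using that r(1) coeff_linear_poly_power[of i n "-c" 1] \<open>m = n\<close> by (simp add: z)
      have "coeff Q n' = 0"
        using PQ[of n'] P1n q n' by (simp)
      then have "of_nat n * c * z = 0"
        using co[of n'] n' by (simp add: Qbc)
      moreover have "z \<noteq> 0" using z r0 by auto
      ultimately have "c = 0" using less.prems(3) by auto
      then show False using co[of k] k by (simp add: Qbc)
    qed
    ultimately have mn: "m < n" by simp
    have "\<exists>N>0. \<exists>\<psi>. poly (map_poly (ramify N) Q) \<psi> = 0"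
      by (rule translate_to_weierstrass_root[of Q c m r, OF _ rc m0 less.IH[OF mn _ _ m0]])
        (use r(1) in \<open>simp_all add: Qb_def\<close>)
    then obtain M \<psi> where M: "M > 0" "poly (map_poly (ramify M) Q) \<psi> = 0" by blast
    \<comment> \<open>The factor \<open>t^(p M)\<close> undoes the scaling of \<open>x\<close> after
      the further ramification by \<open>M\<close>; all terms then share the factor
      \<open>t^(p M n)\<close>.\<close>
    have "poly (map_poly (ramify (M * q)) P1) (fps_X ^ (p * M) * \<psi>) =
        (\<Sum>i\<le>n. ramify (M * q) (coeff P1 i) * (fps_X ^ (p * M) * \<psi>) ^ i)"
      using degree_map_poly_monic[OF P1] by (simp add: poly_altdef coeff_map_poly)
    also have "\<dots> = (\<Sum>i\<le>n. fps_X ^ (p * M * n) * (ramify M (coeff Q i) * \<psi> ^ i))"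
    proof (rule sum.cong[OF refl])
      fix i assume "i \<in> {..n}"
      then have i: "i \<le> n" by simp
      have "ramify (M * q) (coeff P1 i) = ramify M (fps_X ^ (p * (n - i)) * coeff Q i)"
        using PQ[OF i] M(1) q by (simp flip: ramify_ramify)
      also have "\<dots> = fps_X ^ (p * M * (n - i)) * ramify M (coeff Q i)"
        using M(1) by (simp add: ramify_mult ramify_power ramify_X mult_ac flip: power_mult)
      finally have "ramify (M * q) (coeff P1 i) * (fps_X ^ (p * M) * \<psi>) ^ i =
          (fps_X ^ (p * M * (n - i)) * fps_X ^ (p * M * i)) * (ramify M (coeff Q i) * \<psi> ^ i)"
        by (simp add: power_mult_distrib mult_ac flip: power_mult)
      also have "fps_X ^ (p * M * (n - i)) * fps_X ^ (p * M * i) = (fps_X ^ (p * M * n) :: complex fps)"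
        using i by (simp flip: power_add add_mult_distrib2)
      finally show "ramify (M * q) (coeff P1 i) * (fps_X ^ (p * M) * \<psi>) ^ i =
          fps_X ^ (p * M * n) * (ramify M (coeff Q i) * \<psi> ^ i)" .
    qed
    also have "\<dots> = fps_X ^ (p * M * n) * poly (map_poly (ramify M) Q) \<psi>"
      using degree_map_poly_monic[OF Q] by (simp add: poly_altdef coeff_map_poly sum_distrib_left)
    finally have "poly (map_poly (ramify (M * q)) P1) (fps_X ^ (p * M) * \<psi>) = 0" using M by simp
    moreover have "M * q > 0" using M q by simp
    ultimately show ?thesis by blast
  qed
  then obtain N \<phi> where N: "N > 0" "poly (map_poly (ramify N) P1) \<phi> = 0" by blast
  then have "poly (map_poly (ramify N) P) (\<phi> - ramify N a) = 0"
    unfolding P1_def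
    by (subst (asm) map_poly_hom_pcompose)
      (simp_all add: ramify_add ramify_mult map_poly_pCons poly_pcompose ramify_diff[of N 0 a, simplified])
  then show ?case using N(1) by blast
qed

text \<open>One root is split off at a time. Each later ramification by \<open>M\<close> merely
  replaces an earlier branch \<open>\<phi>(t)\<close> by \<open>\<phi>(t^M)\<close>.\<close>

theorem puiseux_factorization:
  assumes "regular_x n g"
  shows "\<exists>N>0. \<exists>\<phi>s u. length \<phi>s = n \<and> (\<forall>\<phi>\<in>set \<phi>s. \<phi> $ 0 = 0) \<and> u $ 0 $ 0 \<noteq> 0 \<and>
    ramify2 N g = u * (\<Prod>\<phi>\<leftarrow>\<phi>s. fps_X - fps_const \<phi>)"
  using assms
proof (induction n arbitrary: g)
  case 0
  then show ?case
    by (intro exI[of _ 1] conjI exI[of _ "[]"] exI[of _ g]) (auto simp: regular_x_def)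
next
  case (Suc n)
  obtain W u where W: "fps_of_poly W = u * g" "u $ 0 $ 0 \<noteq> 0" "degree W = Suc n"
    "coeff W (Suc n) = 1" "\<And>i. i < Suc n \<Longrightarrow> coeff W i $ 0 = 0"
    using weierstrass_preparation[OF Suc.prems] by metis
  obtain N \<phi> where N: "N > 0" and \<phi>: "poly (map_poly (ramify N) W) \<phi> = 0"
    using puiseux_root[OF W(3,4)] by blast
  have \<phi>0: "\<phi> $ 0 = 0" by (rule weierstrass_root_nth_0[OF W(3-5) zero_less_Suc \<phi>])
  have "eval_x \<phi> (ramify2 N u * ramify2 N g) = 0"
    using arg_cong[OF W(1), of "\<lambda>F. eval_x \<phi> (ramify2 N F)"]
    by (simp add: ramify2_mult N ramify2_fps_of_poly eval_x_fps_of_poly \<phi> \<phi>0)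
  moreover have "eval_x \<phi> (ramify2 N u) $ 0 \<noteq> 0" using W(2) by (simp add: eval_x_nth_0 \<phi>0)
  ultimately have "eval_x \<phi> (ramify2 N g) = 0" by (auto simp: eval_x_mult \<phi>0)
  then obtain g' where g': "ramify2 N g = (fps_X - fps_const \<phi>) * g'"
    using eval_x_eq_0_iff[OF \<phi>0] by blast
  \<comment> \<open>On \<open>y = 0\<close> the linear factor is just \<open>x\<close>, so the
    cofactor is regular of order one less.\<close>
  have "g $ i $ 0 = (if i = 0 then 0 else g' $ (i - 1) $ 0)" for i
  proof -
    have "g $ i $ 0 = ramify2 N g $ i $ 0" by simp
    also have "\<dots> = (if i = 0 then 0 else g' $ (i - 1) $ 0)"
      unfolding g' using \<phi>0 by (simp add: left_diff_distrib)
    finally show ?thesis .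
  qed
  from this[of "Suc _"] have "regular_x n g'"
    using Suc.prems by (auto simp: regular_x_def)
  then obtain M \<phi>s v where M: "M > 0" "length \<phi>s = n" "\<forall>\<phi>\<in>set \<phi>s. \<phi> $ 0 = 0" "v $ 0 $ 0 \<noteq> 0"
    "ramify2 M g' = v * (\<Prod>\<phi>\<leftarrow>\<phi>s. fps_X - fps_const \<phi>)" using Suc.IH by blast
  have "ramify2 (M * N) g = ramify2 M (ramify2 N g)" using M N by (simp add: ramify2_ramify2)
  also have "\<dots> = (fps_X - fps_const (ramify M \<phi>)) * ramify2 M g'"
    unfolding g' by (simp add: ramify2_mult M ramify2_diff)
  also have "\<dots> = v * (\<Prod>\<phi>\<leftarrow>ramify M \<phi> # \<phi>s. fps_X - fps_const \<phi>)"
    by (simp add: M(5) mult_ac)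
  finally show ?case
    using M N \<phi>0 by (intro exI[of _ "M * N"] conjI exI[of _ "ramify M \<phi> # \<phi>s"] exI[of _ v]) auto
qed


section \<open>Intersection numbers of formal curves\<close>

definition is_ideal :: "series2 set \<Rightarrow> bool" where
  "is_ideal J \<longleftrightarrow> 0 \<in> J \<and> (\<forall>a\<in>J. \<forall>b\<in>J. a + b \<in> J) \<and> (\<forall>r. \<forall>a\<in>J. r * a \<in> J)"

abbreviation codim :: "series2 set \<Rightarrow> nat \<Rightarrow> bool" where
  "codim J n \<equiv> S.quot_dim J UNIV n"

definition gen2 :: "series2 \<Rightarrow> series2 \<Rightarrow> series2 set" where
  "gen2 g h = {F. \<exists>a b. F = a * g + b * h}"

lemma is_idealD:
  assumes "is_ideal J"
  shows "0 \<in> J" "a \<in> J \<Longrightarrow> b \<in> J \<Longrightarrow> a + b \<in> J" "a \<in> J \<Longrightarrow> r * a \<in> J"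
    "a \<in> J \<Longrightarrow> a * r \<in> J" "a \<in> J \<Longrightarrow> b \<in> J \<Longrightarrow> a - b \<in> J" "S.subspace J"
proof -
  show 1: "0 \<in> J" "a \<in> J \<Longrightarrow> b \<in> J \<Longrightarrow> a + b \<in> J" "a \<in> J \<Longrightarrow> r * a \<in> J" for a b r
    using assms by (auto simp: is_ideal_def)
  show "a \<in> J \<Longrightarrow> a * r \<in> J" using 1(3)[of a r] by (simp add: mult.commute)
  show "a \<in> J \<Longrightarrow> b \<in> J \<Longrightarrow> a - b \<in> J" using 1(2)[of a "-1 * b"] 1(3)[of b "-1"] by simp
  show "S.subspace J" using 1 by (auto simp: S.subspace_def)
qed

lemma is_ideal_gen2: "is_ideal (gen2 g h)"
  unfolding is_ideal_def gen2_def
proof (intro conjI ballI allI CollectI)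
  show "\<exists>a b. 0 = a * g + b * h" by (intro exI[of _ 0]) simp
next
  fix F G assume "F \<in> {F. \<exists>a b. F = a * g + b * h}" "G \<in> {F. \<exists>a b. F = a * g + b * h}"
  then obtain a b c d where "F = a * g + b * h" "G = c * g + d * h" by blast
  then have "F + G = (a + c) * g + (b + d) * h" by (simp add: algebra_simps)
  then show "\<exists>a b. F + G = a * g + b * h" by blast
next
  fix r F assume "F \<in> {F. \<exists>a b. F = a * g + b * h}"
  then obtain a b where "F = a * g + b * h" by blast
  then have "r * F = (r * a) * g + (r * b) * h" by (simp add: algebra_simps)
  then show "\<exists>a b. r * F = a * g + b * h" by blast
qed

lemma gen2I: "a * g + b * h \<in> gen2 g h"
  by (auto simp: gen2_def)

lemma gen2_memI: "F = a * g + b * h \<Longrightarrow> F \<in> gen2 g h"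
  by (auto simp: gen2_def)

lemma gen2E: assumes "F \<in> gen2 g h" obtains a b where "F = a * g + b * h"
  using assms by (auto simp: gen2_def)

text \<open>Multiplication by \<open>a\<close> induces an isomorphism from
  \<open>V / (J : a)\<close> onto \<open>(a V + J) / J\<close>, and carries flags along.\<close>

lemma quot_dim_mult_image:
  assumes J: "is_ideal J" and K: "S.quot_dim {u. a * u \<in> J} V n"
  shows "S.quot_dim J {x. \<exists>u\<in>V. x - a * u \<in> J} n"
  using K
proof (induction rule: S.quot_dim.induct)
  case quot_dim_0
  have "{x. \<exists>u\<in>{u. a * u \<in> J}. x - a * u \<in> J} = J"
  proof safe
    fix x u assume "a * u \<in> J" "x - a * u \<in> J"
    from is_idealD(2)[OF J this(2,1)] show "x \<in> J" by simp
  next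
    fix x assume "x \<in> J"
    then show "\<exists>u\<in>{u. a * u \<in> J}. x - a * u \<in> J"
      using is_idealD(1)[OF J] by (intro bexI[of _ 0]) auto
  qed
  then show ?case using S.quot_dim_0 by simp
next
  case (quot_dim_Suc V n v)
  have sK: "S.subspace {u. a * u \<in> J}"
    using is_idealD(1,2,3)[OF J]
    by (auto simp: S.subspace_def distrib_left mult.left_commute[of a "const2 _"])
  have V: "S.subspace V" "{u. a * u \<in> J} \<subseteq> V"
    using S.quot_dim_subspace[OF quot_dim_Suc.hyps(1) sK] by auto
  let ?E = "\<lambda>V. {x. \<exists>u\<in>V. x - a * u \<in> J}"
  have "a * v \<notin> ?E V"
  proof
    assume "a * v \<in> ?E V"
    then obtain u where u: "u \<in> V" "a * (v - u) \<in> J" by (auto simp: right_diff_distrib)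
    then have "v - u \<in> V" using V by blast
    from S.subspace_add[OF V(1) this u(1)] show False using quot_dim_Suc.hyps by simp
  qed
  moreover have "?E {x. \<exists>c. x - const2 c * v \<in> V} = {x. \<exists>c. x - const2 c * (a * v) \<in> ?E V}"
  proof safe
    fix x u c assume "x - a * u \<in> J" "u - const2 c * v \<in> V"
    then show "\<exists>c. x - const2 c * (a * v) \<in> ?E V"
      by (intro exI[of _ c] CollectI bexI[of _ "u - const2 c * v"]) (auto simp: algebra_simps)
  next
    fix x c u assume "u \<in> V" "x - const2 c * (a * v) - a * u \<in> J"
    then show "\<exists>u\<in>{x. \<exists>c. x - const2 c * v \<in> V}. x - a * u \<in> J"
      by (intro bexI[of _ "u + const2 c * v"]) (auto simp: algebra_simps intro!: exI[of _ c])
  qed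
  ultimately show ?case using S.quot_dim_Suc[OF quot_dim_Suc.IH] by simp
qed

text \<open>Additivity along the exact sequence from \<open>R / (J : a)\<close>, by multiplication
  with \<open>a\<close>, through \<open>R / J\<close> to \<open>R / (J + aR)\<close>, where
  \<open>R\<close> is the ring of formal series.\<close>

lemma codim_add:
  assumes "is_ideal J" "codim {u. a * u \<in> J} p" "codim {x. \<exists>u. x - a * u \<in> J} q"
  shows "codim J (p + q)"
  using quot_dim_mult_image[OF assms(1,2)] assms(3) S.quot_dim_trans by auto

lemma dvd_iff_subdegree_le:
  fixes f g :: "complex fps" assumes "f \<noteq> 0"
  shows "f dvd g \<longleftrightarrow> (\<forall>j<subdegree f. g $ j = 0)"
proof (cases "g = 0")
  case False
  then have "f dvd g \<longleftrightarrow> subdegree f \<le> subdegree g" using assms by (simp add: fps_dvd_iff)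
  also have "\<dots> \<longleftrightarrow> (\<forall>j<subdegree f. g $ j = 0)"
    using False by (meson linorder_not_le nth_less_subdegree_zero nth_subdegree_nonzero order_less_le_trans)
  finally show ?thesis .
qed simp

text \<open>Evaluation identifies the quotient by \<open>x - \<phi>\<close> with the series in one
  variable, where the ideal generated by the value of \<open>H\<close> is determined by its order.
  The sets \<open>B m\<close> are the preimages of the powers of the maximal ideal there.\<close>

lemma codim_linear:
  assumes \<phi>: "\<phi> $ 0 = 0" and H: "eval_x \<phi> H \<noteq> 0"
  shows "codim (gen2 (fps_X - fps_const \<phi>) H) (subdegree (eval_x \<phi> H))"
proof -
  define B where "B m = {F. \<forall>j<m. eval_x \<phi> F $ j = 0}" for m
  have c: "eval_x \<phi> (const2 c) = fps_const c" for c by (simp add: const2_def \<phi>)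
  have step: "S.quot_dim (B (Suc m)) (B m) 1" for m
  proof -
    define v where "v = fps_const (fps_X ^ m :: complex fps)"
    have v: "eval_x \<phi> v = fps_X ^ m" by (simp add: v_def \<phi>)
    have "v \<notin> B (Suc m)" by (auto simp: B_def v)
    moreover have "{x. \<exists>c. x - const2 c * v \<in> B (Suc m)} = B m"
    proof safe
      fix x c assume "x - const2 c * v \<in> B (Suc m)"
      then show "x \<in> B m"
        by (auto simp: B_def eval_x_diff eval_x_mult \<phi> c v fps_X_power_nth less_Suc_eq)
    next
      fix x assume "x \<in> B m"
      then show "\<exists>c. x - const2 c * v \<in> B (Suc m)"
        by (intro exI[of _ "eval_x \<phi> x $ m"])
          (auto simp: B_def eval_x_diff eval_x_mult \<phi> c v fps_X_power_nth less_Suc_eq)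
    qed
    ultimately show ?thesis
      using S.quot_dim_Suc[OF S.quot_dim_0, of v "B (Suc m)"] by simp
  qed
  have "codim (B m) m" for m
  proof (induction m)
    case 0
    have "B 0 = UNIV" by (simp add: B_def)
    then show ?case using S.quot_dim_0[of UNIV] by simp
  next
    case (Suc m)
    then show ?case using S.quot_dim_trans[OF Suc step[of m]] by simp
  qed
  moreover have "gen2 (fps_X - fps_const \<phi>) H = B (subdegree (eval_x \<phi> H))"
  proof -
    have "F \<in> gen2 (fps_X - fps_const \<phi>) H \<longleftrightarrow> eval_x \<phi> H dvd eval_x \<phi> F" for F
    proof
      assume "F \<in> gen2 (fps_X - fps_const \<phi>) H"
      then obtain a b where "F = a * (fps_X - fps_const \<phi>) + b * H" by (rule gen2E)
      then show "eval_x \<phi> H dvd eval_x \<phi> F" by (simp add: eval_x_add eval_x_mult eval_x_diff \<phi>)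
    next
      assume "eval_x \<phi> H dvd eval_x \<phi> F"
      then obtain w where "eval_x \<phi> F = eval_x \<phi> H * w" by blast
      then have "eval_x \<phi> (F - fps_const w * H) = 0" by (simp add: eval_x_diff eval_x_mult \<phi>)
      then obtain q where "F - fps_const w * H = (fps_X - fps_const \<phi>) * q"
        using eval_x_eq_0_iff[OF \<phi>] by blast
      then have "F = q * (fps_X - fps_const \<phi>) + fps_const w * H" by (simp add: algebra_simps)
      then show "F \<in> gen2 (fps_X - fps_const \<phi>) H" by (rule gen2_memI)
    qed
    then show ?thesis using dvd_iff_subdegree_le[OF H] by (auto simp: B_def)
  qed
  ultimately show ?thesis by simp
qed

text \<open>The exact sequence for multiplication by \<open>P\<close>: since \<open>H\<close>
  cancels modulo \<open>P\<close>, the colon ideal is generated by \<open>Q\<close> and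
  \<open>H\<close>, while adding \<open>P\<close> leaves the ideal of \<open>P\<close> and
  \<open>H\<close>.\<close>

lemma codim_gen2_mult:
  assumes nz: "\<And>c. P dvd c * H \<Longrightarrow> P dvd c" and P0: "P \<noteq> 0"
    and "codim (gen2 P H) p" "codim (gen2 Q H) q"
  shows "codim (gen2 (P * Q) H) (q + p)"
proof (rule codim_add[OF is_ideal_gen2, of P])
  have "{u. P * u \<in> gen2 (P * Q) H} = gen2 Q H"
  proof safe
    fix u assume "P * u \<in> gen2 (P * Q) H"
    then obtain a b where ab: "P * u = a * (P * Q) + b * H" by (rule gen2E)
    then have "b * H = P * (u - a * Q)" by (simp add: algebra_simps)
    then have "P dvd b * H" by simp
    then obtain b' where "b = P * b'" using nz by blast
    then have "P * u = P * (a * Q + b' * H)" using ab by (simp add: algebra_simps)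
    then have "u = a * Q + b' * H" using P0 by simp
    then show "u \<in> gen2 Q H" by (rule gen2_memI)
  next
    fix u assume "u \<in> gen2 Q H"
    then obtain a b where "u = a * Q + b * H" by (rule gen2E)
    then have "P * u = a * (P * Q) + (P * b) * H" by (simp add: algebra_simps)
    then show "P * u \<in> gen2 (P * Q) H" by (rule gen2_memI)
  qed
  then show "codim {u. P * u \<in> gen2 (P * Q) H} q" using assms by simp
  have "{x. \<exists>u. x - P * u \<in> gen2 (P * Q) H} = gen2 P H"
  proof safe
    fix x u assume "x - P * u \<in> gen2 (P * Q) H"
    then obtain a b where "x - P * u = a * (P * Q) + b * H" by (rule gen2E)
    then have "x = (u + a * Q) * P + b * H" by (simp add: algebra_simps)
    then show "x \<in> gen2 P H" by (rule gen2_memI)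
  next
    fix x assume "x \<in> gen2 P H"
    then obtain a b where "x = a * P + b * H" by (rule gen2E)
    then have "x - P * a = 0 * (P * Q) + b * H" by (simp add: algebra_simps)
    then have "x - P * a \<in> gen2 (P * Q) H" by (rule gen2_memI)
    then show "\<exists>u. x - P * u \<in> gen2 (P * Q) H" by blast
  qed
  then show "codim {x. \<exists>u. x - P * u \<in> gen2 (P * Q) H} p" using assms by simp
qed

lemma gen2_unit:
  assumes "u $ 0 $ 0 \<noteq> 0" shows "gen2 (u * g) h = gen2 g h"
proof -
  have "u dvd 1" by (rule iffD2[OF unit_dvd_1_iff assms])
  then obtain v where v: "1 = u * v" ..
  show ?thesis
  proof (rule Set.set_eqI, rule iffI)
    fix F assume "F \<in> gen2 (u * g) h"
    then obtain a b where "F = a * (u * g) + b * h" by (rule gen2E)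
    then have "F = (a * u) * g + b * h" by (simp only: mult.assoc)
    then show "F \<in> gen2 g h" by (rule gen2_memI)
  next
    fix F assume "F \<in> gen2 g h"
    then obtain a b where F: "F = a * g + b * h" by (rule gen2E)
    have "(a * v) * (u * g) = (a * g) * (u * v)" by (simp only: mult_ac)
    then have "F = (a * v) * (u * g) + b * h" unfolding F by (simp only: v[symmetric] mult_1_right)
    then show "F \<in> gen2 (u * g) h" by (rule gen2_memI)
  qed
qed

lemma codim_split:
  assumes "\<forall>\<phi>\<in>set \<phi>s. \<phi> $ 0 = 0 \<and> eval_x \<phi> H \<noteq> 0"
  shows "codim (gen2 (\<Prod>\<phi>\<leftarrow>\<phi>s. fps_X - fps_const \<phi>) H) (\<Sum>\<phi>\<leftarrow>\<phi>s. subdegree (eval_x \<phi> H))"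
  using assms
proof (induction \<phi>s)
  case Nil
  have "gen2 1 H = UNIV" using gen2I[of _ 1 0 H] by auto
  then show ?case using S.quot_dim_0[of UNIV] by simp
next
  case (Cons \<phi> \<phi>s)
  let ?P = "fps_X - fps_const \<phi>"
  have \<phi>: "\<phi> $ 0 = 0" "eval_x \<phi> H \<noteq> 0" using Cons.prems by auto
  \<comment> \<open>Modulo \<open>x - \<phi>\<close> the ring is a domain, by evaluation, so an
    \<open>H\<close> with nonzero value cancels.\<close>
  have "?P dvd c" if "?P dvd c * H" for c
  proof -
    have "eval_x \<phi> (c * H) = 0" using that eval_x_eq_0_iff[OF \<phi>(1)] by blast
    then have "eval_x \<phi> c = 0" using \<phi> by (simp add: eval_x_mult)
    then show ?thesis using eval_x_eq_0_iff[OF \<phi>(1)] by blast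
  qed
  moreover have P0: "?P \<noteq> 0"
  proof
    assume "?P = 0"
    then have "?P $ 1 = 0" by simp
    then show False by simp
  qed
  moreover have "codim (gen2 (\<Prod>\<phi>\<leftarrow>\<phi>s. fps_X - fps_const \<phi>) H) (\<Sum>\<phi>\<leftarrow>\<phi>s. subdegree (eval_x \<phi> H))"
    using Cons.prems by (intro Cons.IH) auto
  ultimately have "codim (gen2 (?P * (\<Prod>\<phi>\<leftarrow>\<phi>s. fps_X - fps_const \<phi>)) H)
      ((\<Sum>\<phi>\<leftarrow>\<phi>s. subdegree (eval_x \<phi> H)) + subdegree (eval_x \<phi> H))"
    using codim_linear[OF \<phi>] by (intro codim_gen2_mult)
  then show ?case by (simp add: add.commute)
qed

section \<open>Series in \<open>t\<close> as a free module over series in \<open>t^N\<close>\<close>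

definition slice :: "nat \<Rightarrow> nat \<Rightarrow> complex fps \<Rightarrow> complex fps" where
  "slice N i c = Abs_fps (\<lambda>b. c $ (N * b + i))"

definition slice2 :: "nat \<Rightarrow> nat \<Rightarrow> series2 \<Rightarrow> series2" where
  "slice2 N i F = Abs_fps (\<lambda>a. slice N i (F $ a))"

lemma slice2_nth [simp]: "slice2 N i F $ a = slice N i (F $ a)"
  by (simp add: slice2_def)

lemma slice_nth [simp]: "slice N i c $ b = c $ (N * b + i)"
  by (simp add: slice_def)

lemma slice_sum: "slice N i (sum f A) = (\<Sum>k\<in>A. slice N i (f k))"
  by (rule fps_ext) (simp add: fps_sum_nth)

lemma slice2_add: "slice2 N i (F + G) = slice2 N i F + slice2 N i G"
  and slice2_diff: "slice2 N i (F - G) = slice2 N i F - slice2 N i G"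
  and slice2_const2: "slice2 N i (const2 c * F) = const2 c * slice2 N i F"
  by ((rule fps_ext)+, simp)+

text \<open>Slice \<open>i\<close> is the coordinate at \<open>t^i\<close> with respect to the basis
  \<open>1, t, ..., t^(N-1)\<close>: a series in \<open>t^N\<close> shifts exponents by multiples of
  \<open>N\<close> only and so respects residue classes.\<close>

lemma slice_mult_ramify:
  assumes i: "i < N" shows "slice N i (ramify N g * c) = g * slice N i c"
proof (rule fps_ext)
  fix b
  have "slice N i (ramify N g * c) $ b = (\<Sum>l\<le>N * b + i. ramify N g $ l * c $ (N * b + i - l))"
    by (simp add: fps_mult_nth atLeast0AtMost)
  also have "\<dots> = (\<Sum>l\<in>(*) N ` {..b}. ramify N g $ l * c $ (N * b + i - l))"
  proof (rule sum.mono_neutral_right)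
    show "(*) N ` {..b} \<subseteq> {..N * b + i}" by (auto intro: trans_le_add1)
    show "\<forall>l\<in>{..N * b + i} - (*) N ` {..b}. ramify N g $ l * c $ (N * b + i - l) = 0"
    proof
      fix l assume l: "l \<in> {..N * b + i} - (*) N ` {..b}"
      have "\<not> N dvd l"
      proof
        assume "N dvd l"
        then obtain m where m: "l = N * m" by blast
        have "N * m < N * Suc b" using l i m by simp
        then have "m \<le> b" using i by (simp only: nat_mult_less_cancel1)
        then show False using l m by blast
      qed
      then show "ramify N g $ l * c $ (N * b + i - l) = 0" by (simp add: ramify_nth)
    qed
  qed simp
  also have "\<dots> = (\<Sum>m\<le>b. ramify N g $ (N * m) * c $ (N * b + i - N * m))"
    using i by (subst sum.reindex) (auto intro!: inj_onI)
  also have "\<dots> = (\<Sum>m\<le>b. g $ m * c $ (N * (b - m) + i))"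
  proof (rule sum.cong[OF refl])
    fix m assume "m \<in> {..b}"
    then obtain d where "b = m + d" using le_Suc_ex by blast
    then show "ramify N g $ (N * m) * c $ (N * b + i - N * m) = g $ m * c $ (N * (b - m) + i)"
      using i by (simp add: ramify_nth add_mult_distrib2)
  qed
  also have "\<dots> = (g * slice N i c) $ b" by (simp add: fps_mult_nth atLeast0AtMost)
  finally show "slice N i (ramify N g * c) $ b = (g * slice N i c) $ b" .
qed

lemma slice2_mult_ramify2:
  "i < N \<Longrightarrow> slice2 N i (ramify2 N g * F) = g * slice2 N i F"
  by (rule fps_ext) (simp add: fps_mult_nth slice_sum slice_mult_ramify)

lemma slice_shift_ramify:
  assumes "i < N" "k < N"
  shows "slice N i (fps_X ^ k * ramify N c) = (if i = k then c else 0)"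
proof (rule fps_ext)
  fix b
  show "slice N i (fps_X ^ k * ramify N c) $ b = (if i = k then c else 0) $ b"
  proof (cases "i = k")
    case True
    then show ?thesis using assms by (simp add: fps_X_power_mult_nth ramify_nth)
  next
    case False
    have "\<not> N dvd N * b + i - k" if "k \<le> N * b + i"
    proof
      assume "N dvd N * b + i - k"
      then have "(N * b + i) mod N = k mod N" using that by (metis mod_eq_dvd_iff_nat)
      then show False using assms False by simp
    qed
    then show ?thesis using False by (auto simp: fps_X_power_mult_nth ramify_nth)
  qed
qed

lemma slice2_shift_ramify2:
  "i < N \<Longrightarrow> k < N \<Longrightarrow>
    slice2 N i (fps_const (fps_X ^ k) * ramify2 N F) = (if i = k then F else 0)"
  by (rule fps_ext) (simp add: slice_shift_ramify)

lemma series2_eq_slices: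
  assumes N: "N > 0"
  shows "F = (\<Sum>i<N. fps_const (fps_X ^ i) * ramify2 N (slice2 N i F))"
proof (rule fps_ext, rule fps_ext)
  fix a b
  have "(\<Sum>i<N. fps_const (fps_X ^ i) * ramify2 N (slice2 N i F)) $ a $ b =
     (\<Sum>i<N. if b < i then 0 else if N dvd b - i then F $ a $ (N * ((b - i) div N) + i) else 0)"
    by (auto simp: fps_sum_nth fps_X_power_mult_nth ramify_nth intro!: sum.cong)
  also have "\<dots> = (\<Sum>i<N. if i = b mod N then F $ a $ b else 0)"
  proof (rule sum.cong[OF refl])
    fix i assume i: "i \<in> {..<N}"
    show "(if b < i then 0 else if N dvd b - i then F $ a $ (N * ((b - i) div N) + i) else 0) =
       (if i = b mod N then F $ a $ b else 0)"
    proof (cases "b < i")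
      case True
      then show ?thesis using i by auto
    next
      case False
      then have "N dvd b - i \<longleftrightarrow> i = b mod N"
        using i by (metis lessThan_iff linorder_not_less mod_eq_dvd_iff_nat mod_less)
      moreover have "N * ((b - i) div N) + i = b" if "N dvd b - i"
        using that False by simp
      ultimately show ?thesis using False by auto
    qed
  qed
  also have "\<dots> = F $ a $ b" using N by simp
  finally show "F $ a $ b = (\<Sum>i<N. fps_const (fps_X ^ i) * ramify2 N (slice2 N i F)) $ a $ b" by simp
qed

text \<open>Extending an ideal along a free extension acts coordinatewise.\<close>

lemma gen2_ramify2:
  assumes N: "N > 0"
  shows "gen2 (ramify2 N g) (ramify2 N h) = {F. \<forall>i<N. slice2 N i F \<in> gen2 g h}"
proof safe
  fix F i assume "F \<in> gen2 (ramify2 N g) (ramify2 N h)" and i: "i < N"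
  then obtain a b where "F = a * ramify2 N g + b * ramify2 N h" by (blast elim: gen2E)
  then have "slice2 N i F = slice2 N i a * g + slice2 N i b * h"
    using slice2_mult_ramify2[OF i, of g a] slice2_mult_ramify2[OF i, of h b]
    by (simp add: slice2_add mult.commute)
  then show "slice2 N i F \<in> gen2 g h" by (rule gen2_memI)
next
  fix F assume *: "\<forall>i<N. slice2 N i F \<in> gen2 g h"
  note J = is_idealD[OF is_ideal_gen2[of "ramify2 N g" "ramify2 N h"]]
  have "fps_const (fps_X ^ i) * ramify2 N (slice2 N i F) \<in> gen2 (ramify2 N g) (ramify2 N h)"
    if i: "i < N" for i
  proof -
    obtain a b where "slice2 N i F = a * g + b * h" using * i by (blast elim: gen2E)
    then have "ramify2 N (slice2 N i F) = ramify2 N a * ramify2 N g + ramify2 N b * ramify2 N h"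
      using N by (simp add: ramify2_add ramify2_mult)
    then have "ramify2 N (slice2 N i F) \<in> gen2 (ramify2 N g) (ramify2 N h)" by (rule gen2_memI)
    then show ?thesis by (rule J(3))
  qed
  then have "(\<Sum>i\<in>A. fps_const (fps_X ^ i) * ramify2 N (slice2 N i F)) \<in> gen2 (ramify2 N g) (ramify2 N h)"
    if "A \<subseteq> {..<N}" for A
    using that
  proof (induction A rule: infinite_finite_induct)
    case (insert x A)
    then show ?case using J(2) by simp
  qed (simp_all add: J(1))
  from this[of "{..<N}"] show "F \<in> gen2 (ramify2 N g) (ramify2 N h)"
    using series2_eq_slices[OF N, of F] by simp
qed

text \<open>One coordinate is released at a time: those below \<open>r\<close> are already free,
  those above \<open>r\<close> stay in \<open>J\<close>, and slice \<open>r\<close> runs through the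
  given flag.\<close>

lemma quot_dim_slices:
  assumes "S.quot_dim J V n" and J: "is_ideal J" and r: "r < N"
  shows "S.quot_dim {F. \<forall>i. r \<le> i \<longrightarrow> i < N \<longrightarrow> slice2 N i F \<in> J}
    {F. slice2 N r F \<in> V \<and> (\<forall>i. r < i \<longrightarrow> i < N \<longrightarrow> slice2 N i F \<in> J)} n"
  using assms(1)
proof (induction rule: S.quot_dim.induct)
  case quot_dim_0
  have "{F. slice2 N r F \<in> J \<and> (\<forall>i. r < i \<longrightarrow> i < N \<longrightarrow> slice2 N i F \<in> J)} =
      {F. \<forall>i. r \<le> i \<longrightarrow> i < N \<longrightarrow> slice2 N i F \<in> J}"
    using r by (auto simp: le_less)
  then show ?case using S.quot_dim_0 by simp
next
  case (quot_dim_Suc V n v)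
  let ?E = "\<lambda>V. {F. slice2 N r F \<in> V \<and> (\<forall>i. r < i \<longrightarrow> i < N \<longrightarrow> slice2 N i F \<in> J)}"
  define e where "e = fps_const (fps_X ^ r) * ramify2 N v"
  have e: "slice2 N i (F - const2 c * e) = slice2 N i F - (if i = r then const2 c * v else 0)"
    if "i < N" for i F c
    using that r by (simp add: slice2_diff slice2_const2 e_def slice2_shift_ramify2)
  have "e \<notin> ?E V" using quot_dim_Suc.hyps r by (auto simp: e_def slice2_shift_ramify2)
  moreover have "?E {x. \<exists>c. x - const2 c * v \<in> V} = {F. \<exists>c. F - const2 c * e \<in> ?E V}"
    using r by (auto simp: e)
  ultimately show ?case using S.quot_dim_Suc[OF quot_dim_Suc.IH] by simp
qed

lemma codim_ramify2:
  assumes N: "N > 0" and p: "codim (gen2 g h) p"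
  shows "codim (gen2 (ramify2 N g) (ramify2 N h)) (N * p)"
proof -
  define D where "D r = {F. \<forall>i. r \<le> i \<longrightarrow> i < N \<longrightarrow> slice2 N i F \<in> gen2 g h}" for r
  have step: "S.quot_dim (D r) (D (Suc r)) p" if "r < N" for r
    using quot_dim_slices[OF p is_ideal_gen2 that] by (simp add: D_def Suc_le_eq)
  have "S.quot_dim (D 0) (D r) (r * p)" if "r \<le> N" for r
    using that
  proof (induction r)
    case 0
    then show ?case using S.quot_dim_0 by simp
  next
    case (Suc r)
    then show ?case using S.quot_dim_trans[OF step[of r], of "D 0" "r * p"] by (simp add: add.commute)
  qed
  moreover have "D N = UNIV" "D 0 = gen2 (ramify2 N g) (ramify2 N h)"
    using gen2_ramify2[OF N] by (auto simp: D_def)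
  ultimately show ?thesis by (metis order_refl)
qed

text \<open>The splitting into linear factors shows finiteness only after ramification. The ideal
  downstairs is the preimage of the extended one, because slice 0 recovers a series from its
  ramification; so it has finite codimension too.\<close>

lemma codim_of_ramify2:
  assumes N: "N > 0" and q: "codim (gen2 (ramify2 N g) (ramify2 N h)) q"
  shows "\<exists>p. codim (gen2 g h) p"
proof -
  have sec: "slice2 N 0 (ramify2 N F) = F" for F
    using slice2_shift_ramify2[of 0 N 0 F] N by simp
  have "ramify2 N -` gen2 (ramify2 N g) (ramify2 N h) = gen2 g h"
  proof safe
    fix F assume "ramify2 N F \<in> gen2 (ramify2 N g) (ramify2 N h)"
    then show "F \<in> gen2 g h" unfolding gen2_ramify2[OF N] using N sec by force
  next
    fix F assume "F \<in> gen2 g h"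
    then obtain a b where "F = a * g + b * h" by (rule gen2E)
    then have "ramify2 N F = ramify2 N a * ramify2 N g + ramify2 N b * ramify2 N h"
      using N by (simp add: ramify2_add ramify2_mult)
    then show "F \<in> ramify2 N -` gen2 (ramify2 N g) (ramify2 N h)" by (intro vimageI2 gen2_memI)
  qed
  moreover have "ramify2 N (const2 c * F) = const2 c * ramify2 N F" for c F
    using N by (simp add: ramify2_mult const2_def)
  ultimately show ?thesis
    using S.quot_dim_vimage[OF q is_idealD(6)[OF is_ideal_gen2], of "ramify2 N"]
    by (simp add: ramify2_add)
qed

lemma codim_unique: "is_ideal J \<Longrightarrow> codim J n \<Longrightarrow> codim J m \<Longrightarrow> m = n"
  using S.quot_dim_unique is_idealD(6) by blast

text \<open>The codimension after ramification is computed twice: as \<open>N\<close> times the one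
  before, and branch by branch. Uniqueness equates the two.\<close>

theorem intersection_number_puiseux:
  assumes N: "N > 0" and g: "ramify2 N g = u * (\<Prod>\<phi>\<leftarrow>\<phi>s. fps_X - fps_const \<phi>)" "u $ 0 $ 0 \<noteq> 0"
    and h: "\<forall>\<phi>\<in>set \<phi>s. \<phi> $ 0 = 0 \<and> eval_x \<phi> (ramify2 N h) \<noteq> 0"
  shows "\<exists>p. codim (gen2 g h) p \<and> N * p = (\<Sum>\<phi>\<leftarrow>\<phi>s. subdegree (eval_x \<phi> (ramify2 N h)))"
proof -
  have q: "codim (gen2 (ramify2 N g) (ramify2 N h)) (\<Sum>\<phi>\<leftarrow>\<phi>s. subdegree (eval_x \<phi> (ramify2 N h)))"
    unfolding g(1) gen2_unit[OF g(2)] by (rule codim_split[OF h])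
  obtain p where p: "codim (gen2 g h) p" using codim_of_ramify2[OF N q] by blast
  show ?thesis
    using codim_unique[OF is_ideal_gen2 q codim_ramify2[OF N p]] p by blast
qed


section \<open>Elimination for a reduced curve\<close>

definition restrict_x :: "series2 \<Rightarrow> complex fps" where
  "restrict_x F = Abs_fps (\<lambda>i. F $ i $ 0)"

definition var_y :: series2 where
  "var_y = fps_const fps_X"

text \<open>Plain \<open>dvd\<close> on series would allow a formal cofactor, about which
  reducedness says nothing.\<close>

definition conv_dvd :: "series2 \<Rightarrow> series2 \<Rightarrow> bool" where
  "conv_dvd a b \<longleftrightarrow> (\<exists>c. convergent2 c \<and> b = c * a)"

lemma restrict_x_nth [simp]: "restrict_x F $ i = F $ i $ 0"
  by (simp add: restrict_x_def)

lemma restrict_x_mult: "restrict_x (F * G) = restrict_x F * restrict_x G"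
  by (rule fps_ext) (simp add: fps_mult_nth fps_sum_nth atLeast0AtMost)

lemma regular_x_iff: "regular_x n g \<longleftrightarrow> restrict_x g \<noteq> 0 \<and> subdegree (restrict_x g) = n"
proof
  assume "regular_x n g"
  then show "restrict_x g \<noteq> 0 \<and> subdegree (restrict_x g) = n"
    by (auto simp: regular_x_def fps_eq_iff intro!: subdegreeI)
next
  assume *: "restrict_x g \<noteq> 0 \<and> subdegree (restrict_x g) = n"
  then have "restrict_x g $ n \<noteq> 0" using nth_subdegree_nonzero by blast
  moreover have "restrict_x g $ i = 0" if "i < n" for i using * that by auto
  ultimately show "regular_x n g" by (simp add: regular_x_def)
qed

lemma convergent2_var_y: "convergent2 var_y"
  by (rule convergent2I[of 1 1]) (auto simp: var_y_def fps_X_nth)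

lemma divide_by_var_y:
  assumes "restrict_x F = 0"
  obtains G where "F = var_y * G" "convergent2 F \<Longrightarrow> convergent2 G" "\<And>i j. G $ i $ j = F $ i $ Suc j"
proof -
  define G where "G = Abs_fps (\<lambda>i. fps_shift 1 (F $ i))"
  have G: "G $ i $ j = F $ i $ Suc j" for i j by (simp add: G_def)
  have "F $ i $ 0 = 0" for i using assms by (metis fps_zero_nth restrict_x_nth)
  then have "F = var_y * G"
    by (intro fps_ext) (simp add: var_y_def G fps_X_mult_nth)
  moreover have "convergent2 G" if cF: "convergent2 F"
  proof -
    obtain M R where F: "M \<ge> 0" "R \<ge> 1" "\<And>i j. norm (F $ i $ j) \<le> M * R ^ (i + j)"
      using convergent2E[OF cF] by blast
    show ?thesis
    proof (rule convergent2I[of "M * R" R])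
      show "norm (G $ i $ j) \<le> M * R * R ^ (i + j)" for i j
        using F(3)[of i "Suc j"] by (simp add: G mult.assoc)
    qed (use F in auto)
  qed
  ultimately show ?thesis using that G by blast
qed

lemma extract_var_y_power:
  assumes "F \<noteq> 0"
  obtains k G where "F = var_y ^ k * G" "restrict_x G \<noteq> 0" "convergent2 F \<Longrightarrow> convergent2 G"
proof -
  have "\<exists>k G. F = var_y ^ k * G \<and> restrict_x G \<noteq> 0 \<and> (convergent2 F \<longrightarrow> convergent2 G)"
    if "F $ i $ j \<noteq> 0" for i j
    using that
  proof (induction j arbitrary: F)
    case 0
    then have "restrict_x F $ i \<noteq> 0" by simp
    then have "restrict_x F \<noteq> 0" by (metis fps_zero_nth)
    then show ?case by (intro exI[of _ 0] exI[of _ F]) simp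
  next
    case (Suc j)
    show ?case
    proof (cases "restrict_x F = 0")
      case False
      then show ?thesis by (intro exI[of _ 0] exI[of _ F]) simp
    next
      case True
      obtain H where H: "F = var_y * H" "convergent2 F \<Longrightarrow> convergent2 H"
        "\<And>i j. H $ i $ j = F $ i $ Suc j" using divide_by_var_y[OF True] by metis
      have "H $ i $ j \<noteq> 0" using Suc.prems H(3) by simp
      then obtain k G where G: "H = var_y ^ k * G" "restrict_x G \<noteq> 0" "convergent2 H \<longrightarrow> convergent2 G"
        using Suc.IH by blast
      have "F = var_y ^ Suc k * G" unfolding H(1) G(1) by (simp only: power_Suc mult.assoc)
      then show ?thesis using H(2) G by blast
    qed
  qed
  moreover obtain i j where "F $ i $ j \<noteq> 0" using assms by (auto simp: fps_eq_iff)
  ultimately show ?thesis using that by blast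
qed

text \<open>On \<open>y = 0\<close> the cofactor must vanish because \<open>g\<close> does not, so a
  factor \<open>y\<close> can be cancelled on both sides.\<close>

lemma conv_dvd_var_y_cancel:
  assumes "restrict_x g \<noteq> 0" "conv_dvd g (var_y ^ k * a)"
  shows "conv_dvd g a"
  using assms(2)
proof (induction k)
  case (Suc k)
  then obtain c where c: "convergent2 c" "var_y ^ Suc k * a = c * g"
    unfolding conv_dvd_def by blast
  have "restrict_x var_y = 0" by (rule fps_ext) (simp add: var_y_def)
  then have "restrict_x c * restrict_x g = 0"
    using arg_cong[OF c(2), of restrict_x] by (simp add: restrict_x_mult)
  then have c0: "restrict_x c = 0" using assms(1) by simp
  obtain d where d: "c = var_y * d" "convergent2 d" using divide_by_var_y[OF c0] c(1) by metis
  have "var_y \<noteq> 0" by (simp add: var_y_def)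
  moreover have "var_y * (var_y ^ k * a) = var_y * (d * g)"
    using c(2) unfolding d(1) by (simp only: power_Suc mult.assoc)
  ultimately have "var_y ^ k * a = d * g" by (metis mult_left_cancel)
  then show ?case using Suc.IH d(2) unfolding conv_dvd_def by blast
qed simp

lemma conv_dvdI: "convergent2 c \<Longrightarrow> b = c * a \<Longrightarrow> conv_dvd a b"
  unfolding conv_dvd_def by blast

lemma conv_dvdE: assumes "conv_dvd a b" obtains c where "convergent2 c" "b = c * a"
  using assms unfolding conv_dvd_def by blast

lemma conv_dvd_diff:
  assumes "conv_dvd g a" "conv_dvd g b" shows "conv_dvd g (a - b)"
proof -
  obtain c d where c: "convergent2 c" "a = c * g" and d: "convergent2 d" "b = d * g"
    using assms by (blast elim: conv_dvdE)
  show ?thesis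
    by (rule conv_dvdI[of "c - d"]) (simp_all add: c d convergent2_diff left_diff_distrib)
qed

lemma conv_dvd_mult_left:
  assumes "convergent2 c" "conv_dvd g a" shows "conv_dvd g (c * a)"
proof -
  obtain d where d: "convergent2 d" "a = d * g" using assms(2) by (rule conv_dvdE)
  show ?thesis
    by (rule conv_dvdI[of "c * d"]) (simp_all add: d assms(1) convergent2_mult mult.assoc)
qed

lemma conv_dvd_trans:
  assumes "conv_dvd a b" "conv_dvd b c" shows "conv_dvd a c"
proof -
  obtain d where d: "convergent2 d" "c = d * b" using assms(2) by (rule conv_dvdE)
  show ?thesis unfolding d(2) by (rule conv_dvd_mult_left[OF d(1) assms(1)])
qed

text \<open>The ideal quotient \<open>g : f\<close> is generated by an element of least order along \<open>y = 0\<close>; its cofactor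
  in \<open>g\<close> is a greatest common divisor of \<open>f\<close> and \<open>g\<close>. This replaces unique factorization.\<close>

lemma ideal_quotient_principal:
  assumes "convergent2 g" "convergent2 f" and g: "restrict_x g \<noteq> 0"
  obtains h e q where "convergent2 h" "convergent2 e" "convergent2 q" "g = h * e" "f = e * q"
    "\<And>a. convergent2 a \<Longrightarrow> conv_dvd g (a * f) \<Longrightarrow> conv_dvd h a"
proof -
  define I where "I = {a. convergent2 a \<and> conv_dvd g (a * f)}"
  define P where "P d \<longleftrightarrow> (\<exists>a\<in>I. restrict_x a \<noteq> 0 \<and> subdegree (restrict_x a) = d)" for d
  have gI: "g \<in> I" using assms by (auto simp: I_def conv_dvd_def mult.commute)
  define d where "d = (LEAST d. P d)"
  have "P (subdegree (restrict_x g))" using gI g by (auto simp: P_def)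
  then have "P d" unfolding d_def by (rule LeastI)
  then obtain h where h: "h \<in> I" "regular_x d h" by (auto simp: P_def regular_x_iff)
  have "conv_dvd h a" if a: "a \<in> I" for a
  proof -
    obtain Q R where Q: "a = Q * h + R" "\<And>i. i \<ge> d \<Longrightarrow> R $ i = 0" "convergent2 Q" "convergent2 R"
      using weierstrass_division[OF h(2), of a] a h(1) unfolding I_def by (metis mem_Collect_eq)
    have "R = 0"
    proof (rule ccontr)
      assume "R \<noteq> 0"
      \<comment> \<open>A nonzero remainder, freed of its powers of \<open>y\<close>, would be an
        element of \<open>I\<close> of order below \<open>d\<close> along
        \<open>y = 0\<close>.\<close>
      then obtain k G where G: "R = var_y ^ k * G" "restrict_x G \<noteq> 0" "convergent2 G"
        using extract_var_y_power Q(4) by metis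
      have "conv_dvd g (a * f - Q * (h * f))"
        using a h(1) unfolding I_def by (blast intro: conv_dvd_diff conv_dvd_mult_left Q(3))
      then have "conv_dvd g (var_y ^ k * (G * f))" using Q(1) G(1) by (simp add: algebra_simps)
      then have GI: "G \<in> I" using conv_dvd_var_y_cancel[OF g] G(3) by (simp add: I_def)
      have "G $ i $ 0 = 0" if "i \<ge> d" for i
      proof -
        have "fps_X ^ k * G $ i = R $ i"
          unfolding G(1) var_y_def by (simp add: fps_const_power)
        then show ?thesis using Q(2)[OF that] by simp
      qed
      then have "subdegree (restrict_x G) < d"
        using G(2) by (metis linorder_not_less nth_subdegree_nonzero restrict_x_nth)
      moreover have "P (subdegree (restrict_x G))" using GI G(2) by (auto simp: P_def)
      ultimately show False unfolding d_def using not_less_Least by blast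
    qed
    then show ?thesis using Q by (auto simp: conv_dvd_def)
  qed
  note hdvd = this
  obtain e where e: "convergent2 e" "g = e * h" using hdvd[OF gI] by (auto simp: conv_dvd_def)
  obtain q where q: "convergent2 q" "h * f = q * g" using h(1) by (auto simp: I_def conv_dvd_def)
  have "h \<noteq> 0" using h(2) by (auto simp: regular_x_def)
  moreover have "h * f = h * (e * q)" using q(2) e(2) by (simp add: mult_ac)
  ultimately have "f = e * q" by simp
  then show ?thesis
    using that[of h e q] e q hdvd h(1) by (auto simp: I_def mult.commute)
qed

text \<open>Gaussian elimination without division: \<open>n + 1\<close> vectors of length
  \<open>n\<close> are dependent, and cross-multiplication keeps the coefficients in the subring
  \<open>R\<close>, here later that of convergent series.\<close>

lemma subring_linear_dependence:
  fixes v :: "'k \<Rightarrow> nat \<Rightarrow> 'a::idom" and R :: "'a \<Rightarrow> bool"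
  assumes R: "R 0" "R 1" "\<And>a b. R a \<Longrightarrow> R b \<Longrightarrow> R (a + b)" "\<And>a. R a \<Longrightarrow> R (- a)"
    "\<And>a b. R a \<Longrightarrow> R b \<Longrightarrow> R (a * b)"
    and "finite K" "card K = Suc n" "\<And>k i. k \<in> K \<Longrightarrow> i < n \<Longrightarrow> R (v k i)"
  shows "\<exists>c. (\<forall>k\<in>K. R (c k)) \<and> (\<exists>k\<in>K. c k \<noteq> 0) \<and> (\<forall>i<n. (\<Sum>k\<in>K. c k * v k i) = 0)"
  using assms(6-8)
proof (induction n arbitrary: K v)
  case 0
  then have "K \<noteq> {}" by auto
  then show ?case using R by (intro exI[of _ "\<lambda>_. 1"]) auto
next
  case (Suc n)
  have sumR: "R (sum f A)" if "\<And>x. x \<in> A \<Longrightarrow> R (f x)" for f and A :: "'k set"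
    using that by (induction A rule: infinite_finite_induct) (auto intro: R)
  show ?case
  proof (cases "\<exists>p\<in>K. v p n \<noteq> 0")
    case False
    obtain p where p: "p \<in> K" using Suc.prems by fastforce
    define L where "L = K - {p}"
    have L: "finite L" "card L = Suc n" "p \<notin> L" "K = insert p L" using Suc.prems p by (auto simp: L_def)
    obtain c where c: "\<forall>k\<in>L. R (c k)" "\<exists>k\<in>L. c k \<noteq> 0" "\<forall>i<n. (\<Sum>k\<in>L. c k * v k i) = 0"
      using Suc.IH[OF L(1,2), of v] Suc.prems(3) L(4) by auto
    define b where "b k = (if k = p then 0 else c k)" for k
    have bL: "b k = c k" if "k \<in> L" for k using that L(3) by (auto simp: b_def)
    have "(\<Sum>k\<in>K. b k * v k i) = (\<Sum>k\<in>L. c k * v k i)" for i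
      unfolding L(4) using L(1,3) by (simp add: bL) (simp add: b_def)
    moreover have "(\<Sum>k\<in>L. c k * v k n) = 0" using False L(4) by (intro sum.neutral) auto
    ultimately have "\<forall>i<Suc n. (\<Sum>k\<in>K. b k * v k i) = 0" using c(3) by (auto simp: less_Suc_eq)
    moreover have "\<forall>k\<in>K. R (b k)" using c(1) R(1) L(4) by (auto simp: b_def)
    moreover have "\<exists>k\<in>K. b k \<noteq> 0" using c(2) bL L(4) by auto
    ultimately show ?thesis by blast
  next
    case True
    then obtain p where p: "p \<in> K" "v p n \<noteq> 0" by blast
    define L where "L = K - {p}"
    have L: "finite L" "card L = Suc n" "p \<notin> L" "K = insert p L" using Suc.prems p by (auto simp: L_def)
    \<comment> \<open>Row \<open>k\<close> is combined with the pivot row \<open>p\<close> so that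
      entry \<open>n\<close> cancels.\<close>
    define w where "w k i = v p n * v k i + - (v k n * v p i)" for k i
    have "R (w k i)" if "k \<in> L" "i < n" for k i
      unfolding w_def using that Suc.prems(3) L(4) by (intro R) auto
    then obtain c where c: "\<forall>k\<in>L. R (c k)" "\<exists>k\<in>L. c k \<noteq> 0" "\<forall>i<n. (\<Sum>k\<in>L. c k * w k i) = 0"
      using Suc.IH[OF L(1,2), of w] by auto
    \<comment> \<open>These are the coefficients obtained by expanding a relation among the rows
      \<open>w\<close> in terms of the rows \<open>v\<close>.\<close>
    define b where "b k = (if k = p then - (\<Sum>k\<in>L. c k * v k n) else v p n * c k)" for k
    have "(\<Sum>k\<in>K. b k * v k i) = (\<Sum>k\<in>L. c k * w k i)" for i
    proof -
      have "(\<Sum>k\<in>K. b k * v k i) = - (\<Sum>k\<in>L. c k * v k n) * v p i + (\<Sum>k\<in>L. b k * v k i)"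
        unfolding L(4) using L by (simp add: b_def)
      also have "(\<Sum>k\<in>L. b k * v k i) = (\<Sum>k\<in>L. v p n * c k * v k i)"
        using L by (intro sum.cong) (auto simp: b_def)
      also have "- (\<Sum>k\<in>L. c k * v k n) * v p i = (\<Sum>k\<in>L. - (c k * v k n * v p i))"
        by (simp add: sum_distrib_right sum_negf)
      finally show ?thesis by (simp add: w_def sum.distrib[symmetric] algebra_simps)
    qed
    moreover have "(\<Sum>k\<in>L. c k * w k n) = 0" by (simp add: w_def)
    ultimately have "\<forall>i<Suc n. (\<Sum>k\<in>K. b k * v k i) = 0" using c(3) by (auto simp: less_Suc_eq)
    moreover have "\<forall>k\<in>K. R (b k)"
      unfolding b_def using c(1) L(4) Suc.prems(3) by (auto intro!: R(4,5) sumR)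
    moreover have "\<exists>k\<in>K. b k \<noteq> 0" using c(2) p L by (auto simp: b_def)
    ultimately show ?thesis by blast
  qed
qed

lemma convergent2_const_nth: "convergent2 F \<Longrightarrow> convergent2 (fps_const (F $ i))"
proof -
  assume "convergent2 F"
  then obtain M R where F: "M \<ge> 0" "R \<ge> 1" "\<And>i j. norm (F $ i $ j) \<le> M * R ^ (i + j)"
    using convergent2E by blast
  show ?thesis
  proof (rule convergent2I[of "M * R ^ i" R])
    show "norm (fps_const (F $ i) $ a $ b) \<le> M * R ^ i * R ^ (a + b)" for a b
      using F F(3)[of i b] by (cases "a = 0") (auto simp: power_add mult_ac)
  qed (use F in auto)
qed

text \<open>While the constant coefficient \<open>c 0\<close> is zero, one factor \<open>f\<close>
  can be cancelled modulo \<open>g\<close>. Eventually a nonzero constant coefficient remains, which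
  depends on \<open>y\<close> only.\<close>

lemma elimination_from_relation:
  assumes f: "convergent2 f" "\<And>a. convergent2 a \<Longrightarrow> conv_dvd g (a * f) \<Longrightarrow> conv_dvd g a"
    and c: "\<And>k. k \<le> m \<Longrightarrow> convergent2 (fps_const (c k))" "\<exists>k\<le>m. c k \<noteq> 0"
    and rel: "conv_dvd g (\<Sum>k\<le>m. fps_const (c k) * f ^ k)"
  shows "\<exists>b a v. b \<noteq> 0 \<and> fps_const b = a * f + v * g"
  using c rel
proof (induction m arbitrary: c)
  case 0
  then obtain v where "fps_const (c 0) = v * g" by (auto simp: conv_dvd_def)
  then have "fps_const (c 0) = 0 * f + v * g" by simp
  then show ?case using 0 by (metis le_zero_eq)
next
  case (Suc m)
  define T where "T = (\<Sum>k\<le>m. fps_const (c (Suc k)) * f ^ k)"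
  have split: "(\<Sum>k\<le>Suc m. fps_const (c k) * f ^ k) = fps_const (c 0) + T * f"
    by (subst sum.atMost_Suc_shift) (simp add: T_def sum_distrib_right sum_distrib_left mult_ac)
  show ?case
  proof (cases "c 0 = 0")
    case False
    obtain v where "fps_const (c 0) + T * f = v * g"
      using Suc.prems(3) unfolding split conv_dvd_def by blast
    then have "fps_const (c 0) = (- T) * f + v * g" by (simp add: algebra_simps)
    then show ?thesis using False by blast
  next
    case True
    have cT: "convergent2 T"
      unfolding T_def using Suc.prems(1) f(1) by (intro convergent2_sum convergent2_mult convergent2_power) auto
    have "conv_dvd g T" using Suc.prems(3) f(2)[OF cT] unfolding split True by simp
    moreover have "\<exists>k\<le>m. c (Suc k) \<noteq> 0"
      using Suc.prems(2) True by (metis Suc_le_mono not0_implies_Suc)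
    ultimately show ?thesis using Suc.IH[of "\<lambda>k. c (Suc k)"] Suc.prems(1) by (simp add: T_def)
  qed
qed

text \<open>The powers \<open>1, f, \<dots>, f^n\<close> are linearly dependent in the module \<open>O2 / g\<close> of rank \<open>n\<close>.\<close>

lemma elimination:
  assumes g: "convergent2 g" "restrict_x g \<noteq> 0"
    and f: "convergent2 f" "\<And>a. convergent2 a \<Longrightarrow> conv_dvd g (a * f) \<Longrightarrow> conv_dvd g a"
  shows "\<exists>b a v. b \<noteq> 0 \<and> fps_const b = a * f + v * g"
proof -
  define n where "n = subdegree (restrict_x g)"
  have reg: "regular_x n g" using g by (simp add: n_def regular_x_iff)
  have "\<exists>Q R. f ^ k = Q * g + R \<and> (\<forall>i\<ge>n. R $ i = 0) \<and> convergent2 Q \<and> convergent2 R" for k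
    using weierstrass_division[OF reg, of "f ^ k"] convergent2_power[OF f(1)] g(1) by metis
  then obtain Q R where QR: "\<And>k. f ^ k = Q k * g + R k" "\<And>k i. i \<ge> n \<Longrightarrow> R k $ i = 0"
    "\<And>k. convergent2 (Q k)" "\<And>k. convergent2 (R k)" by metis
  have "\<exists>c. (\<forall>k\<in>{..n}. convergent2 (fps_const (c k))) \<and> (\<exists>k\<in>{..n}. c k \<noteq> 0) \<and>
      (\<forall>i<n. (\<Sum>k\<in>{..n}. c k * (R k $ i)) = 0)"
    by (rule subring_linear_dependence)
      (use QR(4) in \<open>auto simp: convergent2_0 convergent2_1 convergent2_const_nth convergent2_uminus
        simp flip: fps_const_add fps_const_mult fps_const_neg intro: convergent2_add convergent2_mult\<close>)
  then obtain c where c: "\<And>k. k \<le> n \<Longrightarrow> convergent2 (fps_const (c k))" "\<exists>k\<le>n. c k \<noteq> 0"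
    "\<And>i. i < n \<Longrightarrow> (\<Sum>k\<le>n. c k * (R k $ i)) = 0" by auto
  have "(\<Sum>k\<le>n. fps_const (c k) * R k) = 0"
  proof (rule fps_ext)
    show "(\<Sum>k\<le>n. fps_const (c k) * R k) $ i = 0 $ i" for i
      using c(3)[of i] QR(2)[of i] by (cases "i < n") (auto simp: fps_sum_nth)
  qed
  then have "(\<Sum>k\<le>n. fps_const (c k) * f ^ k) = (\<Sum>k\<le>n. fps_const (c k) * Q k) * g"
    by (simp add: QR(1) distrib_left sum.distrib sum_distrib_right mult.assoc)
  moreover have "convergent2 (\<Sum>k\<le>n. fps_const (c k) * Q k)"
    using c(1) QR(3) by (intro convergent2_sum convergent2_mult) auto
  ultimately have "conv_dvd g (\<Sum>k\<le>n. fps_const (c k) * f ^ k)" by (auto simp: conv_dvd_def)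
  from elimination_from_relation[OF f c(1,2) this] show ?thesis by blast
qed

section \<open>Derivatives, and the use of reducedness\<close>

definition dir_deriv :: "complex \<Rightarrow> series2 \<Rightarrow> series2" where
  "dir_deriv s F = const2 s * dx F + dy F"

lemma dx_mult: "dx (F * G) = dx F * G + F * dx G"
  by (simp add: dx_def algebra_simps)

lemma dy_nth [simp]: "dy F $ i = fps_deriv (F $ i)"
  by (simp add: dy_def)

lemma dy_mult: "dy (F * G) = dy F * G + F * dy G"
  by (rule fps_ext) (simp add: fps_mult_nth fps_deriv_sum sum.distrib add.commute)

lemma dx_add: "dx (F + G) = dx F + dx G" and dy_add: "dy (F + G) = dy F + dy G"
  and dx_const: "dx (fps_const c) = 0" and dy_const: "dy (fps_const c) = fps_const (fps_deriv c)"
  and dx_X: "dx fps_X = 1" and dy_X: "dy fps_X = 0"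
  and dx_diff: "dx (F - G) = dx F - dx G" and dy_diff: "dy (F - G) = dy F - dy G"
  by (auto simp: dx_def fps_eq_iff fps_X_nth)

lemma dir_deriv_mult: "dir_deriv s (F * G) = dir_deriv s F * G + F * dir_deriv s G"
  by (simp add: dir_deriv_def dx_mult dy_mult algebra_simps)

lemma dir_deriv_add: "dir_deriv s (F + G) = dir_deriv s F + dir_deriv s G"
  by (simp add: dir_deriv_def dx_add dy_add algebra_simps)

lemma convergent2_dir_deriv: "convergent2 F \<Longrightarrow> convergent2 (dir_deriv s F)"
  unfolding dir_deriv_def
  by (intro convergent2_add convergent2_mult convergent2_const2 convergent2_dx convergent2_dy)

text \<open>The derivation kills \<open>x - s y\<close>, so it descends to the restriction to this
  line, where it is \<open>d/dy\<close>.\<close>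

lemma eval_x_dir_deriv: "eval_x (line s) (dir_deriv s F) = fps_deriv (eval_x (line s) F)"
proof (rule eval_x_eqI)
  obtain q where "F - fps_const (eval_x (line s) F) = (fps_X - fps_const (line s)) * q"
    using eval_x_dvd[of "line s"] by auto
  then have F: "F = (fps_X - fps_const (line s)) * q + fps_const (eval_x (line s) F)"
    by (simp add: algebra_simps)
  have 0: "dir_deriv s (fps_X - fps_const (line s)) = 0"
    by (simp add: dir_deriv_def dx_diff dy_diff dx_X dy_X dx_const dy_const line_def const2_def)
  have "dir_deriv s F = dir_deriv s ((fps_X - fps_const (line s)) * q) + dir_deriv s (fps_const (eval_x (line s) F))"
    by (subst F) (rule dir_deriv_add)
  also have "\<dots> = (fps_X - fps_const (line s)) * dir_deriv s q + fps_const (fps_deriv (eval_x (line s) F))"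
    by (simp add: dir_deriv_mult 0) (simp add: dir_deriv_def dx_const dy_const)
  finally show "fps_X - fps_const (line s) dvd dir_deriv s F - fps_const (fps_deriv (eval_x (line s) F))"
    by simp
qed simp

lemma subdegree_fps_deriv:
  fixes c :: "complex fps" assumes "c \<noteq> 0" "c $ 0 = 0"
  shows "fps_deriv c \<noteq> 0" "Suc (subdegree (fps_deriv c)) = subdegree c"
proof -
  have "subdegree c \<noteq> 0" using assms by (simp add: subdegree_eq_0_iff)
  then obtain m where m: "subdegree c = Suc m" using not0_implies_Suc by blast
  have nz: "fps_deriv c $ m \<noteq> 0"
    using assms(1) m nth_subdegree_nonzero[of c] by (simp del: of_nat_Suc)
  then show "fps_deriv c \<noteq> 0" by (metis fps_zero_nth)
  have "subdegree (fps_deriv c) = m"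
  proof (rule subdegreeI[OF nz])
    show "fps_deriv c $ i = 0" if "i < m" for i
      using that m nth_less_subdegree_zero[of "Suc i" c] by simp
  qed
  then show "Suc (subdegree (fps_deriv c)) = subdegree c" using m by simp
qed

text \<open>A common non-unit factor \<open>a\<close> of least order along the line plays the part
  of an irreducible one: minimality makes \<open>a\<close> coprime to its own derivative, and then
  the product rule produces \<open>a * a\<close> as a factor of \<open>f\<close>.\<close>

lemma reduced_no_common_factor:
  assumes f: "convergent2 f" "reduced_equation f" "eval_x (line s) f \<noteq> 0"
    and g: "restrict_x (dir_deriv s f) \<noteq> 0"
    and e: "convergent2 e" "e $ 0 $ 0 = 0" "conv_dvd e f" "conv_dvd e (dir_deriv s f)"
  shows False
proof -
  let ?ev = "eval_x (line s)" and ?D = "dir_deriv s"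
  define E where "E a \<longleftrightarrow> convergent2 a \<and> a $ 0 $ 0 = 0 \<and> conv_dvd a f \<and> conv_dvd a (?D f)" for a
  obtain a where a: "E a" "\<And>b. E b \<Longrightarrow> subdegree (?ev a) \<le> subdegree (?ev b)"
    using ex_has_least_nat[of E e "\<lambda>a. subdegree (?ev a)"] e by (auto simp: E_def)
  obtain b where b: "convergent2 b" "f = b * a" using a(1) by (auto simp: E_def conv_dvd_def)
  obtain b' where b': "?D f = b' * a" using a(1) by (auto simp: E_def conv_dvd_def)
  have eva: "?ev a \<noteq> 0" using f(3) b by (auto simp: eval_x_mult)
  have "restrict_x a \<noteq> 0" using g b' by (auto simp: restrict_x_mult)
  moreover have ca: "convergent2 a" using a(1) by (simp add: E_def)
  ultimately obtain h e q where h: "convergent2 h" "convergent2 e" "convergent2 q"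
    "a = h * e" "?D a = e * q"
    "\<And>c. convergent2 c \<Longrightarrow> conv_dvd a (c * ?D a) \<Longrightarrow> conv_dvd h c"
    using ideal_quotient_principal[of a "?D a"] convergent2_dir_deriv[OF ca] by metis
  show False
  proof (cases "e $ 0 $ 0 = 0")
    case True
    \<comment> \<open>A non-unit common factor \<open>e\<close> of \<open>a\<close> and its
      derivative would again be a candidate, but its order along the line is at most that of the
      derivative, which is one less than that of \<open>a\<close>.\<close>
    have "conv_dvd e a" using h by (auto simp: conv_dvd_def)
    then have "E e" using a(1) True h(2) conv_dvd_trans by (auto simp: E_def)
    then have le: "subdegree (?ev a) \<le> subdegree (?ev e)" by (rule a(2))
    have "?ev a $ 0 = 0" using a(1) by (simp add: E_def eval_x_nth_0)
    note sd = subdegree_fps_deriv[OF eva this]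
    have "fps_deriv (?ev a) = ?ev e * ?ev q"
      using h(5) by (simp flip: eval_x_dir_deriv add: eval_x_mult)
    then have "subdegree (?ev e) \<le> subdegree (fps_deriv (?ev a))"
      using sd(1) by (auto)
    then show False using sd(2) le by simp
  next
    case False
    obtain w where w: "e * w = 1" "convergent2 w" using unit_inverse[OF False] h(2) by metis
    \<comment> \<open>Here \<open>e\<close> is a unit, so \<open>a\<close> and \<open>h\<close>
      agree up to a unit. As \<open>a\<close> divides \<open>b * ?D a\<close>, \<open>h\<close> and
      hence \<open>a\<close> divides \<open>b\<close>.\<close>
    have "?D f = ?D b * a + b * ?D a" using b(2) by (simp add: dir_deriv_mult)
    then have "b * ?D a = ?D f - ?D b * a" by simp
    moreover have "conv_dvd a (?D f - ?D b * a)"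
      using a(1) convergent2_dir_deriv[OF b(1)] by (intro conv_dvd_diff) (auto simp: E_def conv_dvd_def)
    ultimately have "conv_dvd h b" using h(6)[OF b(1)] by simp
    then obtain c where c: "convergent2 c" "b = c * h" by (auto simp: conv_dvd_def)
    have "b = (c * w) * a"
      using c(2) w(1) h(4) by (metis mult.assoc mult.commute mult.right_neutral)
    then have "f = a * a * (c * w)" using b(2) by (simp add: mult_ac)
    moreover have "convergent2 (c * w)" using c w convergent2_mult by blast
    ultimately have "(a \<otimes>\<^bsub>O2\<^esub> a) divides\<^bsub>O2\<^esub> f" by (auto simp: factor_def)
    then have "a \<in> Units O2" using f(2) ca by (auto simp: reduced_equation_def)
    then show False using a(1) by (simp add: Units_O2_iff E_def)
  qed
qed

text \<open>The greatest common divisor \<open>e\<close> of \<open>f\<close> and \<open>g\<close> is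
  a unit, so \<open>f\<close> cancels modulo \<open>g\<close>, as \<open>elimination\<close>
  requires.\<close>

theorem reduced_elimination:
  assumes f: "convergent2 f" "reduced_equation f" "eval_x (line s) f \<noteq> 0"
    and g: "restrict_x (dir_deriv s f) \<noteq> 0"
  shows "\<exists>b a v. b \<noteq> 0 \<and> fps_const b = a * f + v * dir_deriv s f"
proof -
  let ?g = "dir_deriv s f"
  have cg: "convergent2 ?g" by (rule convergent2_dir_deriv[OF f(1)])
  obtain h e q where h: "convergent2 h" "convergent2 e" "convergent2 q" "?g = h * e" "f = e * q"
    "\<And>a. convergent2 a \<Longrightarrow> conv_dvd ?g (a * f) \<Longrightarrow> conv_dvd h a"
    using ideal_quotient_principal[OF cg f(1) g] by metis
  have "conv_dvd e f" "conv_dvd e ?g" using h by (auto simp: conv_dvd_def mult.commute)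
  then have "e $ 0 $ 0 \<noteq> 0" using reduced_no_common_factor[OF f g h(2)] by blast
  then obtain w where w: "e * w = 1" "convergent2 w" using unit_inverse h(2) by metis
  have "conv_dvd ?g h"
    unfolding conv_dvd_def using w h(4) by (intro exI[of _ w]) (simp add: mult_ac)
  then have "conv_dvd ?g a" if "convergent2 a" "conv_dvd ?g (a * f)" for a
    using h(6)[OF that] conv_dvd_trans by blast
  from elimination[OF cg g f(1) this] show ?thesis by blast
qed


section \<open>Polar curves\<close>

lemma gen2_commute: "gen2 g h = gen2 h g"
  unfolding gen2_def by (metis add.commute)

text \<open>The chain rule. As evaluation is a remainder, it is obtained by differentiating
  \<open>F = (x - \<phi>) * q + c\<close> and evaluating.\<close>

lemma fps_deriv_eval_x:
  assumes \<phi>: "\<phi> $ 0 = 0"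
  shows "fps_deriv (eval_x \<phi> F) = eval_x \<phi> (dy F) + fps_deriv \<phi> * eval_x \<phi> (dx F)"
proof -
  obtain q where "F - fps_const (eval_x \<phi> F) = (fps_X - fps_const \<phi>) * q"
    using eval_x_dvd[OF \<phi>] by (rule dvdE)
  then have F: "F = (fps_X - fps_const \<phi>) * q + fps_const (eval_x \<phi> F)"
    by (simp add: algebra_simps)
  define l where "l = fps_X - fps_const \<phi>"
  have l: "dx l = 1" "dy l = - fps_const (fps_deriv \<phi>)" "eval_x \<phi> l = 0"
    by (simp_all add: l_def dx_diff dy_diff dx_X dy_X dx_const dy_const eval_x_diff \<phi>)
  have "dx F = q + l * dx q" "dy F = - fps_const (fps_deriv \<phi>) * q + l * dy q + fps_const (fps_deriv (eval_x \<phi> F))"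
    by (subst F, simp add: dx_add dy_add dx_mult dy_mult dx_const dy_const l flip: l_def)+
  then have "eval_x \<phi> (dx F) = eval_x \<phi> q"
    "eval_x \<phi> (dy F) = - fps_deriv \<phi> * eval_x \<phi> q + fps_deriv (eval_x \<phi> F)"
    using eval_x_diff[OF \<phi>, of 0 "fps_const (fps_deriv \<phi>)"] \<phi>
    by (simp_all add: eval_x_add eval_x_mult l)
  then show ?thesis by simp
qed

lemma ramify_of_nat_mult: "ramify N (of_nat n * c) = of_nat n * ramify N c"
  by (induction n) (simp_all add: distrib_right ramify_add)

lemma dx_ramify2: "dx (ramify2 N F) = ramify2 N (dx F)"
  using ramify_of_nat_mult[of N "Suc _"] by (intro fps_ext) (simp add: dx_def del: of_nat_Suc)

lemma dy_ramify2:
  assumes "N > 0"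
  shows "dy (ramify2 N F) = fps_const (fps_deriv (fps_X ^ N)) * ramify2 N (dy F)"
proof (rule fps_ext)
  fix i
  have "fps_deriv (ramify N c) = fps_deriv (fps_X ^ N) * ramify N (fps_deriv c)" for c
    unfolding ramify_def using assms by (subst fps_compose_deriv) (simp_all add: mult.commute)
  then show "dy (ramify2 N F) $ i = (fps_const (fps_deriv (fps_X ^ N)) * ramify2 N (dy F)) $ i" by simp
qed

lemma order_along_polar_branch:
  assumes N: "N > 0" and \<phi>: "\<phi> $ 0 = 0" and f0: "f $ 0 $ 0 = 0"
    and g: "eval_x \<phi> (ramify2 N (dir_deriv s f)) = 0" and f: "eval_x \<phi> (ramify2 N f) \<noteq> 0"
  shows "eval_x \<phi> (ramify2 N (dx f)) \<noteq> 0" "eval_x \<phi> (ramify2 N (fps_X - fps_const (line s))) \<noteq> 0"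
    "subdegree (eval_x \<phi> (ramify2 N f)) = subdegree (eval_x \<phi> (ramify2 N (dx f))) +
       subdegree (eval_x \<phi> (ramify2 N (fps_X - fps_const (line s))))"
proof -
  define E where "E F = eval_x \<phi> (ramify2 N F)" for F
  define l where "l = E (fps_X - fps_const (line s))"
  have l: "l = \<phi> - fps_const s * fps_X ^ N"
    by (simp add: l_def E_def ramify2_diff eval_x_diff \<phi> line_def ramify_mult N ramify_X)
  have l0: "l $ 0 = 0" using \<phi> N by (simp add: l)
  have f00: "E f $ 0 = 0" by (simp add: E_def eval_x_nth_0 \<phi> f0)
  have "fps_const s * E (dx f) + E (dy f) = 0"
    using g by (simp add: E_def dir_deriv_def ramify2_add ramify2_mult N eval_x_add eval_x_mult \<phi> const2_def)
  then have dyf: "E (dy f) = - (fps_const s * E (dx f))" by (simp add: eq_neg_iff_add_eq_0 add.commute)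
  have "fps_deriv (E f) = fps_deriv (fps_X ^ N) * E (dy f) + fps_deriv \<phi> * E (dx f)"
    by (simp add: E_def fps_deriv_eval_x \<phi> dy_ramify2 N dx_ramify2 eval_x_mult)
  also have "\<dots> = E (dx f) * fps_deriv l"
    by (simp add: dyf l algebra_simps)
  finally have d: "fps_deriv (E f) = E (dx f) * fps_deriv l" .
  have Ef: "E f \<noteq> 0" using f by (simp add: E_def)
  note sf = subdegree_fps_deriv[OF Ef f00]
  then have nz: "E (dx f) \<noteq> 0" "fps_deriv l \<noteq> 0" using d by auto
  then have "l \<noteq> 0" by auto
  note sl = subdegree_fps_deriv[OF this l0]
  have "subdegree (fps_deriv (E f)) = subdegree (E (dx f)) + subdegree (fps_deriv l)"
    unfolding d using nz by simp
  \<comment> \<open>Both \<open>E f\<close> and \<open>l\<close> lose exactly one in order under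
    differentiation, so the two losses cancel.\<close>
  then have "subdegree (E f) = subdegree (E (dx f)) + subdegree l" using sf(2) sl(2) by linarith
  then show "eval_x \<phi> (ramify2 N (dx f)) \<noteq> 0" "eval_x \<phi> (ramify2 N (fps_X - fps_const (line s))) \<noteq> 0"
    "subdegree (eval_x \<phi> (ramify2 N f)) = subdegree (eval_x \<phi> (ramify2 N (dx f))) +
       subdegree (eval_x \<phi> (ramify2 N (fps_X - fps_const (line s))))"
    using nz(1) \<open>l \<noteq> 0\<close> by (simp_all add: l_def E_def)
qed

theorem polar_intersection_0:
  assumes f: "convergent2 f" "reduced_equation f"
    and \<nu>: "eval_x (line s) f \<noteq> 0" "subdegree (eval_x (line s) f) = Suc d"
    and g: "restrict_x (dir_deriv s f) \<noteq> 0"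
  shows "\<exists>q. codim (gen2 (dir_deriv s f) (dx f)) q \<and> codim (gen2 (dir_deriv s f) f) (q + d)"
proof -
  let ?g = "dir_deriv s f" and ?l = "fps_X - fps_const (line s)"
  have f0: "f $ 0 $ 0 = 0" using f(2) by (simp add: reduced_equation_def max_ideal_def)
  have "regular_x (subdegree (restrict_x ?g)) ?g" using g by (simp add: regular_x_iff)
  then obtain N \<phi>s u where N: "N > 0" and \<phi>s: "\<forall>\<phi>\<in>set \<phi>s. \<phi> $ 0 = 0" and u: "u $ 0 $ 0 \<noteq> 0"
    and fac: "ramify2 N ?g = u * (\<Prod>\<phi>\<leftarrow>\<phi>s. fps_X - fps_const \<phi>)"
    using puiseux_factorization by blast
  obtain b a v where b: "b \<noteq> 0" "fps_const b = a * f + v * ?g"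
    using reduced_elimination[OF f \<nu>(1) g] by blast
  define E where "E \<phi> F = eval_x \<phi> (ramify2 N F)" for \<phi> F
  have branch: "E \<phi> f \<noteq> 0" "E \<phi> (dx f) \<noteq> 0" "E \<phi> ?l \<noteq> 0"
    "subdegree (E \<phi> f) = subdegree (E \<phi> (dx f)) + subdegree (E \<phi> ?l)" if \<phi>: "\<phi> \<in> set \<phi>s" for \<phi>
  proof -
    have \<phi>0: "\<phi> $ 0 = 0" using \<phi> \<phi>s by blast
    have "(\<Prod>\<phi>\<leftarrow>\<phi>s. eval_x \<phi>' (fps_X - fps_const \<phi>)) = 0" if "\<phi>' = \<phi>" for \<phi>'
      using \<phi> that by (auto simp: prod_list_zero_iff eval_x_diff \<phi>0)
    moreover have "eval_x \<phi> (\<Prod>\<phi>\<leftarrow>xs. fps_X - fps_const \<phi>) = (\<Prod>\<phi>'\<leftarrow>xs. eval_x \<phi> (fps_X - fps_const \<phi>'))" for xs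
      by (induction xs) (simp_all add: eval_x_mult \<phi>0)
    ultimately have Eg: "E \<phi> ?g = 0" by (simp add: E_def fac eval_x_mult \<phi>0)
    have "ramify N b = E \<phi> (fps_const b)" by (simp add: E_def \<phi>0)
    also have "\<dots> = E \<phi> a * E \<phi> f + E \<phi> v * E \<phi> ?g"
      by (simp add: E_def b(2) ramify2_add ramify2_mult N eval_x_add eval_x_mult \<phi>0)
    \<comment> \<open>Along the branch \<open>g\<close> vanishes while \<open>b(t^N)\<close> does
      not, so \<open>f\<close> cannot vanish either.\<close>
    finally have "E \<phi> a * E \<phi> f \<noteq> 0" using b(1) Eg N by auto
    then show Ef: "E \<phi> f \<noteq> 0" by auto
    show "E \<phi> (dx f) \<noteq> 0" "E \<phi> ?l \<noteq> 0"
      "subdegree (E \<phi> f) = subdegree (E \<phi> (dx f)) + subdegree (E \<phi> ?l)"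
      using order_along_polar_branch[OF N \<phi>0 f0, of s] Eg Ef unfolding E_def by blast+
  qed
  have num: "\<exists>p. codim (gen2 ?g h) p \<and> N * p = (\<Sum>\<phi>\<leftarrow>\<phi>s. subdegree (E \<phi> h))"
    if "\<And>\<phi>. \<phi> \<in> set \<phi>s \<Longrightarrow> E \<phi> h \<noteq> 0" for h
    using intersection_number_puiseux[OF N fac u, of h] that \<phi>s unfolding E_def by blast
  obtain p where p: "codim (gen2 ?g f) p" "N * p = (\<Sum>\<phi>\<leftarrow>\<phi>s. subdegree (E \<phi> f))"
    using num[OF branch(1)] by blast
  obtain q where q: "codim (gen2 ?g (dx f)) q" "N * q = (\<Sum>\<phi>\<leftarrow>\<phi>s. subdegree (E \<phi> (dx f)))"
    using num[OF branch(2)] by blast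
  obtain r where r: "codim (gen2 ?g ?l) r" "N * r = (\<Sum>\<phi>\<leftarrow>\<phi>s. subdegree (E \<phi> ?l))"
    using num[OF branch(3)] by blast
  have "(\<Sum>\<phi>\<leftarrow>\<phi>s. subdegree (E \<phi> f)) = (\<Sum>\<phi>\<leftarrow>\<phi>s. subdegree (E \<phi> (dx f)) + subdegree (E \<phi> ?l))"
    using branch(4) by (simp cong: map_cong)
  then have "N * p = N * (q + r)" by (simp add: p(2) q(2) r(2) sum_list_addf add_mult_distrib2)
  then have pqr: "p = q + r" using N by simp
  \<comment> \<open>The remaining number is computed from the other side, on the line: there
    \<open>g\<close> restricts to the derivative of the restriction of \<open>f\<close>, whose order
    is \<open>\<nu> - 1 = d\<close>.\<close>
  have ev: "eval_x (line s) ?g = fps_deriv (eval_x (line s) f)" by (rule eval_x_dir_deriv)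
  have "eval_x (line s) f $ 0 = 0" by (simp add: eval_x_nth_0 f0)
  note sd = subdegree_fps_deriv[OF \<nu>(1) this]
  have "codim (gen2 ?l ?g) (subdegree (eval_x (line s) ?g))"
    using sd(1) by (intro codim_linear) (simp_all add: ev)
  moreover have "subdegree (eval_x (line s) ?g) = d" using sd(2) \<nu>(2) by (simp add: ev)
  ultimately have "codim (gen2 ?g ?l) d" by (simp add: gen2_commute)
  then have "r = d" using codim_unique[OF is_ideal_gen2 _ r(1)] by blast
  then show ?thesis using p(1) q(1) pqr by blast
qed

text \<open>Induction on the codimension. If \<open>J : z\<close> is larger than \<open>J\<close>,
  it has smaller codimension and contains a power of \<open>z\<close>. If it equals
  \<open>J\<close>, additivity forces \<open>J + zR\<close>, with \<open>R\<close> the formal ring,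
  to be everything; then \<open>J\<close> contains a unit \<open>1 - z * u\<close>.\<close>

lemma power_mem_finite_codim:
  assumes "is_ideal J" "codim J n" "z $ 0 $ 0 = 0"
  shows "\<exists>k. z ^ k \<in> J"
  using assms(1,2)
proof (induction n arbitrary: J rule: less_induct)
  case (less n)
  note J = is_idealD[OF less.prems(1)]
  define K where "K = {u. z * u \<in> J}"
  have K: "is_ideal K"
    unfolding is_ideal_def K_def using J(1,2,3) by (auto simp: distrib_left mult.left_commute[of z])
  have JK: "J \<subseteq> K" unfolding K_def using J(3) by blast
  obtain m where m: "m \<le> n" "codim K m" "K \<noteq> J \<longrightarrow> m < n"
    using S.quot_dim_supset[OF less.prems(2) J(6) is_idealD(6)[OF K] JK] by blast
  show ?case
  proof (cases "K = J")
    case False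
    then obtain k where "z ^ k \<in> K" using less.IH[OF _ K m(2)] m(3) by blast
    then have "z ^ Suc k \<in> J" by (simp add: K_def)
    then show ?thesis by blast
  next
    case True
    define I where "I = {x. \<exists>u. x - z * u \<in> J}"
    have "is_ideal I"
      unfolding is_ideal_def I_def
    proof (intro conjI ballI allI CollectI)
      show "\<exists>u. 0 - z * u \<in> J" using J(1) by (intro exI[of _ 0]) simp
    next
      fix a b assume "a \<in> {x. \<exists>u. x - z * u \<in> J}" "b \<in> {x. \<exists>u. x - z * u \<in> J}"
      then obtain u v where "a - z * u \<in> J" "b - z * v \<in> J" by blast
      from J(2)[OF this] show "\<exists>u. a + b - z * u \<in> J" by (intro exI[of _ "u + v"]) (simp add: algebra_simps)
    next
      fix r a assume "a \<in> {x. \<exists>u. x - z * u \<in> J}"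
      then obtain u where "a - z * u \<in> J" by blast
      from J(3)[OF this, of r] show "\<exists>u. r * a - z * u \<in> J"
        by (intro exI[of _ "r * u"]) (simp add: algebra_simps)
    qed
    moreover have "J \<subseteq> I" unfolding I_def by (auto intro!: exI[of _ 0])
    ultimately obtain q where q: "codim I q"
      using S.quot_dim_supset[OF less.prems(2) J(6) is_idealD(6)] by blast
    have "codim {u. z * u \<in> J} n" using True less.prems(2) by (simp add: K_def)
    then have "codim J (n + q)" using codim_add[OF less.prems(1)] q unfolding I_def by blast
    then have "q = 0" using codim_unique[OF less.prems(1,2)] by fastforce
    then have "I = UNIV" using q by (auto elim: S.quot_dim.cases)
    then obtain u where u: "1 - z * u \<in> J" unfolding I_def by blast
    have "(1 - z * u) $ 0 $ 0 \<noteq> 0" using assms(3) by (simp add: fps2_mult_nth)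
    then have "(1 - z * u) dvd 1" by (rule iffD2[OF unit_dvd_1_iff])
    then obtain w where "1 = (1 - z * u) * w" by (rule dvdE)
    then have "z ^ 0 \<in> J" using J(4)[OF u, of w] by simp
    then show ?thesis by blast
  qed
qed

lemma dvd_var_y_cancel:
  assumes g: "restrict_x g \<noteq> 0" and "g dvd var_y ^ k * a"
  shows "g dvd a"
  using assms(2)
proof (induction k)
  case (Suc k)
  obtain c where c: "var_y ^ Suc k * a = g * c" using Suc.prems by (rule dvdE)
  have "restrict_x var_y = 0" by (rule fps_ext) (simp add: var_y_def)
  then have "restrict_x g * restrict_x c = 0"
    using arg_cong[OF c, of restrict_x] by (simp add: restrict_x_mult)
  then have c0: "restrict_x c = 0" using g by simp
  obtain d where d: "c = var_y * d" using divide_by_var_y[OF c0] by metis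
  have "var_y \<noteq> 0" by (simp add: var_y_def)
  moreover have "var_y * (var_y ^ k * a) = var_y * (g * d)"
    using c unfolding d by (simp only: power_Suc mult.assoc mult.left_commute)
  ultimately have "var_y ^ k * a = g * d" by (metis mult_left_cancel)
  then have "g dvd var_y ^ k * a" by (rule dvdI)
  then show ?case by (rule Suc.IH)
qed simp

text \<open>Finite codimension puts a power of \<open>y\<close> into the ideal of \<open>g\<close>
  and \<open>h\<close>, so \<open>g\<close> divides that power times \<open>c\<close>; and
  \<open>y\<close> cancels, since \<open>g\<close> does not vanish on \<open>y = 0\<close>.\<close>

lemma nonzerodivisor_of_codim:
  assumes g: "restrict_x g \<noteq> 0" and n: "codim (gen2 g h) n" and c: "g dvd c * h"
  shows "g dvd c"
proof -
  obtain k where "var_y ^ k \<in> gen2 g h"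
    using power_mem_finite_codim[OF is_ideal_gen2 n, of var_y] by (auto simp: var_y_def)
  then obtain a b where ab: "var_y ^ k = a * g + b * h" by (rule gen2E)
  have "var_y ^ k * c = g * (a * c) + b * (c * h)" unfolding ab by (simp only: algebra_simps)
  moreover have "g dvd g * (a * c) + b * (c * h)"
    by (rule dvd_add[OF dvd_triv_left dvd_mult[OF c]])
  ultimately have "g dvd var_y ^ k * c" by (simp only:)
  then show ?thesis by (rule dvd_var_y_cancel[OF g])
qed

text \<open>The formal counterpart of \<open>\<langle>g, h\<rangle> \<mm>^k\<close>: sums of
  products collapse to one coefficient of order at least \<open>k\<close> for each
  generator.\<close>

definition gen2_power :: "series2 \<Rightarrow> series2 \<Rightarrow> nat \<Rightarrow> series2 set" where
  "gen2_power g h k = {F. \<exists>a\<in>order_ge k. \<exists>b\<in>order_ge k. F = a * g + b * h}"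

lemma is_ideal_order_ge: "is_ideal (order_ge k)"
  unfolding is_ideal_def using order_ge_add order_ge_mult_left zero_order_ge by blast

lemma is_ideal_gen2_power: "is_ideal (gen2_power g h k)"
  unfolding is_ideal_def
proof (intro conjI ballI allI)
  show "0 \<in> gen2_power g h k" unfolding gen2_power_def using zero_order_ge by force
next
  fix F G assume "F \<in> gen2_power g h k" "G \<in> gen2_power g h k"
  then obtain a b c d where "a \<in> order_ge k" "b \<in> order_ge k" "c \<in> order_ge k" "d \<in> order_ge k"
    "F = a * g + b * h" "G = c * g + d * h" unfolding gen2_power_def by blast
  then show "F + G \<in> gen2_power g h k"
    unfolding gen2_power_def
    by (intro CollectI bexI[of _ "a + c"] bexI[of _ "b + d"] order_ge_add) (simp_all add: algebra_simps)
next
  fix r F assume "F \<in> gen2_power g h k"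
  then obtain a b where "a \<in> order_ge k" "b \<in> order_ge k" "F = a * g + b * h"
    unfolding gen2_power_def by blast
  then show "r * F \<in> gen2_power g h k"
    unfolding gen2_power_def
    by (intro CollectI bexI[of _ "r * a"] bexI[of _ "r * b"] order_ge_mult_left) (simp_all add: algebra_simps)
qed

text \<open>The powers \<open>x^k\<close> and \<open>y^k\<close> already generate an ideal of finite
  codimension inside.\<close>

lemma codim_order_ge: "\<exists>n. codim (order_ge k) n"
proof -
  let ?x = "\<Prod>\<phi>\<leftarrow>replicate k 0. fps_X - fps_const \<phi> :: series2" and ?y = "fps_const (fps_X ^ k) :: series2"
  have "codim (gen2 ?x ?y) (\<Sum>\<phi>\<leftarrow>replicate k 0. subdegree (eval_x \<phi> ?y))"
    by (rule codim_split) simp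
  moreover have "?x = fps_X ^ k" by (induction k) simp_all
  then have "?x \<in> order_ge k" by (auto simp: order_ge_def fps_X_power_nth)
  moreover have "?y \<in> order_ge k" by (auto simp: order_ge_def fps_X_power_nth)
  ultimately have "gen2 ?x ?y \<subseteq> order_ge k"
    by (auto simp: gen2_def intro!: order_ge_add order_ge_mult_left)
  then show ?thesis
    using S.quot_dim_supset[OF \<open>codim (gen2 ?x ?y) _\<close> is_idealD(6)[OF is_ideal_gen2] is_idealD(6)[OF is_ideal_order_ge]]
    by blast
qed

definition order_ge_plus :: "nat \<Rightarrow> series2 \<Rightarrow> series2 set" where
  "order_ge_plus k g = {F. \<exists>u. F - u * g \<in> order_ge k}"

lemma is_ideal_order_ge_plus: "is_ideal (order_ge_plus k g)"
  unfolding is_ideal_def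
proof (intro conjI ballI allI)
  show "0 \<in> order_ge_plus k g"
    unfolding order_ge_plus_def using zero_order_ge by (intro CollectI exI[of _ 0]) simp
next
  fix F G assume "F \<in> order_ge_plus k g" "G \<in> order_ge_plus k g"
  then obtain u v where "F - u * g \<in> order_ge k" "G - v * g \<in> order_ge k"
    unfolding order_ge_plus_def by blast
  from order_ge_add[OF this] show "F + G \<in> order_ge_plus k g"
    unfolding order_ge_plus_def by (intro CollectI exI[of _ "u + v"]) (simp add: algebra_simps)
next
  fix r F assume "F \<in> order_ge_plus k g"
  then obtain u where "F - u * g \<in> order_ge k" unfolding order_ge_plus_def by blast
  from order_ge_mult_left[OF this, of r] show "r * F \<in> order_ge_plus k g"
    unfolding order_ge_plus_def by (intro CollectI exI[of _ "r * u"]) (simp add: algebra_simps)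
qed

text \<open>The number \<open>C\<close> is \<open>dim O2 / (\<langle>g\<rangle> + \<mm>^k) + dim O2 / \<mm>^k\<close>: the two summands are the dimensions of the steps
  of the chain \<open>\<langle>g, h\<rangle> \<supseteq> \<langle>g\<rangle> + h \<mm>^k \<supseteq> g \<mm>^k + h \<mm>^k\<close>, and neither depends on \<open>h\<close>.\<close>

theorem codim_gen2_power:
  assumes g: "g \<in> order_ge d" "g \<notin> order_ge (Suc d)" "restrict_x g \<noteq> 0"
  shows "\<exists>C. \<forall>h n. h \<in> order_ge d \<longrightarrow> codim (gen2 g h) n \<longrightarrow> codim (gen2_power g h k) (n + C)"
proof -
  obtain b where b: "codim (order_ge k) b" using codim_order_ge by blast
  have "order_ge k \<subseteq> order_ge_plus k g"
    unfolding order_ge_plus_def by (auto intro!: exI[of _ 0])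
  then obtain a where a: "codim (order_ge_plus k g) a"
    using S.quot_dim_supset[OF b is_idealD(6)[OF is_ideal_order_ge] is_idealD(6)[OF is_ideal_order_ge_plus]] by blast
  have g0: "g \<noteq> 0" using g(2) zero_order_ge by blast
  have "codim (gen2_power g h k) (n + (a + b))" if h: "h \<in> order_ge d" and n: "codim (gen2 g h) n" for h n
  proof -
    define J where "J = {F. \<exists>a. \<exists>b\<in>order_ge k. F = a * g + b * h}"
    note nzd = nonzerodivisor_of_codim[OF g(3) n]
    have "is_ideal J"
      unfolding is_ideal_def
    proof (intro conjI ballI allI)
      show "0 \<in> J" unfolding J_def using zero_order_ge by (intro CollectI exI[of _ 0] bexI[of _ 0]) simp_all
    next
      fix F G assume "F \<in> J" "G \<in> J"
      then obtain a b a' b' where "b \<in> order_ge k" "b' \<in> order_ge k" "F = a * g + b * h" "G = a' * g + b' * h"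
        unfolding J_def by blast
      then show "F + G \<in> J" unfolding J_def
        by (intro CollectI exI[of _ "a + a'"] bexI[of _ "b + b'"] order_ge_add) (simp_all add: algebra_simps)
    next
      fix r F assume "F \<in> J"
      then obtain a b where "b \<in> order_ge k" "F = a * g + b * h" unfolding J_def by blast
      then show "r * F \<in> J" unfolding J_def
        by (intro CollectI exI[of _ "r * a"] bexI[of _ "r * b"] order_ge_mult_left) (simp_all add: algebra_simps)
    qed
    moreover have "{u. h * u \<in> J} = order_ge_plus k g"
    proof safe
      fix u assume "h * u \<in> J"
      then obtain a b where ab: "b \<in> order_ge k" "h * u = a * g + b * h" unfolding J_def by blast
      have "(u - b) * h = h * u - b * h" by (simp add: algebra_simps)
      also have "\<dots> = g * a" unfolding ab(2) by (simp add: mult.commute)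
      finally have "g dvd (u - b) * h" by (rule dvdI)
      then have "g dvd u - b" by (rule nzd)
      then obtain w where w: "u - b = g * w" by (rule dvdE)
      have "u - w * g = b" using w by (simp add: algebra_simps)
      then show "u \<in> order_ge_plus k g" unfolding order_ge_plus_def using ab(1) by blast
    next
      fix u assume "u \<in> order_ge_plus k g"
      then obtain w where w: "u - w * g \<in> order_ge k" unfolding order_ge_plus_def by blast
      show "h * u \<in> J" unfolding J_def
        by (intro CollectI exI[of _ "h * w"] bexI[OF _ w]) (simp add: algebra_simps)
    qed
    moreover have "{x. \<exists>u. x - h * u \<in> J} = gen2 g h"
    proof safe
      fix x u assume "x - h * u \<in> J"
      then obtain a b where ab: "x - h * u = a * g + b * h" unfolding J_def by blast
      have "x = (x - h * u) + h * u" by simp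
      also have "\<dots> = a * g + (b + u) * h" unfolding ab by (simp add: algebra_simps)
      finally show "x \<in> gen2 g h" by (rule gen2_memI)
    next
      fix x assume "x \<in> gen2 g h"
      then obtain a b where "x = a * g + b * h" by (rule gen2E)
      then have "x - h * b = a * g + 0 * h" by (simp add: algebra_simps)
      then have "x - h * b \<in> J" unfolding J_def using zero_order_ge by blast
      then show "\<exists>u. x - h * u \<in> J" by blast
    qed
    ultimately have J: "codim J (a + n)" using codim_add[of J h a n] a n by simp
    have "{u. g * u \<in> gen2_power g h k} = order_ge k"
    proof safe
      fix u assume "g * u \<in> gen2_power g h k"
      then obtain a b where ab: "a \<in> order_ge k" "b \<in> order_ge k" "g * u = a * g + b * h"
        unfolding gen2_power_def by blast
      have bh: "b * h = g * (u - a)" using ab(3) by (simp add: algebra_simps)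
      then have "g dvd b * h" by (rule dvdI)
      then have "g dvd b" by (rule nzd)
      then obtain q where q: "b = g * q" by (rule dvdE)
      \<comment> \<open>Here the orders of \<open>g\<close> and \<open>h\<close> enter: dividing by
        \<open>g\<close> lowers the order by exactly \<open>d\<close>, and multiplying by
        \<open>h\<close> restores at least \<open>d\<close>. For \<open>k < d\<close> the truncated
        difference is 0 and nothing is claimed.\<close>
      have q': "q \<in> order_ge (k - d)"
      proof (cases "d \<le> k")
        case True
        then show ?thesis using order_ge_mult_cancel[OF g(1,2), of q "k - d"] ab(2) q by simp
      qed simp
      have "g * (q * h) = g * (u - a)" using bh unfolding q by (simp only: mult.assoc)
      then have "q * h = u - a" using g0 by (metis mult_left_cancel)
      moreover have "q * h \<in> order_ge k"
        using subsetD[OF order_ge_antimono[of k "k - d + d"] order_ge_mult[OF q' h]] by simp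
      ultimately have "a + (u - a) \<in> order_ge k" using order_ge_add[OF ab(1)] by metis
      then show "u \<in> order_ge k" by simp
    next
      fix u assume "u \<in> order_ge k"
      then show "g * u \<in> gen2_power g h k" unfolding gen2_power_def
        using zero_order_ge by (intro CollectI bexI[of _ u] bexI[of _ 0]) (simp_all add: mult.commute)
    qed
    moreover have "{x. \<exists>u. x - g * u \<in> gen2_power g h k} = J"
    proof safe
      fix x u assume "x - g * u \<in> gen2_power g h k"
      then obtain a b where ab: "b \<in> order_ge k" "x - g * u = a * g + b * h" unfolding gen2_power_def by blast
      have "x = (x - g * u) + g * u" by simp
      also have "\<dots> = (a + u) * g + b * h" unfolding ab(2) by (simp add: algebra_simps)
      finally show "x \<in> J" unfolding J_def using ab(1) by blast
    next
      fix x assume "x \<in> J"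
      then obtain a b where ab: "b \<in> order_ge k" "x = a * g + b * h" unfolding J_def by blast
      then have "x - g * a = 0 * g + b * h" by (simp add: algebra_simps)
      then have "x - g * a \<in> gen2_power g h k" unfolding gen2_power_def using ab(1) zero_order_ge by blast
      then show "\<exists>u. x - g * u \<in> gen2_power g h k" by blast
    qed
    ultimately have "codim (gen2_power g h k) (b + (a + n))"
      using codim_add[OF is_ideal_gen2_power, of g g h k b "a + n"] b J by simp
    then show ?thesis by (simp add: ac_simps)
  qed
  then show ?thesis by blast
qed


section \<open>Transfer to convergent series\<close>

lemma order_ge_Suc_split:
  assumes F: "F \<in> order_ge (Suc k)"
  obtains A B where "F = A * fps_X + B * var_y" "A \<in> order_ge k" "B \<in> order_ge k"
    "convergent2 F \<Longrightarrow> convergent2 A \<and> convergent2 B"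
proof -
  define A where "A = fps_shift 1 F"
  have "restrict_x (fps_const (F $ 0)) = 0"
    using F by (intro fps_ext) (simp add: order_ge_def)
  then obtain B where B: "fps_const (F $ 0) = var_y * B"
    "convergent2 (fps_const (F $ 0)) \<Longrightarrow> convergent2 B" "\<And>i j. B $ i $ j = fps_const (F $ 0) $ i $ Suc j"
    by (rule divide_by_var_y) blast
  have "F = fps_const (F $ 0) + A * fps_X"
    by (rule fps_ext) (simp add: A_def)
  then have "F = A * fps_X + B * var_y" using B(1) by (simp add: ac_simps)
  moreover have "A \<in> order_ge k" using F by (auto simp: order_ge_def A_def)
  moreover have "B \<in> order_ge k" using F by (auto simp: order_ge_def B(3))
  moreover have "convergent2 A \<and> convergent2 B" if c: "convergent2 F"
  proof
    show "convergent2 B" by (rule B(2)[OF convergent2_const_nth[OF c]])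
    obtain M R where M: "M \<ge> 0" "R \<ge> 1" "\<And>i j. norm (F $ i $ j) \<le> M * R ^ (i + j)"
      using convergent2E[OF c] by blast
    show "convergent2 A"
    proof (rule convergent2I[of "M * R" R])
      show "norm (A $ i $ j) \<le> M * R * R ^ (i + j)" for i j
        using M(3)[of "Suc i" j] by (simp add: A_def mult.assoc)
    qed (use M in auto)
  qed
  ultimately show ?thesis using that by blast
qed

abbreviation monomial :: "nat \<Rightarrow> nat \<Rightarrow> series2" where
  "monomial M l \<equiv> fps_X ^ l * var_y ^ (M - l)"

lemma convergent2_X: "convergent2 fps_X"
  by (rule convergent2I[of 1 1]) (auto simp: fps_X_nth)

lemma convergent2_monomial: "convergent2 (monomial M l)"
  by (intro convergent2_mult convergent2_power convergent2_X convergent2_var_y)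

lemma var_order_ge: "fps_X \<in> order_ge 1" "var_y \<in> order_ge 1"
  by (auto simp: order_ge_def var_y_def fps_X_nth)

lemma power_order_ge: "F \<in> order_ge 1 \<Longrightarrow> F ^ n \<in> order_ge n"
proof (induction n)
  case (Suc n)
  then show ?case using order_ge_mult[of F 1 "F ^ n" n] by simp
qed simp

lemma monomial_order_ge: "l \<le> M \<Longrightarrow> monomial M l \<in> order_ge M"
  using order_ge_mult[OF power_order_ge[OF var_order_ge(1), of l] power_order_ge[OF var_order_ge(2), of "M - l"]]
  by simp

text \<open>Two cases matter: with \<open>k = 0\<close> the monomials of degree \<open>M\<close>
  generate \<open>\<mm>^M\<close>, and with \<open>k = 1\<close> the coefficients lie in the maximal
  ideal, as Nakayama's lemma demands.\<close>

lemma order_ge_monomial_sum: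
  "F \<in> order_ge (M + k) \<Longrightarrow> \<exists>e. F = (\<Sum>l\<le>M. e l * monomial M l) \<and>
     (\<forall>l. e l \<in> order_ge k \<and> (convergent2 F \<longrightarrow> convergent2 (e l)))"
proof (induction M arbitrary: F)
  case 0
  then show ?case by (intro exI[of _ "\<lambda>_. F"]) auto
next
  case (Suc M)
  then have "F \<in> order_ge (Suc (M + k))" by simp
  then obtain A B where AB: "F = A * fps_X + B * var_y" "A \<in> order_ge (M + k)" "B \<in> order_ge (M + k)"
    "convergent2 F \<Longrightarrow> convergent2 A \<and> convergent2 B" by (rule order_ge_Suc_split) blast
  obtain a where a: "A = (\<Sum>l\<le>M. a l * monomial M l)"
    "\<And>l. a l \<in> order_ge k" "\<And>l. convergent2 A \<Longrightarrow> convergent2 (a l)" using Suc.IH[OF AB(2)] by blast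
  obtain b where b: "B = (\<Sum>l\<le>M. b l * monomial M l)"
    "\<And>l. b l \<in> order_ge k" "\<And>l. convergent2 B \<Longrightarrow> convergent2 (b l)" using Suc.IH[OF AB(3)] by blast
  define e1 where "e1 l = (if l = 0 then 0 else a (l - 1))" for l
  define e2 where "e2 l = (if l \<le> M then b l else 0)" for l
  have "(\<Sum>l\<le>Suc M. e1 l * monomial (Suc M) l) = (\<Sum>l\<le>M. a l * monomial M l * fps_X)"
    by (subst sum.atMost_Suc_shift) (simp add: e1_def mult_ac)
  moreover have "(\<Sum>l\<le>Suc M. e2 l * monomial (Suc M) l) = (\<Sum>l\<le>M. b l * monomial M l * var_y)"
    unfolding sum.atMost_Suc by (simp add: e2_def) (auto intro!: sum.cong simp: Suc_diff_le mult_ac)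
  ultimately have "F = (\<Sum>l\<le>Suc M. (e1 l + e2 l) * monomial (Suc M) l)"
    unfolding AB(1) a(1) b(1) distrib_right sum.distrib sum_distrib_right by simp
  moreover have "e1 l + e2 l \<in> order_ge k" for l
    using a(2) b(2) zero_order_ge by (auto simp: e1_def e2_def intro!: order_ge_add)
  moreover have "convergent2 (e1 l + e2 l)" if "convergent2 F" for l
    using a(3) b(3) AB(4)[OF that] convergent2_0 by (auto simp: e1_def e2_def intro!: convergent2_add)
  ultimately show ?case by (intro exI[of _ "\<lambda>l. e1 l + e2 l"]) blast
qed

text \<open>A submodule over the convergent series; its elements need not converge.\<close>

definition conv_module :: "series2 set \<Rightarrow> bool" where
  "conv_module J \<longleftrightarrow> 0 \<in> J \<and> (\<forall>a\<in>J. \<forall>b\<in>J. a + b \<in> J) \<and> (\<forall>r. convergent2 r \<longrightarrow> (\<forall>a\<in>J. r * a \<in> J))"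

lemma conv_moduleD:
  assumes "conv_module J"
  shows "0 \<in> J" "a \<in> J \<Longrightarrow> b \<in> J \<Longrightarrow> a + b \<in> J" "convergent2 r \<Longrightarrow> a \<in> J \<Longrightarrow> r * a \<in> J"
    "(\<And>k. k \<in> K \<Longrightarrow> f k \<in> J) \<Longrightarrow> sum f K \<in> J"
proof -
  show 1: "0 \<in> J" "a \<in> J \<Longrightarrow> b \<in> J \<Longrightarrow> a + b \<in> J" "convergent2 r \<Longrightarrow> a \<in> J \<Longrightarrow> r * a \<in> J" for a b r
    using assms by (auto simp: conv_module_def)
  show "(\<And>k. k \<in> K \<Longrightarrow> f k \<in> J) \<Longrightarrow> sum f K \<in> J"
    by (induction K rule: infinite_finite_induct) (auto intro: 1)
qed

text \<open>The generators are eliminated one by one instead of inverting a matrix: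
  \<open>1 - e p\<close> is a convergent unit, so \<open>x p\<close> can be solved for and
  substituted into the other relations, whose coefficients stay in the maximal ideal.\<close>

lemma nakayama:
  assumes J: "conv_module J" and "finite K"
    and "\<And>k. k \<in> K \<Longrightarrow> \<exists>e. (\<forall>l\<in>K. convergent2 (e l) \<and> e l $ 0 $ 0 = 0) \<and> x k - (\<Sum>l\<in>K. e l * x l) \<in> J"
  shows "k \<in> K \<Longrightarrow> x k \<in> J"
  using assms(2,3)
proof (induction K arbitrary: k rule: finite_induct)
  case (insert p K)
  note J' = conv_moduleD[OF J]
  have "\<exists>e. (\<forall>l\<in>insert p K. convergent2 (e l) \<and> e l $ 0 $ 0 = 0) \<and>
      x p - (\<Sum>l\<in>insert p K. e l * x l) \<in> J" by (rule insert.prems(2)) simp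
  then obtain e where e: "\<And>l. l \<in> insert p K \<Longrightarrow> convergent2 (e l) \<and> e l $ 0 $ 0 = 0"
    "x p - (\<Sum>l\<in>insert p K. e l * x l) \<in> J" by blast
  have "(1 - e p) $ 0 $ 0 \<noteq> 0" "convergent2 (1 - e p)"
    using e(1)[of p] convergent2_diff convergent2_1 by auto
  then obtain w where w: "(1 - e p) * w = 1" "convergent2 w" using unit_inverse by metis
  have "w * (x p - (\<Sum>l\<in>insert p K. e l * x l)) = ((1 - e p) * w) * x p - w * (\<Sum>l\<in>K. e l * x l)"
    using insert.hyps by (simp add: algebra_simps)
  also have "\<dots> = x p - (\<Sum>l\<in>K. w * e l * x l)"
    unfolding w(1) by (simp add: sum_distrib_left mult.assoc)
  finally have xp: "x p - (\<Sum>l\<in>K. w * e l * x l) \<in> J" using J'(3)[OF w(2) e(2)] by simp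
  have IH: "x k \<in> J" if "k \<in> K" for k
  proof (rule insert.IH[OF that])
    fix k assume "k \<in> K"
    then have "\<exists>e. (\<forall>l\<in>insert p K. convergent2 (e l) \<and> e l $ 0 $ 0 = 0) \<and>
      x k - (\<Sum>l\<in>insert p K. e l * x l) \<in> J" by (intro insert.prems(2)) simp
    then obtain d where d: "\<And>l. l \<in> insert p K \<Longrightarrow> convergent2 (d l) \<and> d l $ 0 $ 0 = 0"
      "x k - (\<Sum>l\<in>insert p K. d l * x l) \<in> J" by blast
    have eq: "x k - (\<Sum>l\<in>K. (d l + d p * (w * e l)) * x l) =
        (x k - (\<Sum>l\<in>insert p K. d l * x l)) + d p * (x p - (\<Sum>l\<in>K. w * e l * x l))"
      using insert.hyps by (simp add: distrib_right sum.distrib right_diff_distrib sum_distrib_left mult.assoc)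
    have "d p * (x p - (\<Sum>l\<in>K. w * e l * x l)) \<in> J" using J'(3) d(1) xp by blast
    then have "x k - (\<Sum>l\<in>K. (d l + d p * (w * e l)) * x l) \<in> J"
      unfolding eq by (rule J'(2)[OF d(2)])
    moreover have "\<forall>l\<in>K. convergent2 (d l + d p * (w * e l)) \<and> (d l + d p * (w * e l)) $ 0 $ 0 = 0"
      using d(1) e(1) w(2) by (auto intro!: convergent2_add convergent2_mult)
    ultimately show "\<exists>e. (\<forall>l\<in>K. convergent2 (e l) \<and> e l $ 0 $ 0 = 0) \<and> x k - (\<Sum>l\<in>K. e l * x l) \<in> J"
      by (intro exI[of _ "\<lambda>l. d l + d p * (w * e l)"]) blast
  qed
  have "(\<Sum>l\<in>K. w * e l * x l) \<in> J"
    using IH w(2) e(1) by (intro J'(4) J'(3) convergent2_mult) auto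
  from J'(2)[OF xp this] have "x p \<in> J" by simp
  then show ?case using IH insert.prems(1) by blast
qed simp

definition truncate2 :: "nat \<Rightarrow> series2 \<Rightarrow> series2" where
  "truncate2 P F = Abs_fps (\<lambda>i. Abs_fps (\<lambda>j. if i + j < P then F $ i $ j else 0))"

lemma truncate2_nth [simp]: "truncate2 P F $ i $ j = (if i + j < P then F $ i $ j else 0)"
  by (simp add: truncate2_def)

lemma diff_truncate2: "F - truncate2 P F \<in> order_ge P"
  by (simp add: order_ge_def)

lemma truncate2_order_ge: "F \<in> order_ge k \<Longrightarrow> truncate2 P F \<in> order_ge k"
  by (simp add: order_ge_def)

lemma convergent2_truncate2: "convergent2 (truncate2 P F)"
proof (rule convergent2I[of "\<Sum>p\<in>{..P} \<times> {..P}. norm (F $ fst p $ snd p)" 1])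
  fix i j
  show "norm (truncate2 P F $ i $ j) \<le> (\<Sum>p\<in>{..P} \<times> {..P}. norm (F $ fst p $ snd p)) * 1 ^ (i + j)"
  proof (cases "i + j < P")
    case True
    have "norm (F $ fst (i, j) $ snd (i, j)) \<le> (\<Sum>p\<in>{..P} \<times> {..P}. norm (F $ fst p $ snd p))"
      using True by (intro member_le_sum) auto
    then show ?thesis using True by simp
  qed (simp add: sum_nonneg)
qed (simp_all add: sum_nonneg)

definition conv_gen2_power :: "series2 \<Rightarrow> series2 \<Rightarrow> nat \<Rightarrow> series2 set" where
  "conv_gen2_power g h k = {F. \<exists>a b. convergent2 a \<and> convergent2 b \<and> a \<in> order_ge k \<and> b \<in> order_ge k \<and>
     F = a * g + b * h}"

lemma conv_gen2_powerI:
  "convergent2 a \<Longrightarrow> convergent2 b \<Longrightarrow> a \<in> order_ge k \<Longrightarrow> b \<in> order_ge k \<Longrightarrow>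
    F = a * g + b * h \<Longrightarrow> F \<in> conv_gen2_power g h k"
  unfolding conv_gen2_power_def by blast

lemma conv_gen2_powerE:
  assumes "F \<in> conv_gen2_power g h k"
  obtains a b where "convergent2 a" "convergent2 b" "a \<in> order_ge k" "b \<in> order_ge k" "F = a * g + b * h"
  using assms unfolding conv_gen2_power_def by blast

lemma conv_module_conv_gen2_power: "conv_module (conv_gen2_power g h k)"
  unfolding conv_module_def
proof (intro conjI ballI allI impI)
  show "0 \<in> conv_gen2_power g h k"
    by (rule conv_gen2_powerI[of 0 0]) (simp_all add: convergent2_0 zero_order_ge)
next
  fix F G assume "F \<in> conv_gen2_power g h k" "G \<in> conv_gen2_power g h k"
  then obtain a b a' b' where
    *: "convergent2 a" "convergent2 b" "a \<in> order_ge k" "b \<in> order_ge k" "F = a * g + b * h"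
       "convergent2 a'" "convergent2 b'" "a' \<in> order_ge k" "b' \<in> order_ge k" "G = a' * g + b' * h"
    by (blast elim: conv_gen2_powerE)
  show "F + G \<in> conv_gen2_power g h k"
    by (rule conv_gen2_powerI[of "a + a'" "b + b'"])
      (simp_all add: * convergent2_add order_ge_add algebra_simps)
next
  fix r F assume r: "convergent2 r" and "F \<in> conv_gen2_power g h k"
  then obtain a b where
    *: "convergent2 a" "convergent2 b" "a \<in> order_ge k" "b \<in> order_ge k" "F = a * g + b * h"
    by (blast elim: conv_gen2_powerE)
  show "r * F \<in> conv_gen2_power g h k"
  proof (rule conv_gen2_powerI[of "r * a" "r * b"])
    show "r * F = r * a * g + r * b * h" by (simp add: * algebra_simps)
  qed (simp_all only: * r convergent2_mult order_ge_mult_left)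
qed

text \<open>Once \<open>x^a\<close> and \<open>y^b\<close> lie in \<open>J\<close>, so does every
  monomial of degree \<open>a + b\<close>, being divisible by one of them.\<close>

lemma order_ge_subset_ideal:
  assumes J: "is_ideal J" and n: "codim J n"
  obtains M where "order_ge M \<subseteq> J"
proof -
  obtain a where a: "fps_X ^ a \<in> J" using power_mem_finite_codim[OF J n, of fps_X] by auto
  obtain b where b: "var_y ^ b \<in> J" using power_mem_finite_codim[OF J n, of var_y] by (auto simp: var_y_def)
  note J' = is_idealD[OF J]
  have mon: "monomial (a + b) l \<in> J" if "l \<le> a + b" for l
  proof (cases "a \<le> l")
    case True
    then have "fps_X ^ l = (fps_X ^ (l - a) * fps_X ^ a :: series2)" by (simp flip: power_add)
    then show ?thesis using J'(3)[OF a, of "fps_X ^ (l - a)"] J'(4) by metis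
  next
    case False
    then have "a + b - l = (a + b - l - b) + b" by simp
    then have "var_y ^ (a + b - l) = var_y ^ ((a + b - l - b) + b)" by (rule arg_cong)
    then have "var_y ^ (a + b - l) = var_y ^ (a + b - l - b) * var_y ^ b" by (simp only: power_add)
    then show ?thesis using J'(3)[OF b, of "var_y ^ (a + b - l - b)"] J'(3) by metis
  qed
  have "F \<in> J" if F: "F \<in> order_ge (a + b)" for F
  proof -
    obtain e where e: "F = (\<Sum>l\<le>a + b. e l * monomial (a + b) l)"
      using order_ge_monomial_sum[of F "a + b" 0] F by auto
    have "(\<Sum>l\<in>A. e l * monomial (a + b) l) \<in> J" if "A \<subseteq> {..a + b}" for A
      using that
    proof (induction A rule: infinite_finite_induct)
      case (insert l A)
      then have "e l * monomial (a + b) l \<in> J" using J'(3)[OF mon] by simp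
      then show ?case using insert J'(2) by simp
    qed (simp_all add: J'(1))
    then show ?thesis unfolding e by simp
  qed
  then show ?thesis using that by blast
qed

text \<open>Truncating the coefficients gives \<open>\<mm>^M \<subseteq> J + \<mm>^(M+1)\<close> over the convergent series, and Nakayama's
  lemma removes the second summand.\<close>

lemma convergent_part_gen2_power:
  assumes g: "convergent2 g" and h: "convergent2 h"
    and M: "order_ge M \<subseteq> gen2_power g h k"
  shows "conv_gen2_power g h k = {F \<in> gen2_power g h k. convergent2 F}"
proof
  show "conv_gen2_power g h k \<subseteq> {F \<in> gen2_power g h k. convergent2 F}"
    unfolding conv_gen2_power_def gen2_power_def
    using g h by (blast intro: convergent2_add convergent2_mult)
  note J = conv_moduleD[OF conv_module_conv_gen2_power[of g h k]]
  have approx: "\<exists>G\<in>conv_gen2_power g h k. F - G \<in> order_ge P \<and> convergent2 (F - G)"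
    if F: "F \<in> gen2_power g h k" "convergent2 F" for F P
  proof -
    obtain a b where ab: "a \<in> order_ge k" "b \<in> order_ge k" "F = a * g + b * h"
      using F(1) unfolding gen2_power_def by blast
    define G where "G = truncate2 P a * g + truncate2 P b * h"
    have G: "G \<in> conv_gen2_power g h k"
      by (rule conv_gen2_powerI[of "truncate2 P a" "truncate2 P b"])
        (simp_all add: convergent2_truncate2 truncate2_order_ge ab G_def)
    have "F - G = (a - truncate2 P a) * g + (b - truncate2 P b) * h"
      by (simp add: ab G_def algebra_simps)
    also have "\<dots> = g * (a - truncate2 P a) + h * (b - truncate2 P b)" by (simp only: mult.commute)
    also have "\<dots> \<in> order_ge P"
      by (intro order_ge_add order_ge_mult_left diff_truncate2)
    finally have "F - G \<in> order_ge P" .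
    moreover have "convergent2 (F - G)"
      unfolding G_def by (intro convergent2_diff convergent2_add convergent2_mult convergent2_truncate2 g h F)
    ultimately show ?thesis using G by blast
  qed
  have mon: "monomial M l \<in> conv_gen2_power g h k" if "l \<in> {..M}" for l
  proof (rule nakayama[OF conv_module_conv_gen2_power finite_atMost _ that])
    fix l assume "l \<in> {..M}"
    then have "monomial M l \<in> gen2_power g h k" using M monomial_order_ge by auto
    then obtain G where G: "G \<in> conv_gen2_power g h k" "monomial M l - G \<in> order_ge (M + 1)"
      "convergent2 (monomial M l - G)" using approx convergent2_monomial by blast
    obtain e where e: "monomial M l - G = (\<Sum>i\<le>M. e i * monomial M i)"
      "\<And>i. e i \<in> order_ge 1" "\<And>i. convergent2 (e i)"
      using order_ge_monomial_sum[OF G(2)] G(3) by blast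
    have "monomial M l - (\<Sum>i\<le>M. e i * monomial M i) = G" unfolding e(1)[symmetric] by simp
    moreover have "e i $ 0 $ 0 = 0" for i using e(2)[of i] by (simp add: order_ge_def)
    ultimately show "\<exists>e. (\<forall>i\<in>{..M}. convergent2 (e i) \<and> e i $ 0 $ 0 = 0) \<and>
        monomial M l - (\<Sum>i\<in>{..M}. e i * monomial M i) \<in> conv_gen2_power g h k"
      using e(3) G(1) by (intro exI[of _ e]) simp
  qed
  show "{F \<in> gen2_power g h k. convergent2 F} \<subseteq> conv_gen2_power g h k"
  proof safe
    fix F assume "F \<in> gen2_power g h k" "convergent2 F"
    then obtain G where G: "G \<in> conv_gen2_power g h k" "F - G \<in> order_ge M" "convergent2 (F - G)"
      using approx by blast
    obtain e where e: "F - G = (\<Sum>i\<le>M. e i * monomial M i)" "\<And>i. convergent2 (e i)"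
      using order_ge_monomial_sum[of "F - G" M 0] G(2,3) by auto
    have "F - G \<in> conv_gen2_power g h k"
      unfolding e(1) by (rule J(4)) (rule J(3)[OF e(2) mon])
    from J(2)[OF G(1) this] show "F \<in> conv_gen2_power g h k" by simp
  qed
qed

lemma ideal_O2I:
  assumes "J \<subseteq> {F. convergent2 F}" "conv_module J"
  shows "ideal J O2"
proof (rule idealI[OF O2.ring_axioms])
  note J = conv_moduleD[OF assms(2)]
  have neg: "- F \<in> J" if "F \<in> J" for F
    using J(3)[OF _ that, of "- 1"] convergent2_uminus[OF convergent2_1] by simp
  show "subgroup J (add_monoid O2)"
  proof
    fix F assume F: "F \<in> J"
    then have "convergent2 F" using assms(1) by blast
    then have "inv\<^bsub>add_monoid O2\<^esub> F = - F"
      using O2.minus_equality[of "- F" F] by (simp add: a_inv_def convergent2_uminus)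
    then show "inv\<^bsub>add_monoid O2\<^esub> F \<in> J" using neg[OF F] by simp
  qed (use assms(1) J in auto)
  fix F G assume "F \<in> J" "G \<in> carrier O2"
  then show "G \<otimes>\<^bsub>O2\<^esub> F \<in> J" "F \<otimes>\<^bsub>O2\<^esub> G \<in> J"
    using J(3)[of G F] by (simp_all add: mult.commute)
qed

section \<open>Identification with the ideals of the statement\<close>

lemma max_ideal_power_eq: "max_ideal_power k = {F. convergent2 F \<and> F \<in> order_ge k}"
proof (induction k)
  case 0
  then show ?case by (auto simp: max_ideal_power_0)
next
  case (Suc k)
  show ?case
  proof
    show "max_ideal_power (Suc k) \<subseteq> {F. convergent2 F \<and> F \<in> order_ge (Suc k)}"
    proof
      fix F assume "F \<in> max_ideal_power (Suc k)"
      then have "F \<in> max_ideal_power k \<cdot>\<^bsub>O2\<^esub> max_ideal" by (simp add: max_ideal_power_Suc)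
      then show "F \<in> {F. convergent2 F \<and> F \<in> order_ge (Suc k)}"
      proof (induction F rule: ideal_prod.induct)
        case (prod i j)
        then have "convergent2 i" "i \<in> order_ge k" "convergent2 j" "j \<in> order_ge 1"
          using Suc.IH by (auto simp: max_ideal_def order_ge_def)
        then show ?case using order_ge_mult[of i k j 1] by (simp add: convergent2_mult)
      next
        case (sum s1 s2)
        then show ?case by (simp add: convergent2_add order_ge_add)
      qed
    qed
    show "{F. convergent2 F \<and> F \<in> order_ge (Suc k)} \<subseteq> max_ideal_power (Suc k)"
    proof safe
      fix F assume F: "convergent2 F" "F \<in> order_ge (Suc k)"
      obtain A B where AB: "F = A * fps_X + B * var_y" "A \<in> order_ge k" "B \<in> order_ge k"
        "convergent2 A" "convergent2 B" using order_ge_Suc_split[OF F(2)] F(1) by metis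
      have "fps_X \<in> max_ideal" "var_y \<in> max_ideal"
        by (simp_all add: max_ideal_def convergent2_X convergent2_var_y) (simp add: var_y_def)
      then have "(A \<otimes>\<^bsub>O2\<^esub> fps_X) \<oplus>\<^bsub>O2\<^esub> (B \<otimes>\<^bsub>O2\<^esub> var_y) \<in> max_ideal_power k \<cdot>\<^bsub>O2\<^esub> max_ideal"
        using AB Suc.IH by (intro ideal_prod.intros) auto
      then show "F \<in> max_ideal_power (Suc k)" by (simp add: AB(1) max_ideal_power_Suc)
    qed
  qed
qed

lemma genideal_pair:
  assumes "convergent2 g" "convergent2 h"
  shows "Idl\<^bsub>O2\<^esub> {g, h} = conv_gen2_power g h 0"
proof
  have "ideal (conv_gen2_power g h 0) O2"
    by (rule ideal_O2I[OF _ conv_module_conv_gen2_power])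
      (use assms in \<open>auto elim!: conv_gen2_powerE intro!: convergent2_add convergent2_mult\<close>)
  moreover have "g \<in> conv_gen2_power g h 0"
    by (rule conv_gen2_powerI[of 1 0]) (simp_all add: convergent2_0 convergent2_1)
  moreover have "h \<in> conv_gen2_power g h 0"
    by (rule conv_gen2_powerI[of 0 1]) (simp_all add: convergent2_0 convergent2_1)
  ultimately show "Idl\<^bsub>O2\<^esub> {g, h} \<subseteq> conv_gen2_power g h 0"
    by (intro O2.genideal_minimal) auto
  have id: "ideal (Idl\<^bsub>O2\<^esub> {g, h}) O2" using assms by (intro O2.genideal_ideal) auto
  have gh: "g \<in> Idl\<^bsub>O2\<^esub> {g, h}" "h \<in> Idl\<^bsub>O2\<^esub> {g, h}"
    using O2.genideal_self[of "{g, h}"] assms by auto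
  show "conv_gen2_power g h 0 \<subseteq> Idl\<^bsub>O2\<^esub> {g, h}"
  proof
    fix F assume "F \<in> conv_gen2_power g h 0"
    then obtain a b where ab: "convergent2 a" "convergent2 b" "F = a * g + b * h"
      by (rule conv_gen2_powerE)
    have "a \<otimes>\<^bsub>O2\<^esub> g \<in> Idl\<^bsub>O2\<^esub> {g, h}" "b \<otimes>\<^bsub>O2\<^esub> h \<in> Idl\<^bsub>O2\<^esub> {g, h}"
      using ideal.I_l_closed[OF id] gh ab by auto
    from additive_subgroup.a_closed[OF ideal.axioms(1)[OF id] this]
    show "F \<in> Idl\<^bsub>O2\<^esub> {g, h}" by (simp add: ab)
  qed
qed

lemma ideal_prod_pair:
  assumes "convergent2 g" "convergent2 h"
  shows "(Idl\<^bsub>O2\<^esub> {g, h}) \<cdot>\<^bsub>O2\<^esub> max_ideal_power k = conv_gen2_power g h k"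
proof
  note J = conv_moduleD[OF conv_module_conv_gen2_power[of g h k]]
  show "(Idl\<^bsub>O2\<^esub> {g, h}) \<cdot>\<^bsub>O2\<^esub> max_ideal_power k \<subseteq> conv_gen2_power g h k"
  proof
    fix F assume "F \<in> (Idl\<^bsub>O2\<^esub> {g, h}) \<cdot>\<^bsub>O2\<^esub> max_ideal_power k"
    then show "F \<in> conv_gen2_power g h k"
    proof (induction F rule: ideal_prod.induct)
      case (prod i j)
      obtain a b where ab: "convergent2 a" "convergent2 b" "i = a * g + b * h"
        using prod(1) unfolding genideal_pair[OF assms] by (rule conv_gen2_powerE)
      have j: "convergent2 j" "j \<in> order_ge k" using prod(2) by (auto simp: max_ideal_power_eq)
      show ?case
      proof (rule conv_gen2_powerI[of "a * j" "b * j"])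
        show "i \<otimes>\<^bsub>O2\<^esub> j = a * j * g + b * j * h" by (simp add: ab algebra_simps)
      qed (simp_all only: ab j convergent2_mult order_ge_mult_left)
    next
      case (sum s1 s2)
      then show ?case using J(2) by simp
    qed
  qed
  show "conv_gen2_power g h k \<subseteq> (Idl\<^bsub>O2\<^esub> {g, h}) \<cdot>\<^bsub>O2\<^esub> max_ideal_power k"
  proof
    fix F assume "F \<in> conv_gen2_power g h k"
    then obtain a b where ab: "convergent2 a" "convergent2 b" "a \<in> order_ge k" "b \<in> order_ge k"
      "F = a * g + b * h" by (rule conv_gen2_powerE)
    have "g \<in> Idl\<^bsub>O2\<^esub> {g, h}" "h \<in> Idl\<^bsub>O2\<^esub> {g, h}"
      using O2.genideal_self[of "{g, h}"] assms by auto
    moreover have "a \<in> max_ideal_power k" "b \<in> max_ideal_power k"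
      using ab by (auto simp: max_ideal_power_eq)
    ultimately have "(g \<otimes>\<^bsub>O2\<^esub> a) \<oplus>\<^bsub>O2\<^esub> (h \<otimes>\<^bsub>O2\<^esub> b) \<in> (Idl\<^bsub>O2\<^esub> {g, h}) \<cdot>\<^bsub>O2\<^esub> max_ideal_power k"
      by (intro ideal_prod.intros)
    then show "F \<in> (Idl\<^bsub>O2\<^esub> {g, h}) \<cdot>\<^bsub>O2\<^esub> max_ideal_power k"
      by (simp add: ab(5) mult.commute)
  qed
qed

text \<open>A power of the maximal ideal inside the formal ideal serves twice: it makes truncations
  dense, and it identifies the convergent ideal with the convergent part of the formal one.\<close>

theorem has_codim_pair:
  assumes g: "convergent2 g" and h: "convergent2 h" and n: "codim (gen2_power g h k) n"
  shows "has_codim ((Idl\<^bsub>O2\<^esub> {g, h}) \<cdot>\<^bsub>O2\<^esub> max_ideal_power k) n"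
proof -
  obtain M where M: "order_ge M \<subseteq> gen2_power g h k"
    using order_ge_subset_ideal[OF is_ideal_gen2_power n] .
  note eq = convergent_part_gen2_power[OF g h M]
  show ?thesis
    unfolding ideal_prod_pair[OF g h]
  proof (rule has_codimI[OF _ eq is_idealD(6)[OF is_ideal_gen2_power] n])
    show "ideal (conv_gen2_power g h k) O2"
      by (rule ideal_O2I[OF _ conv_module_conv_gen2_power]) (use eq in blast)
    show "\<exists>G. convergent2 G \<and> F - G \<in> gen2_power g h k" for F
      using convergent2_truncate2 diff_truncate2 M by blast
  qed
qed

text \<open>If both derivatives vanished on \<open>y = 0\<close>, then \<open>y^2\<close> would
  divide \<open>f\<close>. The nonzero coefficient found here makes \<open>s f_x + f_y\<close>
  regular in \<open>x\<close> for all but at most one \<open>s\<close>.\<close>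

lemma reduced_restrict_deriv:
  assumes "convergent2 f" "reduced_equation f"
  obtains k where "restrict_x (dx f) $ k \<noteq> 0 \<or> restrict_x (dy f) $ k \<noteq> 0"
proof (rule ccontr)
  assume "\<not> thesis"
  then have z: "restrict_x (dx f) $ k = 0" "restrict_x (dy f) $ k = 0" for k using that by blast+
  have "f $ i $ 0 = 0" for i
  proof (cases i)
    case 0
    then show ?thesis using assms(2) by (simp add: reduced_equation_def max_ideal_def)
  next
    case (Suc m)
    have "(of_nat (Suc m) * f $ Suc m) $ 0 = 0" using z(1)[of m] by (simp add: dx_def del: of_nat_Suc)
    then have "of_nat (Suc m) * f $ Suc m $ 0 = 0" by (simp add: fps_mult_nth_0 del: of_nat_Suc)
    then show ?thesis using Suc by (simp del: of_nat_Suc)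
  qed
  then have "restrict_x f = 0" by (intro fps_ext) simp
  then obtain F where F: "f = var_y * F" "convergent2 f \<Longrightarrow> convergent2 F" "\<And>i j. F $ i $ j = f $ i $ Suc j"
    by (rule divide_by_var_y) blast
  \<comment> \<open>On \<open>y = 0\<close> the derivative \<open>f_y\<close> coincides with
    \<open>F = f / y\<close>, so a second factor \<open>y\<close> splits off.\<close>
  have "restrict_x F = 0" using z(2) by (intro fps_ext) (simp add: F(3))
  then obtain G where G: "F = var_y * G" "convergent2 F \<Longrightarrow> convergent2 G"
    by (rule divide_by_var_y) blast
  have "(var_y \<otimes>\<^bsub>O2\<^esub> var_y) divides\<^bsub>O2\<^esub> f"
    using F(1,2) G assms(1) by (auto simp: factor_def mult.assoc)
  then have "var_y \<in> Units O2" using assms(2) convergent2_var_y by (simp add: reduced_equation_def)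
  then show False by (simp add: Units_O2_iff var_y_def)
qed

lemma deriv_order_ge:
  assumes "f \<in> order_ge (Suc d)" shows "dx f \<in> order_ge d" "dy f \<in> order_ge d"
proof -
  have "(of_nat n * c) $ j = of_nat n * c $ j" for n j and c :: "complex fps"
    by (induction n) (simp_all add: distrib_right)
  then have "dx f $ i $ j = of_nat (Suc i) * f $ Suc i $ j" for i j
    by (simp add: dx_def del: of_nat_Suc)
  then show "dx f \<in> order_ge d" "dy f \<in> order_ge d"
    using assms by (auto simp: order_ge_def simp del: of_nat_Suc)
qed

text \<open>The two pairs of generators differ by an invertible constant matrix, which preserves the
  order of the coefficients.\<close>

lemma gen2_power_dir_deriv: "gen2_power (dir_deriv s f) (dx f) k = gen2_power (dx f) (dy f) k"
proof safe
  fix F assume "F \<in> gen2_power (dir_deriv s f) (dx f) k"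
  then obtain a b where ab: "a \<in> order_ge k" "b \<in> order_ge k" "F = a * dir_deriv s f + b * dx f"
    unfolding gen2_power_def by blast
  have "F = (const2 s * a + b) * dx f + a * dy f" by (simp add: ab dir_deriv_def algebra_simps)
  moreover have "const2 s * a + b \<in> order_ge k" using ab by (intro order_ge_add order_ge_mult_left)
  ultimately show "F \<in> gen2_power (dx f) (dy f) k" unfolding gen2_power_def using ab(1) by blast
next
  fix F assume "F \<in> gen2_power (dx f) (dy f) k"
  then obtain a b where ab: "a \<in> order_ge k" "b \<in> order_ge k" "F = a * dx f + b * dy f"
    unfolding gen2_power_def by blast
  have "F = b * dir_deriv s f + (a - const2 s * b) * dx f" by (simp add: ab dir_deriv_def algebra_simps)
  moreover have "a - const2 s * b \<in> order_ge k" using ab by (intro order_ge_diff order_ge_mult_left)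
  ultimately show "F \<in> gen2_power (dir_deriv s f) (dx f) k" unfolding gen2_power_def using ab(2) by blast
qed

lemma gen2_power_scale:
  assumes "c \<noteq> 0" shows "gen2_power (const2 c * g) h k = gen2_power g h k"
proof safe
  fix F assume "F \<in> gen2_power (const2 c * g) h k"
  then obtain a b where ab: "a \<in> order_ge k" "b \<in> order_ge k" "F = a * (const2 c * g) + b * h"
    unfolding gen2_power_def by blast
  have "F = (const2 c * a) * g + b * h" by (simp add: ab(3) mult_ac)
  then show "F \<in> gen2_power g h k" unfolding gen2_power_def using ab order_ge_mult_left by blast
next
  fix F assume "F \<in> gen2_power g h k"
  then obtain a b where ab: "a \<in> order_ge k" "b \<in> order_ge k" "F = a * g + b * h"
    unfolding gen2_power_def by blast
  have "(const2 (1 / c) * a) * (const2 c * g) = (const2 (1 / c) * const2 c) * (a * g)"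
    by (simp only: mult_ac)
  also have "const2 (1 / c) * const2 c = 1" using assms by (simp flip: const2_mult)
  finally have "F = (const2 (1 / c) * a) * (const2 c * g) + b * h" using ab(3) by simp
  then show "F \<in> gen2_power (const2 c * g) h k" unfolding gen2_power_def using ab order_ge_mult_left by blast
qed

text \<open>The passage to the \<open>k\<close>-th power adds the same constant \<open>C\<close> for
  \<open>h = f\<close> and for \<open>h = f_x\<close>, so the difference
  \<open>d = \<nu> - 1\<close> from the case \<open>k = 0\<close> persists.\<close>

lemma polar_codim:
  assumes f: "convergent2 f" "reduced_equation f" "f \<in> order_ge (Suc d)"
    and s: "eval_x (line s) f $ Suc d \<noteq> 0" "restrict_x (dir_deriv s f) \<noteq> 0"
  shows "\<exists>m. codim (gen2_power (dx f) (dy f) k) m \<and> codim (gen2_power (dir_deriv s f) f k) (m + d)"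
proof -
  let ?g = "dir_deriv s f"
  have sub: "subdegree (eval_x (line s) f) = Suc d"
    using s(1) eval_x_line_order[OF f(3)] by (intro subdegreeI) auto
  have nz: "eval_x (line s) f \<noteq> 0" using s(1) by auto
  obtain q where q: "codim (gen2 ?g (dx f)) q" "codim (gen2 ?g f) (q + d)"
    using polar_intersection_0[OF f(1,2) nz sub s(2)] by blast
  have "?g \<in> order_ge d"
    unfolding dir_deriv_def using deriv_order_ge[OF f(3)] by (intro order_ge_add order_ge_mult_left)
  \<comment> \<open>The order of \<open>g\<close> is exactly \<open>d\<close> because its
    restriction to the non-tangent line, the derivative of that of \<open>f\<close>, has a term of
    degree \<open>d\<close>.\<close>
  moreover have "?g \<notin> order_ge (Suc d)"
  proof
    assume "?g \<in> order_ge (Suc d)"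
    then have "eval_x (line s) ?g $ d = 0" using eval_x_line_order by blast
    then have "of_nat (Suc d) * eval_x (line s) f $ Suc d = 0"
      by (simp add: eval_x_dir_deriv del: of_nat_Suc)
    then show False using s(1) by (simp del: of_nat_Suc)
  qed
  ultimately obtain C where C: "\<And>h n. h \<in> order_ge d \<Longrightarrow> codim (gen2 ?g h) n \<Longrightarrow>
      codim (gen2_power ?g h k) (n + C)"
    using codim_gen2_power[OF _ _ s(2), of d k] by blast
  have "f \<in> order_ge d" using f(3) order_ge_antimono[of d "Suc d"] by auto
  then have "codim (gen2_power ?g f k) (q + d + C)" using C q(2) by blast
  moreover have "codim (gen2_power (dx f) (dy f) k) (q + C)"
    using C[OF deriv_order_ge(1)[OF f(3)] q(1)] by (simp add: gen2_power_dir_deriv)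
  ultimately show ?thesis by (intro exI[of _ "q + C"]) (simp add: ac_simps)
qed

lemma vanishing_order_attained:
  assumes "F \<noteq> 0" shows "\<exists>i j. i + j = vanishing_order F \<and> F $ i $ j \<noteq> 0"
proof -
  have "\<exists>i j. F $ i $ j \<noteq> 0"
  proof (rule ccontr)
    assume "\<not> (\<exists>i j. F $ i $ j \<noteq> 0)"
    then have "F $ i $ j = 0" for i j by blast
    then have "F = 0" by (intro fps_ext) simp
    then show False using assms by contradiction
  qed
  then have "\<exists>n i j. i + j = n \<and> F $ i $ j \<noteq> 0" by blast
  then show ?thesis unfolding vanishing_order_def by (rule LeastI_ex)
qed

lemma order_ge_vanishing_order: "F \<in> order_ge (vanishing_order F)"
  unfolding vanishing_order_def order_ge_def using not_less_Least by blast

text \<open>The degree is one more than that of \<open>H\<close>, so that the form also vanishes at \<open>\<beta> = 0\<close>.\<close>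

lemma binary_form_homogenization:
  "binary_form (Suc (degree H), coeff H) \<alpha> \<beta> = (if \<beta> = 0 then 0 else \<beta> ^ Suc (degree H) * poly H (\<alpha> / \<beta>))"
proof (cases "\<beta> = 0")
  case True
  then have z: "coeff H i * \<alpha> ^ i * \<beta> ^ (Suc (degree H) - i) = 0" if "i \<le> Suc (degree H)" for i
    using that by (cases "i = Suc (degree H)") (auto simp: coeff_eq_0)
  have "binary_form (Suc (degree H), coeff H) \<alpha> \<beta> = 0"
    unfolding binary_form_def fst_conv snd_conv by (rule sum.neutral) (use z in blast)
  then show ?thesis using True by simp
next
  case False
  have "binary_form (Suc (degree H), coeff H) \<alpha> \<beta> = (\<Sum>i\<le>degree H. coeff H i * \<alpha> ^ i * \<beta> ^ (Suc (degree H) - i))"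
    by (simp add: binary_form_def coeff_eq_0)
  also have "\<dots> = (\<Sum>i\<le>degree H. \<beta> ^ Suc (degree H) * (coeff H i * (\<alpha> / \<beta>) ^ i))"
    using False by (intro sum.cong refl) (simp add: power_diff field_simps)
  finally show ?thesis using False by (simp add: poly_altdef sum_distrib_left)
qed

theorem lemma9p2:
  fixes f :: series2
  assumes "f \<in> carrier O2" and "reduced_equation f"
  shows "\<forall>k. \<exists>i m. is_polar_intersection k f i \<and> is_mu k f m \<and>
               int i = int m + int (vanishing_order f) - 1"
proof
  fix k
  have cf: "convergent2 f" using assms(1) by simp
  note red = assms(2)
  have f0: "f \<noteq> 0" "f $ 0 $ 0 = 0" using red by (simp_all add: reduced_equation_def max_ideal_def)
  define \<nu> where "\<nu> = vanishing_order f"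
  obtain i j where ij: "i + j = \<nu>" "f $ i $ j \<noteq> 0"
    using vanishing_order_attained[OF f0(1)] unfolding \<nu>_def by blast
  have f\<nu>: "f \<in> order_ge \<nu>" unfolding \<nu>_def by (rule order_ge_vanishing_order)
  have "\<nu> \<noteq> 0"
  proof
    assume "\<nu> = 0"
    then have "i = 0" "j = 0" using ij(1) by auto
    then show False using ij(2) f0(2) by simp
  qed
  then obtain d where d: "\<nu> = Suc d" using not0_implies_Suc by blast
  obtain r where r: "restrict_x (dx f) $ r \<noteq> 0 \<or> restrict_x (dy f) $ r \<noteq> 0"
    using reduced_restrict_deriv[OF cf red] .
  \<comment> \<open>A nonzero value at \<open>s\<close> encodes both genericity conditions: the
    first factor says that \<open>x = s y\<close> is not tangent to the curve, the second is the
    coefficient at \<open>x^r\<close> of \<open>s f_x + f_y\<close> on \<open>y = 0\<close>.\<close>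
  define H where "H = leading_poly \<nu> f * [:restrict_x (dy f) $ r, restrict_x (dx f) $ r:]"
  have "[:restrict_x (dy f) $ r, restrict_x (dx f) $ r:] \<noteq> 0" using r by (simp only: pCons_eq_0_iff) blast
  then have "H \<noteq> 0" unfolding H_def by (rule no_zero_divisors[OF leading_poly_nonzero[OF ij]])
  then obtain s0 where s0: "poly H s0 \<noteq> 0" by (rule poly_nonroot)
  have codims: "\<exists>m. codim (gen2_power (dx f) (dy f) k) m \<and> codim (gen2_power (dir_deriv s f) f k) (m + d)"
    if "poly H s \<noteq> 0" for s
  proof (rule polar_codim[OF cf red])
    show "f \<in> order_ge (Suc d)" using f\<nu> d by simp
    show "eval_x (line s) f $ Suc d \<noteq> 0" using that d by (auto simp: H_def poly_leading_poly)
    have "poly H s = poly (leading_poly \<nu> f) s * (restrict_x (dy f) $ r + s * restrict_x (dx f) $ r)"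
      unfolding H_def by (simp only: poly_mult poly_pCons poly_0 mult_zero_right add_0_right)
    also have "restrict_x (dy f) $ r + s * restrict_x (dx f) $ r = restrict_x (dir_deriv s f) $ r"
      by (simp add: dir_deriv_def)
    finally have "restrict_x (dir_deriv s f) $ r \<noteq> 0" using that by auto
    then show "restrict_x (dir_deriv s f) \<noteq> 0" by (metis fps_zero_nth)
  qed
  then obtain m where m: "codim (gen2_power (dx f) (dy f) k) m" using s0 by blast
  have "is_mu k f m"
    unfolding is_mu_def by (rule has_codim_pair[OF convergent2_dx[OF cf] convergent2_dy[OF cf] m])
  moreover have "is_polar_intersection k f (m + d)"
  proof -
    define q where "q = (Suc (degree H), coeff H)"
    define U where "U = {p \<in> P1. \<exists>q\<in>{q}. \<forall>(\<alpha>, \<beta>)\<in>p. binary_form q \<alpha> \<beta> \<noteq> 0}"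
    have "zariski_open U" unfolding zariski_open_def U_def by blast
    moreover have "hpoint s0 1 \<in> U"
    proof -
      have "hpoint s0 1 \<in> P1" unfolding P1_def by fastforce
      moreover have "binary_form q (c * s0) (c * 1) \<noteq> 0" if "c \<noteq> 0" for c
        unfolding q_def binary_form_homogenization using that s0 by simp
      ultimately show ?thesis unfolding U_def hpoint_def by blast
    qed
    moreover have "has_codim ((Idl\<^bsub>O2\<^esub> {const2 \<alpha> * dx f + const2 \<beta> * dy f, f}) \<cdot>\<^bsub>O2\<^esub> max_ideal_power k) (m + d)"
      if "hpoint \<alpha> \<beta> \<in> U" for \<alpha> \<beta>
    proof -
      have "(\<alpha>, \<beta>) \<in> hpoint \<alpha> \<beta>" unfolding hpoint_def by (auto intro!: exI[of _ 1])
      then have "binary_form q \<alpha> \<beta> \<noteq> 0" using that unfolding U_def by blast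
      then have \<beta>: "\<beta> \<noteq> 0" "poly H (\<alpha> / \<beta>) \<noteq> 0"
        by (auto simp: q_def binary_form_homogenization split: if_splits)
      obtain m' where m': "codim (gen2_power (dx f) (dy f) k) m'"
        "codim (gen2_power (dir_deriv (\<alpha> / \<beta>) f) f k) (m' + d)" using codims[OF \<beta>(2)] by blast
      \<comment> \<open>The ideal of \<open>f_x\<close> and \<open>f_y\<close> does not involve the
        direction, so one number serves all points of \<open>U\<close>.\<close>
      have "m' = m" using codim_unique[OF is_ideal_gen2_power m m'(1)] .
      have "const2 \<alpha> = const2 \<beta> * const2 (\<alpha> / \<beta>)" using \<beta>(1) by (simp flip: const2_mult)
      then have eq: "const2 \<alpha> * dx f + const2 \<beta> * dy f = const2 \<beta> * dir_deriv (\<alpha> / \<beta>) f"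
        by (simp only: dir_deriv_def distrib_left mult.assoc)
      have "codim (gen2_power (const2 \<beta> * dir_deriv (\<alpha> / \<beta>) f) f k) (m + d)"
        unfolding gen2_power_scale[OF \<beta>(1)] using m'(2) unfolding \<open>m' = m\<close> .
      then show ?thesis
        unfolding eq
        by (rule has_codim_pair[OF convergent2_mult[OF convergent2_const2 convergent2_dir_deriv[OF cf]] cf])
    qed
    ultimately show ?thesis unfolding is_polar_intersection_def by blast
  qed
  moreover have "int (m + d) = int m + int (vanishing_order f) - 1"
    using d by (simp add: \<nu>_def)
  ultimately show "\<exists>i m. is_polar_intersection k f i \<and> is_mu k f m \<and>
      int i = int m + int (vanishing_order f) - 1" by blast
qed

end
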